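(* Let $j_X:X\hookrightarrow H_{\rm RT}(X,\Omega)$, $x\mapsto\bullet_x$, be the natural embedding. (1) The sextuple $(H_{\rm RT}(X,\Omega),\,m_{\rm RT},\,1,\,\Delta_{\rm RT},\,\varepsilon_{\rm RT},\,(B^+_\omega)_{\omega\in\Omega})$ together with $j_X$ is the free $\Omega$-cocycle bialgebra on $X$ (with respect to the weights $\lambda_\Omega=(\lambda_\omega)_{\omega\in\Omega}$ and $(\mu_x)_{x\in X}$). That is, it is an $\Omega$-cocycle bialgebra of weight $\lambda_\Omega$, and for every $\Omega$-cocycle bialgebra $(A,m,1_A,\Delta,\varepsilon,(P_\omega)_{\omega\in\Omega})$ of weight $\lambda_\Omega$ and every set map $f:X\to A$ satisfying $\Delta(f(x))=f(x)\otimes 1_A+1_A\otimes f(x)+\mu_x\,1_A\otimes 1_A$ for all $x\in X$, there is a unique homomorphism $\bar f:H_{\rm RT}(X,\Omega)\to A$ of $\Omega$-operated bialgebras such that $\bar f j_X=f$. (2) The Hopf algebra given by the connected cofiltered coaugmented bialgebra $(H_{\rm RT}(X,\Omega),\,m_{\rm RT},\,1,\,\Delta_{\rm RT},\,\varepsilon_{\rm RT},\,(B^+_\omega)_{\omega\in\Omega})$ together with $j_X$ is the free $\Omega$-cocycle Hopf algebra on $X$, i.e. it is an $\Omega$-cocycle Hopf algebra of weight $\lambda_\Omega$ with the same universal property among $\Omega$-cocycle Hopf algebras of weight $\lambda_\Omega$.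
   Context: Let $\mathbf{k}$ be a unitary commutative ring, $X$ a set, $\Omega$ a nonempty set disjoint from $X$, and fix maps $\mu:X\to\mathbf{k}$, $x\mapsto\mu_x$, and $\lambda:\Omega\to\mathbf{k}$, $\omega\mapsto\lambda_\omega$. All algebras are unitary and associative. Decorated forests. An $(X,\Omega)$-decorated rooted tree is a (nonempty) planar rooted tree whose internal (non-leaf) vertices are decorated by elements of $\Omega$ and whose leaf vertices are decorated by elements of $X\sqcup\Omega$; the only vertex of a one-vertex tree is regarded as a leaf. $\mathcal{T}_{\rm RT}(X,\Omega)$ is the set of such trees, and $\mathcal{F}_{\rm RT}(X,\Omega)$ (the forests) is the free monoid on $\mathcal{T}_{\rm RT}(X,\Omega)$ under concatenation, with unit the empty forest $1$. $H_{\rm RT}(X,\Omega)=\mathbf{k}\mathcal{F}_{\rm RT}(X,\Omega)$ is the free $\mathbf{k}$-module on the forests, a unitary associative algebra under the concatenation product $m_{\rm RT}$. For $a\in X\sqcup\Omega$, $\bullet_a$ is the one-vertex tree decorated by $a$. For $\omega\in\Omega$, $B^+_\omega:H_{\rm RT}(X,\Omega)\to H_{\rm RT}(X,\Omega)$ is the linear grafting operator: $B^+_\omega(1)=\bullet_\omega$, and $B^+_\omega(T_1\cdots T_n)$ is the tree obtained by joining the roots of $T_1,\dots,T_n$ (in order) to a new root decorated by $\omega$. Every tree is uniquely either $\bullet_x$ with $x\in X$ or $B^+_\omega(\overline{F})$ with $\omega\in\Omega$, $\overline{F}$ a forest. Coproduct. The linear map $\Delta_{\rm RT}:H_{\rm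 RT}(X,\Omega)\to H_{\rm RT}(X,\Omega)\otimes H_{\rm RT}(X,\Omega)$ is defined recursively by $\Delta_{\rm RT}(1)=1\otimes 1$; $\Delta_{\rm RT}(\bullet_x)=\bullet_x\otimes 1+1\otimes\bullet_x+\mu_x\,1\otimes 1$ for $x\in X$; $\Delta_{\rm RT}(B^+_\omega(\overline{F}))=B^+_\omega(\overline{F})\otimes 1+(\mathrm{id}\otimes B^+_\omega)\Delta_{\rm RT}(\overline{F})+\lambda_\omega\overline{F}\otimes 1$; and $\Delta_{\rm RT}(T_1\cdots T_m)=\Delta_{\rm RT}(T_1)\cdots\Delta_{\rm RT}(T_m)$ for $m\ge 2$ trees. Counit. The linear map $\varepsilon_{\rm RT}:H_{\rm RT}(X,\Omega)\to\mathbf{k}$ is defined recursively by $\varepsilon_{\rm RT}(1)=1_{\mathbf{k}}$; $\varepsilon_{\rm RT}(\bullet_x)=-\mu_x$ for $x\in X$; $\varepsilon_{\rm RT}(B^+_\omega(\overline{F}))=-\lambda_\omega\varepsilon_{\rm RT}(\overline{F})$; and $\varepsilon_{\rm RT}(T_1\cdots T_m)=\varepsilon_{\rm RT}(T_1)\cdots\varepsilon_{\rm RT}(T_m)$ for $m\ge 2$ trees. Operated structures. An $\Omega$-operated bialgebra is a bialgebra $(A,m,1_A,\Delta,\varepsilon)$ together with a family of linear operators $P_\omega:A\to A$, $\omega\in\Omega$. A homomorphism of $\Omega$-operated bialgebras $(A,(P_\omega)_\omega)\to(A',(P'_\omega)_\omega)$ is a bialgebra homomorphism $f$ with $fP_\omega=P'_\omega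 f$ for all $\omega\in\Omega$. An $\Omega$-cocycle bialgebra (of weight $\lambda_\Omega=(\lambda_\omega)_{\omega\in\Omega}$) is an $\Omega$-operated bialgebra satisfying the Hochschild 1-cocycle condition of weight $\lambda_\Omega$: $\Delta P_\omega=P_\omega\otimes 1_A+\lambda_\omega\,\mathrm{id}\otimes 1_A+(\mathrm{id}\otimes P_\omega)\Delta$ for all $\omega\in\Omega$ (where $(P_\omega\otimes 1_A)(a)=P_\omega(a)\otimes 1_A$ and $(\mathrm{id}\otimes 1_A)(a)=a\otimes 1_A$). If the underlying bialgebra is a Hopf algebra it is called an $\Omega$-cocycle Hopf algebra. Connected cofiltered coaugmented. A coalgebra $(C,\Delta,\varepsilon)$ with a linear map $u:\mathbf{k}\to C$ satisfying $\varepsilon u=\mathrm{id}_{\mathbf{k}}$ is coaugmented; it is cofiltered if it has an exhaustive increasing filtration $\{C_{(n)}\}_{n\ge 0}$ with $\mathrm{im}\,u\subseteq C_{(n)}$ and $\Delta(C_{(n)})\subseteq\sum_{p+q=n}C_{(p)}\otimes C_{(q)}$, and connected if $C_{(0)}=\mathrm{im}\,u$. On $H_{\rm RT}(X,\Omega)$ one takes $u(c)=c\,1$ and $H_{{\rm RT},(n)}$ the span of the forests with at most $n$ vertices. A bialgebra whose coalgebra is connected cofiltered coaugmented in this sense is a Hopf algebra. *)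

theory Defs
  imports "HOL-Algebra.Module" "HOL-Algebra.AbelCoset"
begin

section \<open>Linear maps, spans and free modules\<close>

definition lin_map :: "'k ring \<Rightarrow> ('k, 'a) module \<Rightarrow> ('k, 'b) module \<Rightarrow> ('a \<Rightarrow> 'b) set" where
  "lin_map R M N = {f. f \<in> carrier M \<rightarrow> carrier N \<and>
     (\<forall>x\<in>carrier M. \<forall>y\<in>carrier M. f (x \<oplus>\<^bsub>M\<^esub> y) = f x \<oplus>\<^bsub>N\<^esub> f y) \<and>
     (\<forall>r\<in>carrier R. \<forall>x\<in>carrier M. f (r \<odot>\<^bsub>M\<^esub> x) = r \<odot>\<^bsub>N\<^esub> f x)}"

definition lin_span :: "'k ring \<Rightarrow> ('k, 'a) module \<Rightarrow> 'a set \<Rightarrow> 'a set" where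
  "lin_span R M S = \<Inter>{N. submodule N R M \<and> S \<subseteq> N}"

text \<open>The ground ring as a module over itself.\<close>

definition ground :: "'k ring \<Rightarrow> ('k, 'k) module" where
  "ground R = \<lparr>carrier = carrier R, mult = mult R, one = one R,
     zero = zero R, add = add R, smult = mult R\<rparr>"

text \<open>The free module on a set \<open>S\<close>: finitely supported functions, extended by zero outside \<open>S\<close>.
  The record type also demands a multiplication and a unit; they play no role for a mere module
  and are left undefined.\<close>

definition free_module :: "'k ring \<Rightarrow> 's set \<Rightarrow> ('k, 's \<Rightarrow> 'k) module" where
  "free_module R S = \<lparr>
     carrier = {u. finite {s. u s \<noteq> \<zero>\<^bsub>R\<^esub>} \<and> (\<forall>s\<in>S. u s \<in> carrier R) \<and> (\<forall>s. s \<notin> S \<longrightarrow> u s = \<zero>\<^bsub>R\<^esub>)},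
     mult = undefined, one = undefined,
     zero = (\<lambda>s. \<zero>\<^bsub>R\<^esub>), add = (\<lambda>u v s. u s \<oplus>\<^bsub>R\<^esub> v s),
     smult = (\<lambda>r u s. r \<otimes>\<^bsub>R\<^esub> u s)\<rparr>"

definition basis_vec :: "'k ring \<Rightarrow> 's \<Rightarrow> 's \<Rightarrow> 'k" where
  "basis_vec R s = (\<lambda>t. if t = s then \<one>\<^bsub>R\<^esub> else \<zero>\<^bsub>R\<^esub>)"

text \<open>The linear extension to the free module of a map \<open>g\<close> given on basis elements.\<close>

definition lin_ext :: "'k ring \<Rightarrow> ('k, 'b) module \<Rightarrow> ('s \<Rightarrow> 'b) \<Rightarrow> ('s \<Rightarrow> 'k) \<Rightarrow> 'b" where
  "lin_ext R M g u = (\<Oplus>\<^bsub>M\<^esub>s\<in>{s. u s \<noteq> \<zero>\<^bsub>R\<^esub>}. u s \<odot>\<^bsub>M\<^esub> g s)"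


section \<open>Tensor products\<close>

text \<open>\<open>M \<otimes> N\<close> is the quotient of the free module on \<open>carrier M \<times> carrier N\<close> by the submodule
  generated by the bilinearity relations; its elements are cosets.\<close>

definition bilinear_rels ::
  "'k ring \<Rightarrow> ('k, 'a) module \<Rightarrow> ('k, 'b) module \<Rightarrow> ('a \<times> 'b \<Rightarrow> 'k) set" where
  "bilinear_rels R M N =
    (let F = free_module R (carrier M \<times> carrier N); e = (\<lambda>m n. basis_vec R (m, n)) in
      {e (m \<oplus>\<^bsub>M\<^esub> m') n \<ominus>\<^bsub>F\<^esub> (e m n \<oplus>\<^bsub>F\<^esub> e m' n) | m m' n.
         m \<in> carrier M \<and> m' \<in> carrier M \<and> n \<in> carrier N} \<union>
      {e m (n \<oplus>\<^bsub>N\<^esub> n') \<ominus>\<^bsub>F\<^esub> (e m n \<oplus>\<^bsub>F\<^esub> e m n') | m n n'.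
         m \<in> carrier M \<and> n \<in> carrier N \<and> n' \<in> carrier N} \<union>
      {e (r \<odot>\<^bsub>M\<^esub> m) n \<ominus>\<^bsub>F\<^esub> (r \<odot>\<^bsub>F\<^esub> e m n) | r m n.
         r \<in> carrier R \<and> m \<in> carrier M \<and> n \<in> carrier N} \<union>
      {e m (r \<odot>\<^bsub>N\<^esub> n) \<ominus>\<^bsub>F\<^esub> (r \<odot>\<^bsub>F\<^esub> e m n) | r m n.
         r \<in> carrier R \<and> m \<in> carrier M \<and> n \<in> carrier N})"

definition tensor_ker ::
  "'k ring \<Rightarrow> ('k, 'a) module \<Rightarrow> ('k, 'b) module \<Rightarrow> ('a \<times> 'b \<Rightarrow> 'k) set" where
  "tensor_ker R M N = lin_span R (free_module R (carrier M \<times> carrier N)) (bilinear_rels R M N)"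

definition tensor_module ::
  "'k ring \<Rightarrow> ('k, 'a) module \<Rightarrow> ('k, 'b) module \<Rightarrow> ('k, ('a \<times> 'b \<Rightarrow> 'k) set) module" where
  "tensor_module R M N =
    (let F = free_module R (carrier M \<times> carrier N); T = tensor_ker R M N in
      \<lparr>carrier = a_rcosets\<^bsub>F\<^esub> T, mult = undefined, one = undefined,
       zero = T, add = (\<lambda>s t. s <+>\<^bsub>F\<^esub> t),
       smult = (\<lambda>r t. \<Union>u\<in>t. T +>\<^bsub>F\<^esub> (r \<odot>\<^bsub>F\<^esub> u))\<rparr>)"

definition pure_tensor ::
  "'k ring \<Rightarrow> ('k, 'a) module \<Rightarrow> ('k, 'b) module \<Rightarrow> 'a \<Rightarrow> 'b \<Rightarrow> ('a \<times> 'b \<Rightarrow> 'k) set" where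
  "pure_tensor R M N m n =
     tensor_ker R M N +>\<^bsub>free_module R (carrier M \<times> carrier N)\<^esub> basis_vec R (m, n)"

text \<open>For a bilinear map \<open>\<beta>\<close> into \<open>P\<close>, the linear map on \<open>M \<otimes> N\<close> with \<open>m \<otimes> n \<mapsto> \<beta> m n\<close>:
  the linear extension of \<open>\<beta>\<close> is evaluated on the representatives of a coset, on which it is
  constant.\<close>

definition tensor_lift ::
  "'k ring \<Rightarrow> ('k, 'c) module \<Rightarrow> ('a \<Rightarrow> 'b \<Rightarrow> 'c) \<Rightarrow> ('a \<times> 'b \<Rightarrow> 'k) set \<Rightarrow> 'c" where
  "tensor_lift R P \<beta> t = the_elem (lin_ext R P (\<lambda>(m, n). \<beta> m n) ` t)"

definition tensor_map ::
  "'k ring \<Rightarrow> ('k, 'c) module \<Rightarrow> ('k, 'd) module \<Rightarrow> ('a \<Rightarrow> 'c) \<Rightarrow> ('b \<Rightarrow> 'd) \<Rightarrow>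
    ('a \<times> 'b \<Rightarrow> 'k) set \<Rightarrow> ('c \<times> 'd \<Rightarrow> 'k) set" where
  "tensor_map R M' N' f g =
     tensor_lift R (tensor_module R M' N') (\<lambda>m n. pure_tensor R M' N' (f m) (g n))"

text \<open>The associator \<open>(L \<otimes> M) \<otimes> N \<rightarrow> L \<otimes> (M \<otimes> N)\<close>.\<close>

definition tensor_assoc ::
  "'k ring \<Rightarrow> ('k, 'a) module \<Rightarrow> ('k, 'b) module \<Rightarrow> ('k, 'c) module \<Rightarrow>
    (('a \<times> 'b \<Rightarrow> 'k) set \<times> 'c \<Rightarrow> 'k) set \<Rightarrow> ('a \<times> ('b \<times> 'c \<Rightarrow> 'k) set \<Rightarrow> 'k) set" where
  "tensor_assoc R L M N =
    (let T = tensor_module R L (tensor_module R M N) in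
      tensor_lift R T (\<lambda>s n. tensor_lift R T
        (\<lambda>l m. pure_tensor R L (tensor_module R M N) l (pure_tensor R M N m n)) s))"

text \<open>The tensor product of two algebras: \<open>(a \<otimes> b) (c \<otimes> d) = ac \<otimes> bd\<close>.\<close>

definition tensor_algebra ::
  "'k ring \<Rightarrow> ('k, 'a) module \<Rightarrow> ('k, 'b) module \<Rightarrow> ('k, ('a \<times> 'b \<Rightarrow> 'k) set) module" where
  "tensor_algebra R A B =
    (let T = tensor_module R A B in
      T\<lparr>mult := (\<lambda>s t. tensor_lift R T (\<lambda>a b. tensor_lift R T
                   (\<lambda>c d. pure_tensor R A B (a \<otimes>\<^bsub>A\<^esub> c) (b \<otimes>\<^bsub>B\<^esub> d)) t) s),
        one := pure_tensor R A B \<one>\<^bsub>A\<^esub> \<one>\<^bsub>B\<^esub>\<rparr>)"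


section \<open>Coalgebras, bialgebras and Hopf algebras\<close>

text \<open>The library locale \<open>algebra\<close> is restricted to commutative algebras.\<close>

locale assoc_algebra = module R A + ring A for R :: "'k ring" and A :: "('k, 'a) module" +
  assumes smult_mult_left:
      "\<lbrakk>r \<in> carrier R; x \<in> carrier A; y \<in> carrier A\<rbrakk> \<Longrightarrow>
        (r \<odot>\<^bsub>A\<^esub> x) \<otimes>\<^bsub>A\<^esub> y = r \<odot>\<^bsub>A\<^esub> (x \<otimes>\<^bsub>A\<^esub> y)"
    and smult_mult_right:
      "\<lbrakk>r \<in> carrier R; x \<in> carrier A; y \<in> carrier A\<rbrakk> \<Longrightarrow>
        x \<otimes>\<^bsub>A\<^esub> (r \<odot>\<^bsub>A\<^esub> y) = r \<odot>\<^bsub>A\<^esub> (x \<otimes>\<^bsub>A\<^esub> y)"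

text \<open>In the counit axioms the identifications \<open>k \<otimes> C = C = C \<otimes> k\<close> are built in.\<close>

locale coalgebra = module R C for R :: "'k ring" and C :: "('k, 'a) module" +
  fixes \<Delta> :: "'a \<Rightarrow> ('a \<times> 'a \<Rightarrow> 'k) set" and \<epsilon> :: "'a \<Rightarrow> 'k"
  assumes comult_linear: "\<Delta> \<in> lin_map R C (tensor_module R C C)"
    and counit_linear: "\<epsilon> \<in> lin_map R C (ground R)"
    and coassoc: "c \<in> carrier C \<Longrightarrow>
      tensor_assoc R C C C (tensor_map R (tensor_module R C C) C \<Delta> (\<lambda>x. x) (\<Delta> c)) =
      tensor_map R C (tensor_module R C C) (\<lambda>x. x) \<Delta> (\<Delta> c)"
    and counit_left: "c \<in> carrier C \<Longrightarrow> tensor_lift R C (\<lambda>a b. \<epsilon> a \<odot>\<^bsub>C\<^esub> b) (\<Delta> c) = c"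
    and counit_right: "c \<in> carrier C \<Longrightarrow> tensor_lift R C (\<lambda>a b. \<epsilon> b \<odot>\<^bsub>C\<^esub> a) (\<Delta> c) = c"

locale bialgebra = assoc_algebra R A + coalgebra R A \<Delta> \<epsilon>
  for R :: "'k ring" and A :: "('k, 'a) module"
    and \<Delta> :: "'a \<Rightarrow> ('a \<times> 'a \<Rightarrow> 'k) set" and \<epsilon> :: "'a \<Rightarrow> 'k" +
  assumes comult_hom: "\<Delta> \<in> ring_hom A (tensor_algebra R A A)"
    and counit_hom: "\<epsilon> \<in> ring_hom A R"

locale hopf_algebra = bialgebra R A \<Delta> \<epsilon>
  for R :: "'k ring" and A :: "('k, 'a) module"
    and \<Delta> :: "'a \<Rightarrow> ('a \<times> 'a \<Rightarrow> 'k) set" and \<epsilon> :: "'a \<Rightarrow> 'k" +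
  assumes antipode_ex: "\<exists>S\<in>lin_map R A A. \<forall>a\<in>carrier A.
      tensor_lift R A (\<lambda>b c. S b \<otimes>\<^bsub>A\<^esub> c) (\<Delta> a) = \<epsilon> a \<odot>\<^bsub>A\<^esub> \<one>\<^bsub>A\<^esub> \<and>
      tensor_lift R A (\<lambda>b c. b \<otimes>\<^bsub>A\<^esub> S c) (\<Delta> a) = \<epsilon> a \<odot>\<^bsub>A\<^esub> \<one>\<^bsub>A\<^esub>"

text \<open>\<open>C\<^sub>p \<otimes> C\<^sub>q\<close> denotes the image in \<open>C \<otimes> C\<close>, i.e. the span of the pure tensors.\<close>

locale connected_cofiltered_coalgebra = coalgebra R C \<Delta> \<epsilon>
  for R :: "'k ring" and C :: "('k, 'a) module"
    and \<Delta> :: "'a \<Rightarrow> ('a \<times> 'a \<Rightarrow> 'k) set" and \<epsilon> :: "'a \<Rightarrow> 'k" +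
  fixes u :: "'k \<Rightarrow> 'a" and Fil :: "nat \<Rightarrow> 'a set"
  assumes coaug_linear: "u \<in> lin_map R (ground R) C"
    and counit_coaug: "r \<in> carrier R \<Longrightarrow> \<epsilon> (u r) = r"
    and fil_submodule: "submodule (Fil n) R C"
    and fil_increasing: "Fil n \<subseteq> Fil (Suc n)"
    and fil_exhaustive: "(\<Union>n. Fil n) = carrier C"
    and fil_coaug: "u ` carrier R \<subseteq> Fil n"
    and fil_comult: "\<Delta> ` Fil n \<subseteq> lin_span R (tensor_module R C C)
      {pure_tensor R C C a b | a b p q. p + q = n \<and> a \<in> Fil p \<and> b \<in> Fil q}"
    and fil_connected: "Fil 0 = u ` carrier R"


section \<open>Operated bialgebras and the cocycle condition\<close>

locale operated_bialgebra = bialgebra R A \<Delta> \<epsilon>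
  for R :: "'k ring" and \<Omega> :: "'w set" and A :: "('k, 'a) module"
    and \<Delta> :: "'a \<Rightarrow> ('a \<times> 'a \<Rightarrow> 'k) set" and \<epsilon> :: "'a \<Rightarrow> 'k" +
  fixes P :: "'w \<Rightarrow> 'a \<Rightarrow> 'a"
  assumes oper_linear: "\<omega> \<in> \<Omega> \<Longrightarrow> P \<omega> \<in> lin_map R A A"

definition operated_bialgebra_hom ::
  "'k ring \<Rightarrow> 'w set \<Rightarrow>
    ('k, 'a) module \<Rightarrow> ('a \<Rightarrow> ('a \<times> 'a \<Rightarrow> 'k) set) \<Rightarrow> ('a \<Rightarrow> 'k) \<Rightarrow> ('w \<Rightarrow> 'a \<Rightarrow> 'a) \<Rightarrow>
    ('k, 'b) module \<Rightarrow> ('b \<Rightarrow> ('b \<times> 'b \<Rightarrow> 'k) set) \<Rightarrow> ('b \<Rightarrow> 'k) \<Rightarrow> ('w \<Rightarrow> 'b \<Rightarrow> 'b) \<Rightarrow>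
    ('a \<Rightarrow> 'b) set" where
  "operated_bialgebra_hom R \<Omega> A \<Delta> \<epsilon> P A' \<Delta>' \<epsilon>' P' =
    {h. h \<in> lin_map R A A' \<and> h \<in> ring_hom A A' \<and>
        (\<forall>a\<in>carrier A. \<Delta>' (h a) = tensor_map R A' A' h h (\<Delta> a)) \<and>
        (\<forall>a\<in>carrier A. \<epsilon>' (h a) = \<epsilon> a) \<and>
        (\<forall>\<omega>\<in>\<Omega>. \<forall>a\<in>carrier A. h (P \<omega> a) = P' \<omega> (h a))}"

locale cocycle_bialgebra = operated_bialgebra R \<Omega> A \<Delta> \<epsilon> P
  for R :: "'k ring" and \<Omega> :: "'w set" and lam :: "'w \<Rightarrow> 'k" and A :: "('k, 'a) module"
    and \<Delta> :: "'a \<Rightarrow> ('a \<times> 'a \<Rightarrow> 'k) set" and \<epsilon> :: "'a \<Rightarrow> 'k" and P :: "'w \<Rightarrow> 'a \<Rightarrow> 'a" +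
  assumes cocycle: "\<lbrakk>\<omega> \<in> \<Omega>; a \<in> carrier A\<rbrakk> \<Longrightarrow>
      \<Delta> (P \<omega> a) = pure_tensor R A A (P \<omega> a) \<one>\<^bsub>A\<^esub>
        \<oplus>\<^bsub>tensor_module R A A\<^esub> lam \<omega> \<odot>\<^bsub>tensor_module R A A\<^esub> pure_tensor R A A a \<one>\<^bsub>A\<^esub>
        \<oplus>\<^bsub>tensor_module R A A\<^esub> tensor_map R A A (\<lambda>x. x) (P \<omega>) (\<Delta> a)"

locale cocycle_hopf_algebra = cocycle_bialgebra R \<Omega> lam A \<Delta> \<epsilon> P + hopf_algebra R A \<Delta> \<epsilon>
  for R :: "'k ring" and \<Omega> :: "'w set" and lam :: "'w \<Rightarrow> 'k" and A :: "('k, 'a) module"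
    and \<Delta> :: "'a \<Rightarrow> ('a \<times> 'a \<Rightarrow> 'k) set" and \<epsilon> :: "'a \<Rightarrow> 'k" and P :: "'w \<Rightarrow> 'a \<Rightarrow> 'a"


section \<open>Decorated planar rooted forests\<close>

text \<open>A vertex decorated by \<open>x \<in> X\<close> is necessarily a leaf; a vertex decorated by \<open>\<omega> \<in> \<Omega>\<close> carries
  the (possibly empty) list of the subtrees at its children. So \<open>Leaf x\<close> is \<open>\<bullet>\<^sub>x\<close>,
  \<open>Node \<omega> F\<close> is \<open>B\<^sup>+\<^sub>\<omega>(F)\<close>, and \<open>Node \<omega> []\<close> is the one-vertex tree \<open>\<bullet>\<^sub>\<omega>\<close>.
  The two constructors keep the decorations from \<open>X\<close> and from \<open>\<Omega>\<close> apart.\<close>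

datatype (leaf_decs: 'x, node_decs: 'w) dtree =
  Leaf 'x | Node 'w "('x, 'w) dtree list"

definition dtrees :: "'x set \<Rightarrow> 'w set \<Rightarrow> ('x, 'w) dtree set" where
  "dtrees X \<Omega> = {t. leaf_decs t \<subseteq> X \<and> node_decs t \<subseteq> \<Omega>}"

definition forests :: "'x set \<Rightarrow> 'w set \<Rightarrow> ('x, 'w) dtree list set" where
  "forests X \<Omega> = lists (dtrees X \<Omega>)"

primrec tree_verts :: "('x, 'w) dtree \<Rightarrow> nat" where
  "tree_verts (Leaf x) = 1"
| "tree_verts (Node \<omega> F) = Suc (sum_list (map tree_verts F))"

definition forest_verts :: "('x, 'w) dtree list \<Rightarrow> nat" where
  "forest_verts F = sum_list (map tree_verts F)"

text \<open>The forest algebra: the concatenation product is extended bilinearly.\<close>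

definition H_RT :: "'k ring \<Rightarrow> 'x set \<Rightarrow> 'w set \<Rightarrow> ('k, ('x, 'w) dtree list \<Rightarrow> 'k) module" where
  "H_RT R X \<Omega> =
    (let M = free_module R (forests X \<Omega>) in
      M\<lparr>mult := (\<lambda>u v. lin_ext R M (\<lambda>F. lin_ext R M (\<lambda>G. basis_vec R (F @ G)) v) u),
        one := basis_vec R []\<rparr>)"

definition j_RT :: "'k ring \<Rightarrow> 'x \<Rightarrow> ('x, 'w) dtree list \<Rightarrow> 'k" where
  "j_RT R x = basis_vec R [Leaf x]"

definition B_RT :: "'k ring \<Rightarrow> 'x set \<Rightarrow> 'w set \<Rightarrow> 'w \<Rightarrow>
    (('x, 'w) dtree list \<Rightarrow> 'k) \<Rightarrow> (('x, 'w) dtree list \<Rightarrow> 'k)" where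
  "B_RT R X \<Omega> \<omega> = lin_ext R (H_RT R X \<Omega>) (\<lambda>F. basis_vec R [Node \<omega> F])"

text \<open>The value on a forest is the product of the values on its trees, ending with the unit
  \<open>1 \<otimes> 1\<close>; so the forest \<open>[T]\<close> gets the value of \<open>T\<close>. The same convention is used for the
  counit below.\<close>

primrec
  comult_tree :: "'k ring \<Rightarrow> 'x set \<Rightarrow> 'w set \<Rightarrow> ('x \<Rightarrow> 'k) \<Rightarrow> ('w \<Rightarrow> 'k) \<Rightarrow> ('x, 'w) dtree \<Rightarrow>
    ((('x, 'w) dtree list \<Rightarrow> 'k) \<times> (('x, 'w) dtree list \<Rightarrow> 'k) \<Rightarrow> 'k) set" and
  comult_forest :: "'k ring \<Rightarrow> 'x set \<Rightarrow> 'w set \<Rightarrow> ('x \<Rightarrow> 'k) \<Rightarrow> ('w \<Rightarrow> 'k) \<Rightarrow> ('x, 'w) dtree list \<Rightarrow>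
    ((('x, 'w) dtree list \<Rightarrow> 'k) \<times> (('x, 'w) dtree list \<Rightarrow> 'k) \<Rightarrow> 'k) set"
where
  "comult_tree R X \<Omega> \<mu> lam (Leaf x) =
    (let H = H_RT R X \<Omega>; HH = tensor_algebra R H H in
      pure_tensor R H H (j_RT R x) \<one>\<^bsub>H\<^esub> \<oplus>\<^bsub>HH\<^esub> pure_tensor R H H \<one>\<^bsub>H\<^esub> (j_RT R x)
        \<oplus>\<^bsub>HH\<^esub> \<mu> x \<odot>\<^bsub>HH\<^esub> pure_tensor R H H \<one>\<^bsub>H\<^esub> \<one>\<^bsub>H\<^esub>)"
| "comult_tree R X \<Omega> \<mu> lam (Node \<omega> F) =
    (let H = H_RT R X \<Omega>; HH = tensor_algebra R H H in
      pure_tensor R H H (basis_vec R [Node \<omega> F]) \<one>\<^bsub>H\<^esub>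
        \<oplus>\<^bsub>HH\<^esub> tensor_map R H H (\<lambda>u. u) (B_RT R X \<Omega> \<omega>) (comult_forest R X \<Omega> \<mu> lam F)
        \<oplus>\<^bsub>HH\<^esub> lam \<omega> \<odot>\<^bsub>HH\<^esub> pure_tensor R H H (basis_vec R F) \<one>\<^bsub>H\<^esub>)"
| "comult_forest R X \<Omega> \<mu> lam [] =
    pure_tensor R (H_RT R X \<Omega>) (H_RT R X \<Omega>) \<one>\<^bsub>H_RT R X \<Omega>\<^esub> \<one>\<^bsub>H_RT R X \<Omega>\<^esub>"
| "comult_forest R X \<Omega> \<mu> lam (T # F) =
    comult_tree R X \<Omega> \<mu> lam T
      \<otimes>\<^bsub>tensor_algebra R (H_RT R X \<Omega>) (H_RT R X \<Omega>)\<^esub> comult_forest R X \<Omega> \<mu> lam F"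

definition Delta_RT :: "'k ring \<Rightarrow> 'x set \<Rightarrow> 'w set \<Rightarrow> ('x \<Rightarrow> 'k) \<Rightarrow> ('w \<Rightarrow> 'k) \<Rightarrow>
    (('x, 'w) dtree list \<Rightarrow> 'k) \<Rightarrow>
    ((('x, 'w) dtree list \<Rightarrow> 'k) \<times> (('x, 'w) dtree list \<Rightarrow> 'k) \<Rightarrow> 'k) set" where
  "Delta_RT R X \<Omega> \<mu> lam =
    lin_ext R (tensor_module R (H_RT R X \<Omega>) (H_RT R X \<Omega>)) (comult_forest R X \<Omega> \<mu> lam)"

primrec
  counit_tree :: "'k ring \<Rightarrow> ('x \<Rightarrow> 'k) \<Rightarrow> ('w \<Rightarrow> 'k) \<Rightarrow> ('x, 'w) dtree \<Rightarrow> 'k" and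
  counit_forest :: "'k ring \<Rightarrow> ('x \<Rightarrow> 'k) \<Rightarrow> ('w \<Rightarrow> 'k) \<Rightarrow> ('x, 'w) dtree list \<Rightarrow> 'k"
where
  "counit_tree R \<mu> lam (Leaf x) = \<ominus>\<^bsub>R\<^esub> \<mu> x"
| "counit_tree R \<mu> lam (Node \<omega> F) = \<ominus>\<^bsub>R\<^esub> (lam \<omega> \<otimes>\<^bsub>R\<^esub> counit_forest R \<mu> lam F)"
| "counit_forest R \<mu> lam [] = \<one>\<^bsub>R\<^esub>"
| "counit_forest R \<mu> lam (T # F) = counit_tree R \<mu> lam T \<otimes>\<^bsub>R\<^esub> counit_forest R \<mu> lam F"

definition eps_RT :: "'k ring \<Rightarrow> ('x \<Rightarrow> 'k) \<Rightarrow> ('w \<Rightarrow> 'k) \<Rightarrow> (('x, 'w) dtree list \<Rightarrow> 'k) \<Rightarrow> 'k" where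
  "eps_RT R \<mu> lam = lin_ext R (ground R) (counit_forest R \<mu> lam)"

definition u_RT :: "'k ring \<Rightarrow> 'x set \<Rightarrow> 'w set \<Rightarrow> 'k \<Rightarrow> ('x, 'w) dtree list \<Rightarrow> 'k" where
  "u_RT R X \<Omega> c = c \<odot>\<^bsub>H_RT R X \<Omega>\<^esub> \<one>\<^bsub>H_RT R X \<Omega>\<^esub>"

definition Fil_RT :: "'k ring \<Rightarrow> 'x set \<Rightarrow> 'w set \<Rightarrow> nat \<Rightarrow> (('x, 'w) dtree list \<Rightarrow> 'k) set" where
  "Fil_RT R X \<Omega> n =
    lin_span R (H_RT R X \<Omega>) {basis_vec R F | F. F \<in> forests X \<Omega> \<and> forest_verts F \<le> n}"

end

theory Submission
  imports Defs
begin

text \<open>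
  Both sides of every identity to be proved on the forest algebra \<open>H\<close> (coassociativity, the counit
  laws, compatibility of the universal map with coproducts and counits, uniqueness of that map) are
  algebra homomorphisms out of \<open>H\<close>. Since \<open>H\<close> is generated by the leaves under products and
  grafting, it is enough to check the identity on the leaves and that it passes from \<open>a\<close> to
  \<open>B\<^sup>+\<^sub>\<omega>(a)\<close>; the latter is always the cocycle condition. That the weights of the counit are forced
  in an arbitrary cocycle bialgebra follows by applying \<open>\<epsilon> \<otimes> id\<close> to the coproduct of \<open>f(x)\<close> and of
  \<open>P\<^sub>\<omega>(a)\<close>.

  The antipode is the geometric series \<open>\<Sum>\<^sub>k (u\<epsilon> - id)\<^sup>k\<close> for the convolution product:
  \<open>u\<epsilon> - id\<close> vanishes on the bottom step of the filtration, so its \<open>k\<close>-th power vanishes on all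
  forests with fewer than \<open>k\<close> vertices.
\<close>

section \<open>Linear maps and spans\<close>

text \<open>Elements of a tensor product are cosets here, so nothing is computed on a general
  element of \<open>H \<otimes> H\<close>. A map out of it exists only through a bilinear map, and
  two such maps are compared on pure tensors, one comparison per factor; hence the steady
  bookkeeping of linearity. Multiplicativity of the coproduct, the counit and the universal map is
  automatic: forests form a free monoid, and the value on a forest is by definition the product over
  its trees. The weights \<open>\<mu> x\<close> and \<open>lam \<omega>\<close> add terms with fewer
  vertices to the coproduct, which is therefore filtered but in general not graded; the signs in the
  counit are exactly those that cancel these terms. In an arbitrary target the cancellation is an
  equation between multiples of \<open>\<one>\<close>, from which scalars can be read off because
  \<open>\<epsilon> \<one> = \<one>\<close>. Homomorphisms are functions on a whole type,
  constrained only on the carrier, so uniqueness is claimed among \<open>extensional\<close>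
  functions.\<close>

lemma lin_mapI:
  assumes "\<And>x. x \<in> carrier M \<Longrightarrow> f x \<in> carrier N"
    and "\<And>x y. x \<in> carrier M \<Longrightarrow> y \<in> carrier M \<Longrightarrow> f (x \<oplus>\<^bsub>M\<^esub> y) = f x \<oplus>\<^bsub>N\<^esub> f y"
    and "\<And>r x. r \<in> carrier R \<Longrightarrow> x \<in> carrier M \<Longrightarrow> f (r \<odot>\<^bsub>M\<^esub> x) = r \<odot>\<^bsub>N\<^esub> f x"
  shows "f \<in> lin_map R M N"
  using assms unfolding lin_map_def by blast

lemma lin_map_closed: "f \<in> lin_map R M N \<Longrightarrow> x \<in> carrier M \<Longrightarrow> f x \<in> carrier N"
  and lin_map_add: "f \<in> lin_map R M N \<Longrightarrow> x \<in> carrier M \<Longrightarrow> y \<in> carrier M \<Longrightarrow>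
    f (x \<oplus>\<^bsub>M\<^esub> y) = f x \<oplus>\<^bsub>N\<^esub> f y"
  and lin_map_smult: "f \<in> lin_map R M N \<Longrightarrow> r \<in> carrier R \<Longrightarrow> x \<in> carrier M \<Longrightarrow>
    f (r \<odot>\<^bsub>M\<^esub> x) = r \<odot>\<^bsub>N\<^esub> f x"
  unfolding lin_map_def by blast+

lemma lin_map_zero:
  assumes "f \<in> lin_map R M N" "module R M" "module R N"
  shows "f \<zero>\<^bsub>M\<^esub> = \<zero>\<^bsub>N\<^esub>"
proof -
  interpret M: module R M by fact
  interpret N: module R N by fact
  have "f \<zero>\<^bsub>M\<^esub> = f (\<zero>\<^bsub>R\<^esub> \<odot>\<^bsub>M\<^esub> \<zero>\<^bsub>M\<^esub>)"
    by simp
  also have "\<dots> = \<zero>\<^bsub>R\<^esub> \<odot>\<^bsub>N\<^esub> f \<zero>\<^bsub>M\<^esub>"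
    by (rule lin_map_smult[OF assms(1)]) simp_all
  also have "\<dots> = \<zero>\<^bsub>N\<^esub>"
    using lin_map_closed[OF assms(1)] by simp
  finally show ?thesis .
qed

lemma a_inv_eq_smult:
  assumes "module R M" "x \<in> carrier M"
  shows "\<ominus>\<^bsub>M\<^esub> x = (\<ominus>\<^bsub>R\<^esub> \<one>\<^bsub>R\<^esub>) \<odot>\<^bsub>M\<^esub> x"
proof -
  interpret module R M by fact
  show ?thesis using assms(2) by (simp add: smult_l_minus)
qed

lemma lin_map_a_inv:
  assumes "f \<in> lin_map R M N" "module R M" "module R N" "x \<in> carrier M"
  shows "f (\<ominus>\<^bsub>M\<^esub> x) = \<ominus>\<^bsub>N\<^esub> f x"
proof -
  interpret M: module R M by fact
  show ?thesis
    using assms lin_map_closed[OF assms(1)] lin_map_smult[OF assms(1)] by (simp add: a_inv_eq_smult)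
qed

lemma lin_map_minus:
  assumes "f \<in> lin_map R M N" "module R M" "module R N" "x \<in> carrier M" "y \<in> carrier M"
  shows "f (x \<ominus>\<^bsub>M\<^esub> y) = f x \<ominus>\<^bsub>N\<^esub> f y"
proof -
  interpret M: module R M by fact
  show ?thesis
    using assms by (simp add: a_minus_def lin_map_add[OF assms(1)] lin_map_a_inv[OF assms(1-3)])
qed

text \<open>Closure under inverses follows from closure under scaling, negation being scaling by
  minus one.\<close>

lemma submodule_crit:
  assumes "module R M" "H \<subseteq> carrier M" "\<zero>\<^bsub>M\<^esub> \<in> H"
    and "\<And>x y. x \<in> H \<Longrightarrow> y \<in> H \<Longrightarrow> x \<oplus>\<^bsub>M\<^esub> y \<in> H"
    and "\<And>r x. r \<in> carrier R \<Longrightarrow> x \<in> H \<Longrightarrow> r \<odot>\<^bsub>M\<^esub> x \<in> H"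
  shows "submodule H R M"
proof -
  interpret module R M by fact
  show ?thesis
  proof (rule submoduleI)
    fix a assume "a \<in> H"
    with assms(2,5) show "\<ominus>\<^bsub>M\<^esub> a \<in> H"
      by (subst a_inv_eq_smult[OF assms(1)]) auto
  qed (use assms in auto)
qed

lemma submoduleD:
  assumes "submodule H R M"
  shows submodule_subset: "H \<subseteq> carrier M"
    and submodule_zero: "\<zero>\<^bsub>M\<^esub> \<in> H"
    and submodule_add: "x \<in> H \<Longrightarrow> y \<in> H \<Longrightarrow> x \<oplus>\<^bsub>M\<^esub> y \<in> H"
    and submodule_smult: "r \<in> carrier R \<Longrightarrow> x \<in> H \<Longrightarrow> r \<odot>\<^bsub>M\<^esub> x \<in> H"
proof -
  interpret submodule H R M by fact
  show "H \<subseteq> carrier M" "\<zero>\<^bsub>M\<^esub> \<in> H" "x \<in> H \<Longrightarrow> y \<in> H \<Longrightarrow> x \<oplus>\<^bsub>M\<^esub> y \<in> H"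
    "r \<in> carrier R \<Longrightarrow> x \<in> H \<Longrightarrow> r \<odot>\<^bsub>M\<^esub> x \<in> H"
    using subset one_closed m_closed by auto
qed

text \<open>With \<open>lin_span_least\<close> this carries equality on generators to the whole
  span; with the zero map as \<open>g\<close> it says that kernels are submodules.\<close>

lemma submodule_eq_set:
  assumes f: "f \<in> lin_map R M N" and g: "g \<in> lin_map R M N" and "module R M" "module R N"
  shows "submodule {x \<in> carrier M. f x = g x} R M"
proof -
  interpret M: module R M by fact
  show ?thesis
    using assms
    by (intro submodule_crit) (auto simp: lin_map_zero lin_map_add[OF f] lin_map_add[OF g]
        lin_map_smult[OF f] lin_map_smult[OF g])
qed

lemma lin_span_superset: "S \<subseteq> lin_span R M S"
  unfolding lin_span_def by blast

lemma lin_span_least: "submodule N R M \<Longrightarrow> S \<subseteq> N \<Longrightarrow> lin_span R M S \<subseteq> N"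
  unfolding lin_span_def by blast

lemma lin_span_mono: "S \<subseteq> S' \<Longrightarrow> lin_span R M S \<subseteq> lin_span R M S'"
  unfolding lin_span_def by blast

lemma lin_span_submodule:
  assumes "module R M" "S \<subseteq> carrier M"
  shows "submodule (lin_span R M S) R M"
proof -
  interpret module R M by fact
  have c: "lin_span R M S \<subseteq> carrier M"
    using carrier_is_submodule assms(2) by (rule lin_span_least)
  show ?thesis
    using assms c by (intro submodule_crit)
      (auto simp: lin_span_def intro: submodule_zero submodule_add submodule_smult)
qed

lemma lin_map_eq_on_span:
  assumes "f \<in> lin_map R M N" "g \<in> lin_map R M N" "module R M" "module R N"
    and "S \<subseteq> carrier M" "\<And>s. s \<in> S \<Longrightarrow> f s = g s" "x \<in> lin_span R M S"
  shows "f x = g x"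
  using lin_span_least[OF submodule_eq_set[OF assms(1-4)], of S] assms(5-7) by blast

lemma lin_map_id [simp, intro]: "(\<lambda>x. x) \<in> lin_map R M M"
  by (rule lin_mapI) auto

lemma lin_map_comp: "f \<in> lin_map R M N \<Longrightarrow> g \<in> lin_map R N P \<Longrightarrow> (\<lambda>x. g (f x)) \<in> lin_map R M P"
  unfolding lin_map_def by (auto simp: Pi_def)

lemma lin_map_plus:
  assumes "module R N" "f \<in> lin_map R M N" "g \<in> lin_map R M N"
  shows "(\<lambda>x. f x \<oplus>\<^bsub>N\<^esub> g x) \<in> lin_map R M N"
proof -
  interpret module R N by fact
  show ?thesis
    using assms(2,3) unfolding lin_map_def by (auto simp: Pi_def smult_r_distr M.a_ac)
qed

lemma lin_map_scale:
  assumes "module R N" "f \<in> lin_map R M N" "r \<in> carrier R"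
  shows "(\<lambda>x. r \<odot>\<^bsub>N\<^esub> f x) \<in> lin_map R M N"
proof -
  interpret module R N by fact
  show ?thesis
    using assms(2,3) unfolding lin_map_def
    by (auto simp: Pi_def smult_r_distr simp flip: smult_assoc1) (simp add: R.m_comm)
qed

lemma lin_map_const_zero: "module R N \<Longrightarrow> (\<lambda>x. \<zero>\<^bsub>N\<^esub>) \<in> lin_map R M N"
proof -
  assume "module R N"
  then interpret module R N .
  show ?thesis unfolding lin_map_def by auto
qed

lemma lin_map_inv:
  assumes "module R N" "f \<in> lin_map R M N"
  shows "(\<lambda>x. \<ominus>\<^bsub>N\<^esub> f x) \<in> lin_map R M N"
proof -
  interpret module R N by fact
  show ?thesis
    using assms(2) unfolding lin_map_def by (auto simp: Pi_def M.minus_add smult_r_minus M.a_ac)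
qed

text \<open>Linearity constrains values on the carrier only. This is what allows the universal map
  to be replaced by its restriction.\<close>

lemma lin_map_cong:
  assumes "f \<in> lin_map R M N" "module R M" "\<And>x. x \<in> carrier M \<Longrightarrow> g x = f x"
  shows "g \<in> lin_map R M N"
proof -
  interpret module R M by fact
  show ?thesis using assms(1,3) by (simp add: lin_map_def Pi_def)
qed

lemma ground_simps [simp]: "carrier (ground R) = carrier R" "add (ground R) = add R"
  "smult (ground R) = mult R" "zero (ground R) = zero R" "mult (ground R) = mult R"
  "one (ground R) = one R"
  by (simp_all add: ground_def)

lemma ground_module: "cring R \<Longrightarrow> module R (ground R)"
proof -
  assume "cring R"
  then interpret cring R .
  show ?thesis
  proof (rule moduleI)
    show "cring R" by fact
    show "abelian_group (ground R)"
      by (rule abelian_groupI) (use add.l_inv_ex in \<open>auto simp: a_ac\<close>)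
  qed (auto simp: l_distr r_distr m_assoc)
qed

lemma lin_map_smult_vec:
  assumes "module R M" "x \<in> carrier M" "f \<in> lin_map R N (ground R)"
  shows "(\<lambda>y. f y \<odot>\<^bsub>M\<^esub> x) \<in> lin_map R N M"
proof -
  interpret module R M by fact
  show ?thesis using assms(2,3) unfolding lin_map_def
    by (auto simp: Pi_def smult_l_distr smult_assoc1)
qed

section \<open>Bilinear maps\<close>

text \<open>Curried and stated as linearity in each slot, so that fixing either argument immediately
  yields a \<open>lin_map\<close>.\<close>

definition bilin :: "'k ring \<Rightarrow> ('k, 'a) module \<Rightarrow> ('k, 'b) module \<Rightarrow> ('k, 'c) module \<Rightarrow>
    ('a \<Rightarrow> 'b \<Rightarrow> 'c) set" where
  "bilin R M N P = {\<beta>. (\<forall>m\<in>carrier M. \<beta> m \<in> lin_map R N P) \<and>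
     (\<forall>n\<in>carrier N. (\<lambda>m. \<beta> m n) \<in> lin_map R M P)}"

lemma bilinI:
  assumes "\<And>m. m \<in> carrier M \<Longrightarrow> (\<lambda>n. \<beta> m n) \<in> lin_map R N P"
    and "\<And>n. n \<in> carrier N \<Longrightarrow> (\<lambda>m. \<beta> m n) \<in> lin_map R M P"
  shows "\<beta> \<in> bilin R M N P"
  using assms unfolding bilin_def by simp

lemma bilin_right: "\<beta> \<in> bilin R M N P \<Longrightarrow> m \<in> carrier M \<Longrightarrow> (\<lambda>n. \<beta> m n) \<in> lin_map R N P"
  and bilin_left: "\<beta> \<in> bilin R M N P \<Longrightarrow> n \<in> carrier N \<Longrightarrow> (\<lambda>m. \<beta> m n) \<in> lin_map R M P"
  unfolding bilin_def by auto

lemma bilin_closed: "\<beta> \<in> bilin R M N P \<Longrightarrow> m \<in> carrier M \<Longrightarrow> n \<in> carrier N \<Longrightarrow> \<beta> m n \<in> carrier P"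
  by (meson bilin_right lin_map_closed)

lemma bilin_simps:
  assumes "\<beta> \<in> bilin R M N P"
  shows bilin_add_left: "\<lbrakk>m \<in> carrier M; m' \<in> carrier M; n \<in> carrier N\<rbrakk> \<Longrightarrow>
      \<beta> (m \<oplus>\<^bsub>M\<^esub> m') n = \<beta> m n \<oplus>\<^bsub>P\<^esub> \<beta> m' n"
    and bilin_smult_left: "\<lbrakk>r \<in> carrier R; m \<in> carrier M; n \<in> carrier N\<rbrakk> \<Longrightarrow>
      \<beta> (r \<odot>\<^bsub>M\<^esub> m) n = r \<odot>\<^bsub>P\<^esub> \<beta> m n"
    and bilin_add_right: "\<lbrakk>m \<in> carrier M; n \<in> carrier N; n' \<in> carrier N\<rbrakk> \<Longrightarrow>
      \<beta> m (n \<oplus>\<^bsub>N\<^esub> n') = \<beta> m n \<oplus>\<^bsub>P\<^esub> \<beta> m n'"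
    and bilin_smult_right: "\<lbrakk>r \<in> carrier R; m \<in> carrier M; n \<in> carrier N\<rbrakk> \<Longrightarrow>
      \<beta> m (r \<odot>\<^bsub>N\<^esub> n) = r \<odot>\<^bsub>P\<^esub> \<beta> m n"
  using assms unfolding bilin_def lin_map_def by blast+

lemma bilin_comp_lin:
  assumes "\<beta> \<in> bilin R M N P" "f \<in> lin_map R M' M" "g \<in> lin_map R N' N"
  shows "(\<lambda>x y. \<beta> (f x) (g y)) \<in> bilin R M' N' P"
proof (rule bilinI)
  fix x assume "x \<in> carrier M'"
  then show "(\<lambda>y. \<beta> (f x) (g y)) \<in> lin_map R N' P"
    by (intro lin_map_comp[OF assms(3)] bilin_right[OF assms(1)] lin_map_closed[OF assms(2)])
next
  fix y assume "y \<in> carrier N'"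
  then show "(\<lambda>x. \<beta> (f x) (g y)) \<in> lin_map R M' P"
    by (intro lin_map_comp[OF assms(2)] bilin_left[OF assms(1)] lin_map_closed[OF assms(3)])
qed

lemma lin_comp_bilin:
  assumes "\<beta> \<in> bilin R M N P" "f \<in> lin_map R P Q"
  shows "(\<lambda>x y. f (\<beta> x y)) \<in> bilin R M N Q"
  by (rule bilinI) (intro lin_map_comp[OF _ assms(2)] bilin_right[OF assms(1)] bilin_left[OF assms(1)],
      assumption)+

section \<open>Free modules\<close>

lemma free_module_simps:
  "zero (free_module R S) = (\<lambda>s. \<zero>\<^bsub>R\<^esub>)"
  "add (free_module R S) = (\<lambda>u v s. u s \<oplus>\<^bsub>R\<^esub> v s)"
  "smult (free_module R S) = (\<lambda>r u s. r \<otimes>\<^bsub>R\<^esub> u s)"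
  by (simp_all add: free_module_def)

lemma free_module_carrier:
  "u \<in> carrier (free_module R S) \<longleftrightarrow>
    finite {s. u s \<noteq> \<zero>\<^bsub>R\<^esub>} \<and> (\<forall>s\<in>S. u s \<in> carrier R) \<and> (\<forall>s. s \<notin> S \<longrightarrow> u s = \<zero>\<^bsub>R\<^esub>)"
  by (simp add: free_module_def)

lemma free_module_support: "u \<in> carrier (free_module R S) \<Longrightarrow> {s. u s \<noteq> \<zero>\<^bsub>R\<^esub>} \<subseteq> S"
  by (auto simp: free_module_carrier)

lemma free_module_coeff: "cring R \<Longrightarrow> u \<in> carrier (free_module R S) \<Longrightarrow> u s \<in> carrier R"
  by (cases "s \<in> S") (auto simp: free_module_carrier ring.ring_simprules cring.axioms)

lemma free_module_module:
  assumes "cring R"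
  shows "module R (free_module R S)"
proof -
  interpret cring R by fact
  \<comment> \<open>A pointwise operation that sends two zeros to zero has its support inside the
    union of the two supports. Sum, negation and scaling are all instances.\<close>
  have sup: "finite {s. f s (u s) (v s) \<noteq> \<zero>\<^bsub>R\<^esub>}"
    if "finite {s. u s \<noteq> \<zero>\<^bsub>R\<^esub>}" "finite {s. v s \<noteq> \<zero>\<^bsub>R\<^esub>}" "\<And>s. f s \<zero>\<^bsub>R\<^esub> \<zero>\<^bsub>R\<^esub> = \<zero>\<^bsub>R\<^esub>"
    for f and u v :: "'s \<Rightarrow> _"
    by (rule finite_subset[OF _ finite_UnI[OF that(1,2)]]) (use that(3) in auto)
  show ?thesis
  proof (rule moduleI)
    show "abelian_group (free_module R S)"
    proof (rule abelian_groupI)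
      fix x y assume xy: "x \<in> carrier (free_module R S)" "y \<in> carrier (free_module R S)"
      show "x \<oplus>\<^bsub>free_module R S\<^esub> y \<in> carrier (free_module R S)"
        using xy sup[of x y "\<lambda>_. (\<oplus>\<^bsub>R\<^esub>)"] by (auto simp: free_module_carrier free_module_simps)
      show "x \<oplus>\<^bsub>free_module R S\<^esub> y = y \<oplus>\<^bsub>free_module R S\<^esub> x"
        using xy by (auto simp: free_module_coeff[OF is_cring] free_module_simps a_ac)
    next
      fix x assume x: "x \<in> carrier (free_module R S)"
      show "\<exists>y\<in>carrier (free_module R S). y \<oplus>\<^bsub>free_module R S\<^esub> x = \<zero>\<^bsub>free_module R S\<^esub>"
        using x sup[of x x "\<lambda>_ a b. \<ominus>\<^bsub>R\<^esub> a"]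
        by (intro bexI[of _ "\<lambda>s. \<ominus>\<^bsub>R\<^esub> x s"])
          (auto simp: free_module_carrier free_module_simps free_module_coeff[OF is_cring x] l_neg)
    next
      show "\<zero>\<^bsub>free_module R S\<^esub> \<in> carrier (free_module R S)"
        by (simp add: free_module_carrier free_module_simps)
    next
      fix x assume x: "x \<in> carrier (free_module R S)"
      show "\<zero>\<^bsub>free_module R S\<^esub> \<oplus>\<^bsub>free_module R S\<^esub> x = x"
        using free_module_coeff[OF is_cring x] by (auto simp: free_module_simps)
      fix y assume y: "y \<in> carrier (free_module R S)"
      fix z assume z: "z \<in> carrier (free_module R S)"
      show "x \<oplus>\<^bsub>free_module R S\<^esub> y \<oplus>\<^bsub>free_module R S\<^esub> z =
          x \<oplus>\<^bsub>free_module R S\<^esub> (y \<oplus>\<^bsub>free_module R S\<^esub> z)"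
        using free_module_coeff[OF is_cring x] free_module_coeff[OF is_cring y]
          free_module_coeff[OF is_cring z] by (auto simp: free_module_simps a_assoc)
    qed
  next
    fix a x assume ax: "a \<in> carrier R" "x \<in> carrier (free_module R S)"
    then show "a \<odot>\<^bsub>free_module R S\<^esub> x \<in> carrier (free_module R S)"
      using sup[of x x "\<lambda>_ b c. a \<otimes>\<^bsub>R\<^esub> b"]
      by (auto simp: free_module_carrier free_module_simps elim: rev_finite_subset)
  qed (auto simp: free_module_simps free_module_coeff[OF is_cring] l_distr r_distr m_assoc is_cring)
qed

lemma basis_vec_closed: "cring R \<Longrightarrow> s \<in> S \<Longrightarrow> basis_vec R s \<in> carrier (free_module R S)"
  by (auto simp: free_module_carrier basis_vec_def ring.ring_simprules cring.axioms)

lemma free_module_span: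
  assumes "cring R"
  shows "lin_span R (free_module R S) (basis_vec R ` S) = carrier (free_module R S)" (is "?L = ?R")
proof
  interpret cring R by fact
  let ?F = "free_module R S"
  interpret F: module R ?F by (rule free_module_module[OF is_cring])
  have S: "basis_vec R ` S \<subseteq> carrier ?F"
    by (auto intro: basis_vec_closed[OF is_cring])
  have sub: "submodule ?L R ?F"
    by (rule lin_span_submodule[OF F.module_axioms S])
  then show "?L \<subseteq> ?R"
    by (rule submodule_subset)
  \<comment> \<open>Induction over a finite set that contains the support: clearing the coefficient
    at \<open>a\<close> leaves a vector supported in the smaller set.\<close>
  have "u \<in> carrier ?F \<Longrightarrow> {s. u s \<noteq> \<zero>\<^bsub>R\<^esub>} \<subseteq> A \<Longrightarrow> u \<in> ?L" if "finite A" for A u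
    using that
  proof (induction A arbitrary: u rule: finite_induct)
    case empty
    then have "u = \<zero>\<^bsub>?F\<^esub>" by (auto simp: free_module_simps)
    then show ?case using submodule_zero[OF sub] by simp
  next
    case (insert a A)
    note u = insert.prems(1)
    show ?case
    proof (cases "a \<in> S")
      case True
      have v: "u(a := \<zero>\<^bsub>R\<^esub>) \<in> carrier ?F"
        using u by (auto simp: free_module_carrier intro!: finite_subset[of _ "{s. u s \<noteq> \<zero>\<^bsub>R\<^esub>}"])
      have u0: "u(a := \<zero>\<^bsub>R\<^esub>) \<in> ?L"
        by (rule insert.IH[OF v]) (use insert.prems in auto)
      have eq: "u = u(a := \<zero>\<^bsub>R\<^esub>) \<oplus>\<^bsub>?F\<^esub> u a \<odot>\<^bsub>?F\<^esub> basis_vec R a"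
        using free_module_coeff[OF is_cring u] by (auto simp: free_module_simps basis_vec_def)
      have "basis_vec R a \<in> ?L"
        using True by (intro subsetD[OF lin_span_superset]) simp
      then have "u a \<odot>\<^bsub>?F\<^esub> basis_vec R a \<in> ?L"
        by (rule submodule_smult[OF sub free_module_coeff[OF is_cring u]])
      with u0 show ?thesis
        by (subst eq) (rule submodule_add[OF sub])
    next
      case False
      then have "u a = \<zero>\<^bsub>R\<^esub>" using u by (auto simp: free_module_carrier)
      then show ?thesis using insert by auto
    qed
  qed
  then show "?R \<subseteq> ?L"
    by (auto simp: free_module_carrier)
qed

text \<open>\<open>lin_ext\<close> sums over the exact support, which changes under addition. A
  larger finite index set only adds zero terms, so several vectors can be summed over a common
  set.\<close>

lemma lin_ext_superset:
  assumes M: "module R M" and u: "u \<in> carrier (free_module R S)" and g: "g \<in> S \<rightarrow> carrier M"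
    and A: "finite A" "{s. u s \<noteq> \<zero>\<^bsub>R\<^esub>} \<subseteq> A" "A \<subseteq> S"
  shows "lin_ext R M g u = (\<Oplus>\<^bsub>M\<^esub>s\<in>A. u s \<odot>\<^bsub>M\<^esub> g s)"
proof -
  interpret module R M by fact
  show ?thesis
    unfolding lin_ext_def
    by (rule M.add.finprod_mono_neutral_cong_left)
      (use A g free_module_coeff[OF R.is_cring u] in \<open>auto simp: Pi_def subset_iff\<close>)
qed

lemma lin_ext_linear:
  assumes M: "module R M" and g: "g \<in> S \<rightarrow> carrier M"
  shows "lin_ext R M g \<in> lin_map R (free_module R S) M"
proof -
  interpret module R M by fact
  let ?F = "free_module R S"
  interpret F: module R ?F by (rule free_module_module[OF R.is_cring])
  have gc: "s \<in> S \<Longrightarrow> g s \<in> carrier M" for s using g by auto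
  show ?thesis
  proof (rule lin_mapI)
    fix u assume u: "u \<in> carrier ?F"
    then show "lin_ext R M g u \<in> carrier M"
      unfolding lin_ext_def using free_module_support[OF u] free_module_coeff[OF R.is_cring u]
      by (intro M.finsum_closed) (auto intro!: gc)
    fix v assume v: "v \<in> carrier ?F"
    define A where "A = {s. u s \<noteq> \<zero>\<^bsub>R\<^esub>} \<union> {s. v s \<noteq> \<zero>\<^bsub>R\<^esub>}"
    have A: "finite A" "A \<subseteq> S"
      using u v by (auto simp: A_def free_module_carrier)
    then have AS: "s \<in> A \<Longrightarrow> s \<in> S" for s by auto
    have "lin_ext R M g (u \<oplus>\<^bsub>?F\<^esub> v) = (\<Oplus>\<^bsub>M\<^esub>s\<in>A. (u \<oplus>\<^bsub>?F\<^esub> v) s \<odot>\<^bsub>M\<^esub> g s)"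
      by (rule lin_ext_superset[OF M _ g])
        (use u v A F.a_closed in \<open>auto simp: free_module_simps A_def\<close>)
    also have "\<dots> = (\<Oplus>\<^bsub>M\<^esub>s\<in>A. u s \<odot>\<^bsub>M\<^esub> g s \<oplus>\<^bsub>M\<^esub> v s \<odot>\<^bsub>M\<^esub> g s)"
      using u v AS gc
      by (intro M.finsum_cong')
        (auto simp: free_module_simps free_module_coeff[OF R.is_cring] smult_l_distr)
    also have "\<dots> = (\<Oplus>\<^bsub>M\<^esub>s\<in>A. u s \<odot>\<^bsub>M\<^esub> g s) \<oplus>\<^bsub>M\<^esub> (\<Oplus>\<^bsub>M\<^esub>s\<in>A. v s \<odot>\<^bsub>M\<^esub> g s)"
      using u v AS gc by (intro M.finsum_addf) (auto simp: free_module_coeff[OF R.is_cring])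
    also have "(\<Oplus>\<^bsub>M\<^esub>s\<in>A. u s \<odot>\<^bsub>M\<^esub> g s) = lin_ext R M g u"
      by (rule lin_ext_superset[OF M u g, symmetric]) (use A in \<open>auto simp: A_def\<close>)
    also have "(\<Oplus>\<^bsub>M\<^esub>s\<in>A. v s \<odot>\<^bsub>M\<^esub> g s) = lin_ext R M g v"
      by (rule lin_ext_superset[OF M v g, symmetric]) (use A in \<open>auto simp: A_def\<close>)
    finally show "lin_ext R M g (u \<oplus>\<^bsub>?F\<^esub> v) = lin_ext R M g u \<oplus>\<^bsub>M\<^esub> lin_ext R M g v" .
  next
    fix r u assume r: "r \<in> carrier R" and u: "u \<in> carrier ?F"
    \<comment> \<open>The support of \<open>r \<odot> u\<close> can be strictly smaller, since
      \<open>r\<close> may be zero or a zero divisor; the support of \<open>u\<close> serves both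
      sums.\<close>
    define A where "A = {s. u s \<noteq> \<zero>\<^bsub>R\<^esub>}"
    have A: "finite A" "A \<subseteq> S"
      using u by (auto simp: A_def free_module_carrier)
    then have AS: "s \<in> A \<Longrightarrow> s \<in> S" for s by auto
    have "lin_ext R M g (r \<odot>\<^bsub>?F\<^esub> u) = (\<Oplus>\<^bsub>M\<^esub>s\<in>A. (r \<odot>\<^bsub>?F\<^esub> u) s \<odot>\<^bsub>M\<^esub> g s)"
      by (rule lin_ext_superset[OF M _ g])
        (use r u A F.smult_closed in \<open>auto simp: free_module_simps A_def\<close>)
    also have "\<dots> = (\<Oplus>\<^bsub>M\<^esub>s\<in>A. r \<odot>\<^bsub>M\<^esub> (u s \<odot>\<^bsub>M\<^esub> g s))"
      using r u AS gc
      by (intro M.finsum_cong') (auto simp: free_module_simps free_module_coeff[OF R.is_cring] smult_assoc1)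
    also have "\<dots> = r \<odot>\<^bsub>M\<^esub> (\<Oplus>\<^bsub>M\<^esub>s\<in>A. u s \<odot>\<^bsub>M\<^esub> g s)"
      using r u AS gc A by (intro finsum_smult_ldistr[symmetric]) (auto simp: free_module_coeff[OF R.is_cring])
    also have "(\<Oplus>\<^bsub>M\<^esub>s\<in>A. u s \<odot>\<^bsub>M\<^esub> g s) = lin_ext R M g u"
      by (simp add: lin_ext_def A_def)
    finally show "lin_ext R M g (r \<odot>\<^bsub>?F\<^esub> u) = r \<odot>\<^bsub>M\<^esub> lin_ext R M g u" .
qed
qed

lemma lin_ext_basis:
assumes M: "module R M" and g: "g s \<in> carrier M"
shows "lin_ext R M g (basis_vec R s) = g s"
proof -
interpret module R M by fact
\<comment> \<open>Summing over \<open>{s}\<close> instead of the support also covers the zero ring,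
  where \<open>basis_vec R s\<close> has empty support.\<close>
have "lin_ext R M g (basis_vec R s) = (\<Oplus>\<^bsub>M\<^esub>t\<in>{s}. basis_vec R s t \<odot>\<^bsub>M\<^esub> g t)"
  by (rule lin_ext_superset[OF M, where S = "{s}"])
    (use g in \<open>auto simp: basis_vec_closed[OF R.is_cring], auto simp: basis_vec_def split: if_splits\<close>)
also have "\<dots> = g s"
  using g by (simp add: basis_vec_def)
finally show ?thesis .
qed

lemma free_module_map_eqI:
assumes f: "f \<in> lin_map R (free_module R S) N" and g: "g \<in> lin_map R (free_module R S) N"
  and N: "module R N"
  and "\<And>s. s \<in> S \<Longrightarrow> f (basis_vec R s) = g (basis_vec R s)" "u \<in> carrier (free_module R S)"
shows "f u = g u"
proof -
interpret module R N by fact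
show ?thesis
  by (rule lin_map_eq_on_span[OF f g free_module_module[OF R.is_cring] N, where S = "basis_vec R ` S"])
    (use assms free_module_span[OF R.is_cring] in \<open>auto intro: basis_vec_closed[OF R.is_cring]\<close>)
qed

section \<open>Tensor products\<close>

text \<open>The record built in \<open>tensor_module\<close>, for an arbitrary submodule
  \<open>K\<close>; the module axioms are settled before any bilinearity relation enters.\<close>

definition quotient_module :: "'k ring \<Rightarrow> ('k, 'a) module \<Rightarrow> 'a set \<Rightarrow> ('k, 'a set) module" where
  "quotient_module R F K =
      \<lparr>carrier = a_rcosets\<^bsub>F\<^esub> K, mult = undefined, one = undefined,
       zero = K, add = (\<lambda>s t. s <+>\<^bsub>F\<^esub> t),
       smult = (\<lambda>r t. \<Union>u\<in>t. K +>\<^bsub>F\<^esub> (r \<odot>\<^bsub>F\<^esub> u))\<rparr>"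

lemma tensor_module_quotient:
  "tensor_module R M N = quotient_module R (free_module R (carrier M \<times> carrier N)) (tensor_ker R M N)"
  by (simp add: tensor_module_def quotient_module_def Let_def)

lemma quotient_module_carrier: "carrier (quotient_module R F K) = (\<lambda>u. K +>\<^bsub>F\<^esub> u) ` carrier F"
  by (auto simp: quotient_module_def A_RCOSETS_def')

lemma submodule_abelian_subgroup:
  assumes "module R F" "submodule K R F"
  shows "abelian_subgroup K F"
proof -
  interpret module R F by fact
  interpret submodule K R F by fact
  show ?thesis
    by (intro abelian_subgroupI3 additive_subgroup.intro subgroup_axioms M.abelian_group_axioms)
qed

lemma quotient_module_ops:
  assumes F: "module R F" and K: "submodule K R F" and u: "u \<in> carrier F"
  shows "v \<in> carrier F \<Longrightarrow> (K +>\<^bsub>F\<^esub> u) \<oplus>\<^bsub>quotient_module R F K\<^esub> (K +>\<^bsub>F\<^esub> v) = K +>\<^bsub>F\<^esub> (u \<oplus>\<^bsub>F\<^esub> v)"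
    and "r \<in> carrier R \<Longrightarrow> r \<odot>\<^bsub>quotient_module R F K\<^esub> (K +>\<^bsub>F\<^esub> u) = K +>\<^bsub>F\<^esub> (r \<odot>\<^bsub>F\<^esub> u)"
proof -
  interpret F: module R F by fact
  interpret abelian_subgroup K F by (rule submodule_abelian_subgroup[OF F K])
  show "(K +>\<^bsub>F\<^esub> u) \<oplus>\<^bsub>quotient_module R F K\<^esub> (K +>\<^bsub>F\<^esub> v) = K +>\<^bsub>F\<^esub> (u \<oplus>\<^bsub>F\<^esub> v)"
    if "v \<in> carrier F"
    using a_rcos_sum[OF u that] by (simp add: quotient_module_def)
  show "r \<odot>\<^bsub>quotient_module R F K\<^esub> (K +>\<^bsub>F\<^esub> u) = K +>\<^bsub>F\<^esub> (r \<odot>\<^bsub>F\<^esub> u)" if r: "r \<in> carrier R"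
  proof -
    \<comment> \<open>Two representatives differ by an element of \<open>K\<close>, and scaling
      keeps the difference in \<open>K\<close>. So the union defining the scalar action consists of
      one and the same coset.\<close>
    have const: "K +>\<^bsub>F\<^esub> (r \<odot>\<^bsub>F\<^esub> w) = K +>\<^bsub>F\<^esub> (r \<odot>\<^bsub>F\<^esub> u)" if w: "w \<in> K +>\<^bsub>F\<^esub> u" for w
    proof -
      obtain k where k: "k \<in> K" "w = k \<oplus>\<^bsub>F\<^esub> u"
        using w by (auto simp: a_r_coset_def')
      then have "r \<odot>\<^bsub>F\<^esub> w = (r \<odot>\<^bsub>F\<^esub> k) \<oplus>\<^bsub>F\<^esub> (r \<odot>\<^bsub>F\<^esub> u)"
        using r u a_Hcarr by (simp add: F.smult_r_distr)
      then have "r \<odot>\<^bsub>F\<^esub> w \<in> K +>\<^bsub>F\<^esub> (r \<odot>\<^bsub>F\<^esub> u)"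
        using submodule_smult[OF K r k(1)] by (auto simp: a_r_coset_def')
      then show ?thesis
        using r u a_subgroup by (intro F.a_repr_independence[symmetric]) auto
    qed
    have "K +>\<^bsub>F\<^esub> u \<noteq> {}"
      using a_rcos_self[OF u] by blast
    then have "(\<Union>w\<in>K +>\<^bsub>F\<^esub> u. K +>\<^bsub>F\<^esub> (r \<odot>\<^bsub>F\<^esub> w)) = K +>\<^bsub>F\<^esub> (r \<odot>\<^bsub>F\<^esub> u)"
      by (rule SUP_eq_const) (rule const)
    then show ?thesis
      by (simp add: quotient_module_def)
  qed
qed

lemma quotient_module_zero:
  assumes F: "module R F" and K: "submodule K R F" and "k \<in> K"
  shows "K +>\<^bsub>F\<^esub> k = \<zero>\<^bsub>quotient_module R F K\<^esub>"
proof -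
  interpret F: module R F by fact
  interpret abelian_subgroup K F by (rule submodule_abelian_subgroup[OF F K])
  show ?thesis
    using assms(3) a_subgroup by (simp add: quotient_module_def F.a_coset_join2)
qed

lemma quotient_module_module:
  assumes F: "module R F" and K: "submodule K R F"
  shows "module R (quotient_module R F K)"
proof -
  interpret F: module R F by fact
  note ops = quotient_module_ops[OF F K]
  have z: "\<zero>\<^bsub>quotient_module R F K\<^esub> = K +>\<^bsub>F\<^esub> \<zero>\<^bsub>F\<^esub>"
    by (rule quotient_module_zero[OF F K, symmetric]) (rule submodule_zero[OF K])
  have inv: "\<exists>v\<in>carrier F. K +>\<^bsub>F\<^esub> (u \<oplus>\<^bsub>F\<^esub> v) = K +>\<^bsub>F\<^esub> \<zero>\<^bsub>F\<^esub>"
    if "u \<in> carrier F" for u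
    using that by (intro bexI[of _ "\<ominus>\<^bsub>F\<^esub> u"]) (auto simp: F.r_neg)
  show ?thesis
  proof (rule moduleI)
    show "abelian_group (quotient_module R F K)"
      by (rule abelian_groupI)
        (auto simp: quotient_module_carrier ops z F.a_ac inv)
  qed (auto simp: quotient_module_carrier ops F.is_cring F.smult_l_distr F.smult_r_distr
      F.smult_assoc1)
qed

lemma quotient_map_linear:
  assumes F: "module R F" and K: "submodule K R F"
  shows "(\<lambda>u. K +>\<^bsub>F\<^esub> u) \<in> lin_map R F (quotient_module R F K)"
  by (rule lin_mapI) (auto simp: quotient_module_ops[OF F K] quotient_module_carrier)

section \<open>Tensor products as quotients by the bilinearity relations\<close>

lemma bilinear_rels_closed:
  assumes "module R M" "module R N"
  shows "bilinear_rels R M N \<subseteq> carrier (free_module R (carrier M \<times> carrier N))"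
proof -
  interpret M: module R M by fact
  interpret N: module R N by fact
  interpret F: module R "free_module R (carrier M \<times> carrier N)"
    by (rule free_module_module[OF M.is_cring])
  note e = basis_vec_closed[OF M.is_cring, of _ "carrier M \<times> carrier N"]
  show ?thesis
    unfolding bilinear_rels_def Let_def by (auto intro!: e F.minus_closed F.a_closed F.smult_closed)
qed

lemma tensor_ker_submodule:
  assumes "module R M" "module R N"
  shows "submodule (tensor_ker R M N) R (free_module R (carrier M \<times> carrier N))"
  unfolding tensor_ker_def
  by (rule lin_span_submodule[OF free_module_module[OF module.axioms(1)[OF assms(1)]] bilinear_rels_closed[OF assms]])

lemma tensor_module_module [intro]:
  assumes "module R M" "module R N"
  shows "module R (tensor_module R M N)"
  unfolding tensor_module_quotient
  by (rule quotient_module_module[OF free_module_module[OF module.axioms(1)[OF assms(1)]] tensor_ker_submodule[OF assms]])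

lemma tensor_quotient_linear:
  assumes "module R M" "module R N"
  shows "(\<lambda>u. tensor_ker R M N +>\<^bsub>free_module R (carrier M \<times> carrier N)\<^esub> u)
    \<in> lin_map R (free_module R (carrier M \<times> carrier N)) (tensor_module R M N)"
  unfolding tensor_module_quotient
  by (rule quotient_map_linear[OF free_module_module[OF module.axioms(1)[OF assms(1)]] tensor_ker_submodule[OF assms]])

lemma pure_tensor_closed:
  assumes "module R M" "module R N" "m \<in> carrier M" "n \<in> carrier N"
  shows "pure_tensor R M N m n \<in> carrier (tensor_module R M N)"
  unfolding pure_tensor_def
  using assms(3,4)
  by (intro lin_map_closed[OF tensor_quotient_linear[OF assms(1,2)]]
      basis_vec_closed[OF module.axioms(1)[OF assms(1)]]) simp

text \<open>Each of the four laws is the vanishing of one kind of generator of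
  \<open>tensor_ker\<close> under the quotient map.\<close>

lemma pure_tensor_bilin:
  assumes M: "module R M" and N: "module R N"
  shows "pure_tensor R M N \<in> bilin R M N (tensor_module R M N)"
proof -
  interpret M: module R M by fact
  interpret N: module R N by fact
  define F where "F = free_module R (carrier M \<times> carrier N)"
  interpret F: module R F unfolding F_def by (rule free_module_module[OF M.is_cring])
  interpret T: module R "tensor_module R M N" by (rule tensor_module_module[OF M N])
  define q where "q = (\<lambda>u. tensor_ker R M N +>\<^bsub>F\<^esub> u)"
  have q: "q \<in> lin_map R F (tensor_module R M N)"
    unfolding F_def q_def by (rule tensor_quotient_linear[OF M N])
  have e: "basis_vec R (m, n) \<in> carrier F" if "m \<in> carrier M" "n \<in> carrier N" for m n
    unfolding F_def using that by (auto intro: basis_vec_closed[OF M.is_cring])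
  \<comment> \<open>Turns a listed relation \<open>u \<ominus> v\<close> into an equality of cosets;
    each law below then only has to exhibit its relation.\<close>
  have eq: "q u = q v" if "u \<ominus>\<^bsub>F\<^esub> v \<in> bilinear_rels R M N" "u \<in> carrier F" "v \<in> carrier F" for u v
  proof -
    have "u \<ominus>\<^bsub>F\<^esub> v \<in> tensor_ker R M N"
      unfolding tensor_ker_def using that(1) by (rule subsetD[OF lin_span_superset])
    then have "q (u \<ominus>\<^bsub>F\<^esub> v) = \<zero>\<^bsub>tensor_module R M N\<^esub>"
      unfolding q_def tensor_module_quotient F_def
      by (rule quotient_module_zero[OF F.module_axioms[unfolded F_def] tensor_ker_submodule[OF M N]])
    then have "q u \<ominus>\<^bsub>tensor_module R M N\<^esub> q v = \<zero>\<^bsub>tensor_module R M N\<^esub>"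
      using that lin_map_minus[OF q F.module_axioms T.module_axioms] by simp
    moreover have "q u \<in> carrier (tensor_module R M N)" "q v \<in> carrier (tensor_module R M N)"
      using that by (simp_all add: lin_map_closed[OF q])
    ultimately show ?thesis
      using T.minus_equality[of "q u" "\<ominus>\<^bsub>tensor_module R M N\<^esub> q v"] by (simp add: T.minus_eq)
  qed
  have p: "pure_tensor R M N m n = q (basis_vec R (m, n))" for m n
    by (simp add: pure_tensor_def q_def F_def)
  note qs = lin_map_add[OF q] lin_map_smult[OF q]
  note cl = pure_tensor_closed[OF M N]
  show ?thesis
  proof (rule bilinI; rule lin_mapI)
    fix m n assume m: "m \<in> carrier M" and n: "n \<in> carrier N"
    then show "pure_tensor R M N m n \<in> carrier (tensor_module R M N)"
      "pure_tensor R M N m n \<in> carrier (tensor_module R M N)" by (simp_all add: cl)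
    { fix n' assume n': "n' \<in> carrier N"
      have "q (basis_vec R (m, n \<oplus>\<^bsub>N\<^esub> n')) = q (basis_vec R (m, n) \<oplus>\<^bsub>F\<^esub> basis_vec R (m, n'))"
        using m n n' by (intro eq) (auto simp: bilinear_rels_def Let_def F_def[symmetric] e)
      then show "pure_tensor R M N m (n \<oplus>\<^bsub>N\<^esub> n') =
          pure_tensor R M N m n \<oplus>\<^bsub>tensor_module R M N\<^esub> pure_tensor R M N m n'"
        using m n n' by (simp add: p qs e) }
    { fix m' assume m': "m' \<in> carrier M"
      have "q (basis_vec R (m \<oplus>\<^bsub>M\<^esub> m', n)) = q (basis_vec R (m, n) \<oplus>\<^bsub>F\<^esub> basis_vec R (m', n))"
        using m n m' by (intro eq) (auto simp: bilinear_rels_def Let_def F_def[symmetric] e)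
      then show "pure_tensor R M N (m \<oplus>\<^bsub>M\<^esub> m') n =
          pure_tensor R M N m n \<oplus>\<^bsub>tensor_module R M N\<^esub> pure_tensor R M N m' n"
        using m n m' by (simp add: p qs e) }
    fix r assume r: "r \<in> carrier R"
    have "q (basis_vec R (m, r \<odot>\<^bsub>N\<^esub> n)) = q (r \<odot>\<^bsub>F\<^esub> basis_vec R (m, n))"
      using m n r by (intro eq) (auto simp: bilinear_rels_def Let_def F_def[symmetric] e)
    then show "pure_tensor R M N m (r \<odot>\<^bsub>N\<^esub> n) = r \<odot>\<^bsub>tensor_module R M N\<^esub> pure_tensor R M N m n"
      using m n r by (simp add: p qs e)
    have "q (basis_vec R (r \<odot>\<^bsub>M\<^esub> m, n)) = q (r \<odot>\<^bsub>F\<^esub> basis_vec R (m, n))"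
      using m n r by (intro eq) (auto simp: bilinear_rels_def Let_def F_def[symmetric] e)
    then show "pure_tensor R M N (r \<odot>\<^bsub>M\<^esub> m) n = r \<odot>\<^bsub>tensor_module R M N\<^esub> pure_tensor R M N m n"
      using m n r by (simp add: p qs e)
  qed
qed

definition pure_tensors :: "'k ring \<Rightarrow> ('k, 'a) module \<Rightarrow> ('k, 'b) module \<Rightarrow> ('a \<times> 'b \<Rightarrow> 'k) set set" where
  "pure_tensors R M N = {pure_tensor R M N m n | m n. m \<in> carrier M \<and> n \<in> carrier N}"

lemma pure_tensors_closed:
  "module R M \<Longrightarrow> module R N \<Longrightarrow> pure_tensors R M N \<subseteq> carrier (tensor_module R M N)"
  by (auto simp: pure_tensors_def pure_tensor_closed)

lemma submodule_preimage:
  assumes f: "f \<in> lin_map R M N" and M: "module R M" and N: "module R N" and H: "submodule H R N"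
  shows "submodule {x \<in> carrier M. f x \<in> H} R M"
proof -
  interpret module R M by fact
  show ?thesis
    using M N by (intro submodule_crit) (auto simp: lin_map_zero[OF f] lin_map_add[OF f]
        lin_map_smult[OF f] submodule_zero[OF H] submodule_add[OF H] submodule_smult[OF H])
qed

text \<open>Basis vectors of the free module map to pure tensors. The preimage of the span of the
  pure tensors is a submodule that contains all basis vectors, hence everything.\<close>

lemma tensor_span:
  assumes M: "module R M" and N: "module R N"
  shows "lin_span R (tensor_module R M N) (pure_tensors R M N) = carrier (tensor_module R M N)"
    (is "?L = carrier ?T")
proof
  have R: "cring R" using M by (rule module.axioms)
  let ?F = "free_module R (carrier M \<times> carrier N)"
  have sub: "submodule ?L R ?T"
    by (rule lin_span_submodule[OF tensor_module_module[OF M N] pure_tensors_closed[OF M N]])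
  then show "?L \<subseteq> carrier ?T" by (rule submodule_subset)
  have "lin_span R ?F (basis_vec R ` (carrier M \<times> carrier N)) \<subseteq>
      {u \<in> carrier ?F. tensor_ker R M N +>\<^bsub>?F\<^esub> u \<in> ?L}"
  proof (rule lin_span_least)
    show "submodule {u \<in> carrier ?F. tensor_ker R M N +>\<^bsub>?F\<^esub> u \<in> ?L} R ?F"
      by (rule submodule_preimage[OF tensor_quotient_linear[OF M N] free_module_module[OF R]
            tensor_module_module[OF M N] sub])
    show "basis_vec R ` (carrier M \<times> carrier N) \<subseteq> {u \<in> carrier ?F. tensor_ker R M N +>\<^bsub>?F\<^esub> u \<in> ?L}"
      using basis_vec_closed[OF R, of _ "carrier M \<times> carrier N"]
      by (auto simp: pure_tensors_def pure_tensor_def intro!: subsetD[OF lin_span_superset])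
  qed
  then show "carrier ?T \<subseteq> ?L"
    unfolding free_module_span[OF R] tensor_module_quotient quotient_module_carrier by auto
qed

text \<open>The uniqueness half of the universal property of the tensor product, and the standard
  way below to prove an identity in a tensor argument.\<close>

lemma tensor_eqI:
  assumes "f \<in> lin_map R (tensor_module R M N) P" "g \<in> lin_map R (tensor_module R M N) P"
    and "module R M" "module R N" "module R P"
    and "\<And>m n. m \<in> carrier M \<Longrightarrow> n \<in> carrier N \<Longrightarrow> f (pure_tensor R M N m n) = g (pure_tensor R M N m n)"
    and "t \<in> carrier (tensor_module R M N)"
  shows "f t = g t"
  by (rule lin_map_eq_on_span[OF assms(1,2) tensor_module_module assms(5) pure_tensors_closed])
    (use assms tensor_span[OF assms(3,4)] in \<open>auto simp: pure_tensors_def\<close>)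

section \<open>The universal property and functoriality of the tensor product\<close>

text \<open>The linear extension of a bilinear map kills every generator of
  \<open>tensor_ker\<close>, so it is constant on cosets. As cosets are nonempty, its image of a
  coset is a singleton and \<open>the_elem\<close> returns a genuine value.\<close>

lemma tensor_lift_coset:
  assumes M: "module R M" and N: "module R N" and P: "module R P" and \<beta>: "\<beta> \<in> bilin R M N P"
    and u: "u \<in> carrier (free_module R (carrier M \<times> carrier N))"
  shows "tensor_lift R P \<beta> (tensor_ker R M N +>\<^bsub>free_module R (carrier M \<times> carrier N)\<^esub> u)
    = lin_ext R P (\<lambda>(m, n). \<beta> m n) u"
proof -
  interpret M: module R M by fact
  interpret N: module R N by fact
  interpret P: module R P by fact
  define F where "F = free_module R (carrier M \<times> carrier N)"
  interpret F: module R F unfolding F_def by (rule free_module_module[OF M.is_cring])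
  define f where "f = lin_ext R P (\<lambda>(m, n). \<beta> m n)"
  have f: "f \<in> lin_map R F P"
    unfolding f_def F_def using bilin_closed[OF \<beta>] by (intro lin_ext_linear P.module_axioms) auto
  have K: "submodule (tensor_ker R M N) R F"
    unfolding F_def by (rule tensor_ker_submodule[OF M N])
  interpret abelian_subgroup "tensor_ker R M N" F
    by (rule submodule_abelian_subgroup[OF F.module_axioms K])
  have e: "basis_vec R (m, n) \<in> carrier F" if "m \<in> carrier M" "n \<in> carrier N" for m n
    unfolding F_def using that by (auto intro: basis_vec_closed[OF M.is_cring])
  have fe: "f (basis_vec R (m, n)) = \<beta> m n" if "m \<in> carrier M" "n \<in> carrier N" for m n
    unfolding f_def using bilin_closed[OF \<beta> that] by (subst lin_ext_basis[OF P]) auto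
  note fs = lin_map_add[OF f] lin_map_smult[OF f] lin_map_minus[OF f F.module_axioms P]
  have "tensor_ker R M N \<subseteq> {x \<in> carrier F. f x = \<zero>\<^bsub>P\<^esub>}"
    unfolding tensor_ker_def F_def[symmetric]
  proof (rule lin_span_least)
    show "submodule {x \<in> carrier F. f x = \<zero>\<^bsub>P\<^esub>} R F"
      by (rule submodule_eq_set[OF f lin_map_const_zero[OF P] F.module_axioms P])
    show "bilinear_rels R M N \<subseteq> {x \<in> carrier F. f x = \<zero>\<^bsub>P\<^esub>}"
      using bilin_closed[OF \<beta>]
      by (auto simp: bilinear_rels_def Let_def F_def[symmetric] e fs fe bilin_simps[OF \<beta>] P.M.minus_eq P.r_neg)
  qed
  then have K0: "f k = \<zero>\<^bsub>P\<^esub>" if "k \<in> tensor_ker R M N" for k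
    using that by auto
  have u': "u \<in> carrier F" using u by (simp add: F_def)
  then have const: "f w = f u" if "w \<in> tensor_ker R M N +>\<^bsub>F\<^esub> u" for w
    using that lin_map_closed[OF f] by (auto simp: a_r_coset_def' fs K0 a_Hcarr)
  have "f ` (tensor_ker R M N +>\<^bsub>F\<^esub> u) = {f u}"
    using a_rcos_self[OF u'] const by blast
  then show ?thesis
    by (simp add: tensor_lift_def F_def f_def)
qed

lemma tensor_lift_linear:
  assumes M: "module R M" and N: "module R N" and P: "module R P" and \<beta>: "\<beta> \<in> bilin R M N P"
  shows "tensor_lift R P \<beta> \<in> lin_map R (tensor_module R M N) P"
proof -
  interpret M: module R M by fact
  let ?F = "free_module R (carrier M \<times> carrier N)"
  interpret F: module R ?F by (rule free_module_module[OF M.is_cring])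
  have f: "lin_ext R P (\<lambda>(m, n). \<beta> m n) \<in> lin_map R ?F P"
    using bilin_closed[OF \<beta>] by (intro lin_ext_linear P) auto
  note l = tensor_lift_coset[OF M N P \<beta>]
  note ops = quotient_module_ops[OF F.module_axioms tensor_ker_submodule[OF M N]]
  show ?thesis
    unfolding tensor_module_quotient
    by (rule lin_mapI) (auto simp: quotient_module_carrier l ops lin_map_closed[OF f]
        lin_map_add[OF f] lin_map_smult[OF f])
qed

lemma tensor_lift_pure:
  assumes "module R M" "module R N" "module R P" "\<beta> \<in> bilin R M N P" "m \<in> carrier M" "n \<in> carrier N"
  shows "tensor_lift R P \<beta> (pure_tensor R M N m n) = \<beta> m n"
proof -
  have "cring R" using assms(1) by (rule module.axioms)
  then have "tensor_lift R P \<beta> (pure_tensor R M N m n) = lin_ext R P (\<lambda>(m, n). \<beta> m n) (basis_vec R (m, n))"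
    unfolding pure_tensor_def using assms
    by (intro tensor_lift_coset) (auto intro: basis_vec_closed)
  also have "\<dots> = \<beta> m n"
    using bilin_closed[OF assms(4-6)] by (subst lin_ext_basis[OF assms(3)]) auto
  finally show ?thesis .
qed

lemma tensor_lift_eqI:
  assumes "module R M" "module R N" "module R P" "\<beta> \<in> bilin R M N P"
    and "g \<in> lin_map R (tensor_module R M N) P"
    and "\<And>m n. m \<in> carrier M \<Longrightarrow> n \<in> carrier N \<Longrightarrow> g (pure_tensor R M N m n) = \<beta> m n"
    and "t \<in> carrier (tensor_module R M N)"
  shows "tensor_lift R P \<beta> t = g t"
  by (rule tensor_eqI[OF tensor_lift_linear[OF assms(1-4)] assms(5,1-3) _ assms(7)])
    (simp add: tensor_lift_pure[OF assms(1-4)] assms(6))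

text \<open>Meant for nested lifts: in the associator and in the product of a tensor algebra, the
  inner lift has to be linear in a variable that the outer one binds.\<close>

lemma tensor_lift_param:
  assumes M: "module R M" and N: "module R N" and P: "module R P" and L: "module R L"
    and \<beta>: "\<And>x. x \<in> carrier L \<Longrightarrow> (\<lambda>m n. \<beta> x m n) \<in> bilin R M N P"
    and lin: "\<And>m n. m \<in> carrier M \<Longrightarrow> n \<in> carrier N \<Longrightarrow> (\<lambda>x. \<beta> x m n) \<in> lin_map R L P"
    and t: "t \<in> carrier (tensor_module R M N)"
  shows "(\<lambda>x. tensor_lift R P (\<lambda>m n. \<beta> x m n) t) \<in> lin_map R L P"
proof -
  interpret L: module R L by fact
  note l = tensor_lift_linear[OF M N P \<beta>]
  note lp = tensor_lift_pure[OF M N P \<beta>]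
  show ?thesis
  proof (rule lin_mapI)
    fix x assume x: "x \<in> carrier L"
    then show "tensor_lift R P (\<beta> x) t \<in> carrier P"
      by (rule lin_map_closed[OF l t])
    { fix y assume y: "y \<in> carrier L"
      show "tensor_lift R P (\<beta> (x \<oplus>\<^bsub>L\<^esub> y)) t = tensor_lift R P (\<beta> x) t \<oplus>\<^bsub>P\<^esub> tensor_lift R P (\<beta> y) t"
        by (rule tensor_lift_eqI[OF M N P \<beta> lin_map_plus[OF P l[OF x] l[OF y]] _ t])
          (use x y in \<open>auto simp: lp lin_map_add[OF lin]\<close>) }
    fix r assume r: "r \<in> carrier R"
    show "tensor_lift R P (\<beta> (r \<odot>\<^bsub>L\<^esub> x)) t = r \<odot>\<^bsub>P\<^esub> tensor_lift R P (\<beta> x) t"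
      by (rule tensor_lift_eqI[OF M N P \<beta> lin_map_scale[OF P l[OF x] r] _ t])
        (use x r in \<open>auto simp: lp lin_map_smult[OF lin]\<close>)
  qed
qed

lemma pure_tensor_map_bilin:
  assumes "module R M'" "module R N'" "f \<in> lin_map R M M'" "g \<in> lin_map R N N'"
  shows "(\<lambda>m n. pure_tensor R M' N' (f m) (g n)) \<in> bilin R M N (tensor_module R M' N')"
  by (rule bilin_comp_lin[OF pure_tensor_bilin[OF assms(1,2)] assms(3,4)])

lemma tensor_map_linear:
  assumes "module R M" "module R N" "module R M'" "module R N'"
    and "f \<in> lin_map R M M'" "g \<in> lin_map R N N'"
  shows "tensor_map R M' N' f g \<in> lin_map R (tensor_module R M N) (tensor_module R M' N')"
  unfolding tensor_map_def
  by (intro tensor_lift_linear tensor_module_module pure_tensor_map_bilin assms)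

lemma tensor_map_pure:
  assumes "module R M" "module R N" "module R M'" "module R N'"
    and "f \<in> lin_map R M M'" "g \<in> lin_map R N N'" "m \<in> carrier M" "n \<in> carrier N"
  shows "tensor_map R M' N' f g (pure_tensor R M N m n) = pure_tensor R M' N' (f m) (g n)"
  unfolding tensor_map_def
  by (intro tensor_lift_pure tensor_module_module pure_tensor_map_bilin assms)

text \<open>Absorbs maps on the factors into the bilinear form. In this shape coassociativity
  becomes associativity of convolution.\<close>

lemma tensor_lift_map:
  assumes "module R M" "module R N" "module R M'" "module R N'" "module R P"
    and f: "f \<in> lin_map R M M'" and g: "g \<in> lin_map R N N'" and \<beta>: "\<beta> \<in> bilin R M' N' P"
    and "t \<in> carrier (tensor_module R M N)"
  shows "tensor_lift R P \<beta> (tensor_map R M' N' f g t) = tensor_lift R P (\<lambda>m n. \<beta> (f m) (g n)) t"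
  by (rule tensor_lift_eqI[symmetric, OF assms(1,2,5) bilin_comp_lin[OF \<beta> f g]
        lin_map_comp[OF tensor_map_linear[OF assms(1-4) f g] tensor_lift_linear[OF assms(3-5) \<beta>]] _ assms(9)])
    (use assms in \<open>simp add: tensor_map_pure tensor_lift_pure lin_map_closed[OF f] lin_map_closed[OF g]\<close>)

lemma tensor_map_comp:
  assumes "module R M" "module R N" "module R M'" "module R N'" "module R M''" "module R N''"
    and "f \<in> lin_map R M M'" "g \<in> lin_map R N N'" "f' \<in> lin_map R M' M''" "g' \<in> lin_map R N' N''"
    and "t \<in> carrier (tensor_module R M N)"
  shows "tensor_map R M'' N'' f' g' (tensor_map R M' N' f g t)
    = tensor_map R M'' N'' (\<lambda>x. f' (f x)) (\<lambda>x. g' (g x)) t"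
  unfolding tensor_map_def[of R M'' N'']
  by (rule tensor_lift_map[OF assms(1-4) tensor_module_module[OF assms(5,6)] assms(7,8)
        pure_tensor_map_bilin[OF assms(5,6,9,10)] assms(11)])

lemma tensor_lift_cong:
  assumes "module R M" "module R N" "module R P" "\<beta> \<in> bilin R M N P"
    and "\<And>m n. m \<in> carrier M \<Longrightarrow> n \<in> carrier N \<Longrightarrow> \<beta>' m n = \<beta> m n"
    and "t \<in> carrier (tensor_module R M N)"
  shows "tensor_lift R P \<beta>' t = tensor_lift R P \<beta> t"
proof -
  interpret M: module R M by fact
  interpret N: module R N by fact
  have "\<beta>' \<in> bilin R M N P"
    using assms(5) by (auto intro!: bilinI intro: lin_map_cong[OF bilin_right[OF assms(4)] assms(2)]
        lin_map_cong[OF bilin_left[OF assms(4)] assms(1)])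
  then show ?thesis
    by (rule tensor_lift_eqI[OF assms(1-3) _ tensor_lift_linear[OF assms(1-4)] _ assms(6)])
      (simp add: tensor_lift_pure[OF assms(1-4)] assms(5))
qed

lemma tensor_map_cong:
  assumes "module R M" "module R N" "module R M'" "module R N'"
    and "f \<in> lin_map R M M'" "g \<in> lin_map R N N'"
    and "\<And>m. m \<in> carrier M \<Longrightarrow> f' m = f m" "\<And>n. n \<in> carrier N \<Longrightarrow> g' n = g n"
    and "t \<in> carrier (tensor_module R M N)"
  shows "tensor_map R M' N' f' g' t = tensor_map R M' N' f g t"
  unfolding tensor_map_def
  by (rule tensor_lift_cong[OF assms(1,2) tensor_module_module[OF assms(3,4)]
        pure_tensor_map_bilin[OF assms(3-6)] _ assms(9)]) (simp add: assms(7,8))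

lemma tensor_assoc_aux_bilin:
  assumes L: "module R L" and M: "module R M" and N: "module R N" and n: "n \<in> carrier N"
  shows "(\<lambda>l m. pure_tensor R L (tensor_module R M N) l (pure_tensor R M N m n))
    \<in> bilin R L M (tensor_module R L (tensor_module R M N))"
  by (rule bilin_comp_lin[OF pure_tensor_bilin[OF L tensor_module_module[OF M N]] lin_map_id
        bilin_left[OF pure_tensor_bilin[OF M N] n]])

lemma tensor_assoc_bilin:
  assumes L: "module R L" and M: "module R M" and N: "module R N"
  shows "(\<lambda>s n. tensor_lift R (tensor_module R L (tensor_module R M N))
      (\<lambda>l m. pure_tensor R L (tensor_module R M N) l (pure_tensor R M N m n)) s)
    \<in> bilin R (tensor_module R L M) N (tensor_module R L (tensor_module R M N))"
proof (rule bilinI)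
  fix s assume s: "s \<in> carrier (tensor_module R L M)"
  show "(\<lambda>n. tensor_lift R (tensor_module R L (tensor_module R M N))
        (\<lambda>l m. pure_tensor R L (tensor_module R M N) l (pure_tensor R M N m n)) s)
      \<in> lin_map R N (tensor_module R L (tensor_module R M N))"
    by (intro tensor_lift_param[OF L M _ N _ _ s] tensor_module_module assms
        tensor_assoc_aux_bilin lin_map_comp[OF bilin_right[OF pure_tensor_bilin[OF M N]]
          bilin_right[OF pure_tensor_bilin[OF L tensor_module_module[OF M N]]]])
qed (intro tensor_lift_linear assms tensor_module_module tensor_assoc_aux_bilin)

lemma tensor_assoc_linear:
  assumes "module R L" "module R M" "module R N"
  shows "tensor_assoc R L M N \<in> lin_map R (tensor_module R (tensor_module R L M) N)
    (tensor_module R L (tensor_module R M N))"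
  unfolding tensor_assoc_def Let_def
  by (intro tensor_lift_linear tensor_assoc_bilin tensor_module_module assms)

lemma tensor_assoc_pure:
  assumes "module R L" "module R M" "module R N" "l \<in> carrier L" "m \<in> carrier M" "n \<in> carrier N"
  shows "tensor_assoc R L M N (pure_tensor R (tensor_module R L M) N (pure_tensor R L M l m) n)
    = pure_tensor R L (tensor_module R M N) l (pure_tensor R M N m n)"
  unfolding tensor_assoc_def Let_def
  by (subst tensor_lift_pure[OF _ _ _ tensor_assoc_bilin])
    (intro tensor_module_module assms pure_tensor_closed tensor_lift_pure tensor_assoc_aux_bilin)+

text \<open>Two passes of \<open>tensor_eqI\<close>: the outer one splits off \<open>n\<close>, the
  inner one treats the tensor \<open>s\<close> with \<open>n\<close> held fixed.\<close>

lemma tensor3_eqI: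
  assumes "f \<in> lin_map R (tensor_module R (tensor_module R L M) N) P"
    and "g \<in> lin_map R (tensor_module R (tensor_module R L M) N) P"
    and "module R L" "module R M" "module R N" "module R P"
    and "\<And>l m n. l \<in> carrier L \<Longrightarrow> m \<in> carrier M \<Longrightarrow> n \<in> carrier N \<Longrightarrow>
      f (pure_tensor R (tensor_module R L M) N (pure_tensor R L M l m) n)
      = g (pure_tensor R (tensor_module R L M) N (pure_tensor R L M l m) n)"
    and "t \<in> carrier (tensor_module R (tensor_module R L M) N)"
  shows "f t = g t"
proof (rule tensor_eqI[OF assms(1,2) tensor_module_module[OF assms(3,4)] assms(5,6) _ assms(8)])
  fix s n assume s: "s \<in> carrier (tensor_module R L M)" and n: "n \<in> carrier N"
  note p = bilin_left[OF pure_tensor_bilin[OF tensor_module_module[OF assms(3,4)] assms(5)] n]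
  show "f (pure_tensor R (tensor_module R L M) N s n) = g (pure_tensor R (tensor_module R L M) N s n)"
    by (rule tensor_eqI[OF lin_map_comp[OF p assms(1)] lin_map_comp[OF p assms(2)] assms(3,4,6) _ s])
      (simp add: assms(7) n)
qed

section \<open>Tensor products of algebras\<close>

lemma tensor_algebra_simps [simp]:
  "carrier (tensor_algebra R A B) = carrier (tensor_module R A B)"
  "add (tensor_algebra R A B) = add (tensor_module R A B)"
  "zero (tensor_algebra R A B) = zero (tensor_module R A B)"
  "smult (tensor_algebra R A B) = smult (tensor_module R A B)"
  "one (tensor_algebra R A B) = pure_tensor R A B \<one>\<^bsub>A\<^esub> \<one>\<^bsub>B\<^esub>"
  by (simp_all add: tensor_algebra_def Let_def)

text \<open>\<open>tensor_algebra\<close> differs from \<open>tensor_module\<close>, and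
  \<open>H_RT\<close> from the free module, only in the fields \<open>mult\<close> and
  \<open>one\<close>. Linear notions do not see these fields, so facts pass between the two
  records.\<close>

lemma lin_map_mult_update:
  fixes M M' :: "('k, 'a) module"
  assumes "carrier M' = carrier M" "add M' = add M" "smult M' = smult M"
  shows "lin_map R M' N = lin_map R M N" "lin_map R N M' = lin_map R N M"
  using assms by (simp_all add: lin_map_def)

lemmas lin_map_tensor_algebra [simp] =
  lin_map_mult_update[OF tensor_algebra_simps(1,2,4)]

lemma module_mult_update:
  fixes M M' :: "('k, 'a) module"
  assumes "carrier M' = carrier M" "add M' = add M" "zero M' = zero M" "smult M' = smult M"
  shows "module R M' = module R M"
  using assms
  by (simp add: module_def abelian_group_def abelian_monoid_def abelian_group_axioms_def
      module_axioms_def)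

lemma module_tensor_algebra [simp]: "module R (tensor_algebra R A B) = module R (tensor_module R A B)"
  by (rule module_mult_update) simp_all

lemma tensor_module_tensor_algebra [simp]:
  "tensor_module R (tensor_algebra R A B) N = tensor_module R (tensor_module R A B) N"
  "tensor_module R N (tensor_algebra R A B) = tensor_module R N (tensor_module R A B)"
  "pure_tensor R (tensor_algebra R A B) N = pure_tensor R (tensor_module R A B) N"
  "pure_tensor R N (tensor_algebra R A B) = pure_tensor R N (tensor_module R A B)"
  unfolding tensor_module_def tensor_ker_def bilinear_rels_def fun_eq_iff pure_tensor_def Let_def
    tensor_algebra_simps by (rule refl allI)+

lemma lin_ext_mult_update:
  fixes M M' :: "('k, 'a) module"
  assumes "carrier M' = carrier M" "add M' = add M" "zero M' = zero M" "smult M' = smult M"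
  shows "lin_ext R M' = lin_ext R M"
  using assms by (intro ext) (simp add: lin_ext_def finsum_def)

lemma assoc_algebra_module: "assoc_algebra R A \<Longrightarrow> module R A"
  by (simp add: assoc_algebra_def)

lemma mult_bilin:
  assumes "assoc_algebra R A"
  shows "(\<lambda>x y. x \<otimes>\<^bsub>A\<^esub> y) \<in> bilin R A A A"
proof -
  interpret assoc_algebra R A by fact
  show ?thesis
    by (intro bilinI lin_mapI) (auto simp: l_distr r_distr smult_mult_left smult_mult_right)
qed

lemma assoc_algebraI:
  assumes A: "module R A" and m: "(\<lambda>x y. x \<otimes>\<^bsub>A\<^esub> y) \<in> bilin R A A A" and "\<one>\<^bsub>A\<^esub> \<in> carrier A"
    and "\<And>x y z. x \<in> carrier A \<Longrightarrow> y \<in> carrier A \<Longrightarrow> z \<in> carrier A \<Longrightarrow>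
      (x \<otimes>\<^bsub>A\<^esub> y) \<otimes>\<^bsub>A\<^esub> z = x \<otimes>\<^bsub>A\<^esub> (y \<otimes>\<^bsub>A\<^esub> z)"
    and "\<And>x. x \<in> carrier A \<Longrightarrow> \<one>\<^bsub>A\<^esub> \<otimes>\<^bsub>A\<^esub> x = x"
    and "\<And>x. x \<in> carrier A \<Longrightarrow> x \<otimes>\<^bsub>A\<^esub> \<one>\<^bsub>A\<^esub> = x"
  shows "assoc_algebra R A"
proof -
  interpret module R A by fact
  note c = bilin_closed[OF m] and b = bilin_simps[OF m]
  have "ring A"
    by (rule ringI) (use assms c b in \<open>auto intro!: monoidI M.abelian_group_axioms\<close>)
  then show ?thesis
    by (intro assoc_algebra.intro assoc_algebra_axioms.intro A) (use b in auto)
qed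

text \<open>Both sides are bilinear in \<open>x\<close> and \<open>y\<close>, so the identity
  spreads from \<open>S\<close> to the carrier in the second argument, then in the first.\<close>

lemma multiplicative_on_span:
  assumes A: "assoc_algebra R A" and B: "assoc_algebra R B" and f: "f \<in> lin_map R A B"
    and S: "S \<subseteq> carrier A" "carrier A \<subseteq> lin_span R A S"
    and mult: "\<And>s t. s \<in> S \<Longrightarrow> t \<in> S \<Longrightarrow> f (s \<otimes>\<^bsub>A\<^esub> t) = f s \<otimes>\<^bsub>B\<^esub> f t"
    and xy: "x \<in> carrier A" "y \<in> carrier A"
  shows "f (x \<otimes>\<^bsub>A\<^esub> y) = f x \<otimes>\<^bsub>B\<^esub> f y"
proof -
  note mA = assoc_algebra_module[OF A] and mB = assoc_algebra_module[OF B]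
  note bA = mult_bilin[OF A] and bB = mult_bilin[OF B]
  have 1: "f (s \<otimes>\<^bsub>A\<^esub> y) = f s \<otimes>\<^bsub>B\<^esub> f y" if "s \<in> S" for s
  proof -
    have s: "s \<in> carrier A" using that S by auto
    show ?thesis
      by (rule lin_map_eq_on_span[OF lin_map_comp[OF bilin_right[OF bA s] f]
            lin_map_comp[OF f bilin_right[OF bB lin_map_closed[OF f s]]] mA mB S(1)])
        (use mult that xy S in auto)
  qed
  show ?thesis
    by (rule lin_map_eq_on_span[OF lin_map_comp[OF bilin_left[OF bA xy(2)] f]
          lin_map_comp[OF f bilin_left[OF bB lin_map_closed[OF f xy(2)]]] mA mB S(1)])
      (use 1 xy S in auto)
qed

locale two_algebras = A: assoc_algebra R A + B: assoc_algebra R B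
  for R :: "'k ring" and A :: "('k, 'a) module" and B :: "('k, 'b) module"
begin

abbreviation T where "T \<equiv> tensor_module R A B"
abbreviation AB where "AB \<equiv> tensor_algebra R A B"
abbreviation tens (infixl "\<diamondop>" 72) where "tens \<equiv> pure_tensor R A B"

lemma A: "module R A" and B: "module R B" and T: "module R T"
  by (auto intro: A.module_axioms B.module_axioms)

sublocale T: module R T by (rule T)

lemma tensor_mult_inner_bilin:
  assumes "a \<in> carrier A" "b \<in> carrier B"
  shows "(\<lambda>c d. (a \<otimes>\<^bsub>A\<^esub> c) \<diamondop> (b \<otimes>\<^bsub>B\<^esub> d)) \<in> bilin R A B T"
  by (intro pure_tensor_map_bilin A B bilin_right[OF mult_bilin] assms
      A.assoc_algebra_axioms B.assoc_algebra_axioms)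

lemma tensor_mult_outer_bilin:
  assumes t: "t \<in> carrier T"
  shows "(\<lambda>a b. tensor_lift R T (\<lambda>c d. (a \<otimes>\<^bsub>A\<^esub> c) \<diamondop> (b \<otimes>\<^bsub>B\<^esub> d)) t) \<in> bilin R A B T"
proof (rule bilinI)
  note mB = mult_bilin[OF B.assoc_algebra_axioms] and p = pure_tensor_bilin[OF A B]
  fix a assume a: "a \<in> carrier A"
  show "(\<lambda>b. tensor_lift R T (\<lambda>c d. (a \<otimes>\<^bsub>A\<^esub> c) \<diamondop> (b \<otimes>\<^bsub>B\<^esub> d)) t) \<in> lin_map R B T"
    by (rule tensor_lift_param[OF A B T B tensor_mult_inner_bilin[OF a] _ t])
      (auto intro: lin_map_comp[OF bilin_left[OF mB] bilin_right[OF p]] a)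
next
  note mA = mult_bilin[OF A.assoc_algebra_axioms] and p = pure_tensor_bilin[OF A B]
  fix b assume b: "b \<in> carrier B"
  show "(\<lambda>a. tensor_lift R T (\<lambda>c d. (a \<otimes>\<^bsub>A\<^esub> c) \<diamondop> (b \<otimes>\<^bsub>B\<^esub> d)) t) \<in> lin_map R A T"
    by (rule tensor_lift_param[OF A B T A tensor_mult_inner_bilin[OF _ b] _ t])
      (auto intro: lin_map_comp[OF bilin_left[OF mA] bilin_left[OF p]] b)
qed

lemma tensor_mult_def: "s \<otimes>\<^bsub>AB\<^esub> t = tensor_lift R T (\<lambda>a b. tensor_lift R T
    (\<lambda>c d. (a \<otimes>\<^bsub>A\<^esub> c) \<diamondop> (b \<otimes>\<^bsub>B\<^esub> d)) t) s"
  by (simp add: tensor_algebra_def Let_def)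

lemma tensor_mult_bilin: "(\<lambda>s t. s \<otimes>\<^bsub>AB\<^esub> t) \<in> bilin R T T T"
  unfolding tensor_mult_def
proof (rule bilinI)
  fix s assume s: "s \<in> carrier T"
  show "(\<lambda>t. tensor_lift R T (\<lambda>a b. tensor_lift R T (\<lambda>c d. (a \<otimes>\<^bsub>A\<^esub> c) \<diamondop> (b \<otimes>\<^bsub>B\<^esub> d)) t) s) \<in> lin_map R T T"
    by (rule tensor_lift_param[OF A B T T tensor_mult_outer_bilin _ s])
      (auto intro: tensor_lift_linear A B T tensor_mult_inner_bilin)
qed (intro tensor_lift_linear A B T tensor_mult_outer_bilin)

lemma tensor_mult_pure:
  assumes "a \<in> carrier A" "b \<in> carrier B" "c \<in> carrier A" "d \<in> carrier B"
  shows "(a \<diamondop> b) \<otimes>\<^bsub>AB\<^esub> (c \<diamondop> d) = (a \<otimes>\<^bsub>A\<^esub> c) \<diamondop> (b \<otimes>\<^bsub>B\<^esub> d)"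
  unfolding tensor_mult_def
  by (simp add: tensor_lift_pure[OF A B T] tensor_mult_outer_bilin tensor_mult_inner_bilin assms
      pure_tensor_closed[OF A B])

lemma assoc_algebra_tensor: "assoc_algebra R AB"
proof (rule assoc_algebraI)
  note m = tensor_mult_bilin
  note mc = bilin_closed[OF m]
  note pc = pure_tensor_closed[OF A B]
  show "module R AB" using T by simp
  show "(\<lambda>s t. s \<otimes>\<^bsub>AB\<^esub> t) \<in> bilin R AB AB AB"
    using m by (simp add: bilin_def)
  show "\<one>\<^bsub>AB\<^esub> \<in> carrier AB" by (simp add: pc)
  fix x assume "x \<in> carrier AB"
  then have x: "x \<in> carrier T" by simp
  show "\<one>\<^bsub>AB\<^esub> \<otimes>\<^bsub>AB\<^esub> x = x"
    by (rule tensor_eqI[OF bilin_right[OF m] lin_map_id A B T _ x]) (simp_all add: tensor_mult_pure pc)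
  show "x \<otimes>\<^bsub>AB\<^esub> \<one>\<^bsub>AB\<^esub> = x"
    by (rule tensor_eqI[OF bilin_left[OF m] lin_map_id A B T _ x]) (simp_all add: tensor_mult_pure pc)
  fix y assume "y \<in> carrier AB"
  then have y: "y \<in> carrier T" by simp
  fix z assume "z \<in> carrier AB"
  then have z: "z \<in> carrier T" by simp
  \<comment> \<open>Associativity is trilinear. On pure tensors it is associativity in the two
    factors; it is then extended one argument at a time, in the order \<open>z\<close>,
    \<open>y\<close>, \<open>x\<close>.\<close>
  have 1: "(s \<otimes>\<^bsub>AB\<^esub> t) \<otimes>\<^bsub>AB\<^esub> z = s \<otimes>\<^bsub>AB\<^esub> (t \<otimes>\<^bsub>AB\<^esub> z)"
    if "s \<in> pure_tensors R A B" "t \<in> pure_tensors R A B" for s t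
  proof -
    have st: "s \<in> carrier T" "t \<in> carrier T" using that pure_tensors_closed[OF A B] by auto
    show ?thesis
      by (rule tensor_eqI[OF bilin_right[OF m mc[OF st]]
            lin_map_comp[OF bilin_right[OF m st(2)] bilin_right[OF m st(1)]] A B T _ z])
        (use that in \<open>auto simp: pure_tensors_def tensor_mult_pure A.m_assoc B.m_assoc\<close>)
  qed
  have 2: "(s \<otimes>\<^bsub>AB\<^esub> y) \<otimes>\<^bsub>AB\<^esub> z = s \<otimes>\<^bsub>AB\<^esub> (y \<otimes>\<^bsub>AB\<^esub> z)" if "s \<in> pure_tensors R A B" for s
  proof -
    have s: "s \<in> carrier T" using that pure_tensors_closed[OF A B] by auto
    show ?thesis
      by (rule tensor_eqI[OF lin_map_comp[OF bilin_right[OF m s] bilin_left[OF m z]]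
            lin_map_comp[OF bilin_left[OF m z] bilin_right[OF m s]] A B T _ y])
        (use that 1 in \<open>auto simp: pure_tensors_def\<close>)
  qed
  show "(x \<otimes>\<^bsub>AB\<^esub> y) \<otimes>\<^bsub>AB\<^esub> z = x \<otimes>\<^bsub>AB\<^esub> (y \<otimes>\<^bsub>AB\<^esub> z)"
    by (rule tensor_eqI[OF lin_map_comp[OF bilin_left[OF m y] bilin_left[OF m z]]
          bilin_left[OF m mc[OF y z]] A B T _ x])
      (use 2 in \<open>auto simp: pure_tensors_def\<close>)
qed

end

lemmas assoc_algebra_tensor = two_algebras.assoc_algebra_tensor[OF two_algebras.intro]
lemmas tensor_mult_pure = two_algebras.tensor_mult_pure[OF two_algebras.intro]

section \<open>Algebra homomorphisms between tensor products\<close>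

definition alg_hom :: "'k ring \<Rightarrow> ('k, 'a) module \<Rightarrow> ('k, 'b) module \<Rightarrow> ('a \<Rightarrow> 'b) set" where
  "alg_hom R A B = lin_map R A B \<inter> ring_hom A B"

lemma alg_hom_lin: "f \<in> alg_hom R A B \<Longrightarrow> f \<in> lin_map R A B"
  and alg_hom_mult: "f \<in> alg_hom R A B \<Longrightarrow> x \<in> carrier A \<Longrightarrow> y \<in> carrier A \<Longrightarrow>
    f (x \<otimes>\<^bsub>A\<^esub> y) = f x \<otimes>\<^bsub>B\<^esub> f y"
  and alg_hom_one: "f \<in> alg_hom R A B \<Longrightarrow> f \<one>\<^bsub>A\<^esub> = \<one>\<^bsub>B\<^esub>"
  by (auto simp: alg_hom_def ring_hom_mult ring_hom_one)

lemma alg_homI: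
  assumes "f \<in> lin_map R A B"
    and "\<And>x y. x \<in> carrier A \<Longrightarrow> y \<in> carrier A \<Longrightarrow> f (x \<otimes>\<^bsub>A\<^esub> y) = f x \<otimes>\<^bsub>B\<^esub> f y"
    and "f \<one>\<^bsub>A\<^esub> = \<one>\<^bsub>B\<^esub>"
  shows "f \<in> alg_hom R A B"
  unfolding alg_hom_def
  using assms(1) by (auto intro!: ring_hom_memI lin_map_closed[OF assms(1)] lin_map_add[OF assms(1)] assms(2,3))

lemma alg_hom_id: "(\<lambda>x. x) \<in> alg_hom R A A"
  by (rule alg_homI) auto

lemma alg_hom_comp:
  assumes "f \<in> alg_hom R A B" "g \<in> alg_hom R B C"
  shows "(\<lambda>x. g (f x)) \<in> alg_hom R A C"
  by (rule alg_homI)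
    (simp_all add: lin_map_comp[OF alg_hom_lin[OF assms(1)] alg_hom_lin[OF assms(2)]]
      alg_hom_mult[OF assms(1)] alg_hom_mult[OF assms(2)] alg_hom_one[OF assms(1)]
      alg_hom_one[OF assms(2)] lin_map_closed[OF alg_hom_lin[OF assms(1)]])

text \<open>An application of \<open>multiplicative_on_span\<close> to the pure tensors. It serves
  for \<open>f \<otimes> g\<close>, for the associator and for the contraction of one factor by the
  counit.\<close>

lemma tensor_alg_homI:
  assumes A: "assoc_algebra R A" and B: "assoc_algebra R B" and C: "assoc_algebra R C"
    and f: "f \<in> lin_map R (tensor_module R A B) C"
    and one: "f (pure_tensor R A B \<one>\<^bsub>A\<^esub> \<one>\<^bsub>B\<^esub>) = \<one>\<^bsub>C\<^esub>"
    and mult: "\<And>a b a' b'. a \<in> carrier A \<Longrightarrow> b \<in> carrier B \<Longrightarrow> a' \<in> carrier A \<Longrightarrow> b' \<in> carrier B \<Longrightarrow>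
      f (pure_tensor R A B (a \<otimes>\<^bsub>A\<^esub> a') (b \<otimes>\<^bsub>B\<^esub> b'))
      = f (pure_tensor R A B a b) \<otimes>\<^bsub>C\<^esub> f (pure_tensor R A B a' b')"
  shows "f \<in> alg_hom R (tensor_algebra R A B) C"
proof (rule alg_homI)
  note mA = assoc_algebra_module[OF A] and mB = assoc_algebra_module[OF B]
  show lin: "f \<in> lin_map R (tensor_algebra R A B) C" using f by simp
  fix x y assume xy: "x \<in> carrier (tensor_algebra R A B)" "y \<in> carrier (tensor_algebra R A B)"
  have span: "lin_span R (tensor_algebra R A B) S = lin_span R (tensor_module R A B) S" for S
    by (simp add: lin_span_def submodule_def submodule_axioms_def)
  show "f (x \<otimes>\<^bsub>tensor_algebra R A B\<^esub> y) = f x \<otimes>\<^bsub>C\<^esub> f y"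
  proof (rule multiplicative_on_span[OF assoc_algebra_tensor[OF A B] C lin _ _ _ xy])
    show "pure_tensors R A B \<subseteq> carrier (tensor_algebra R A B)"
      using pure_tensors_closed[OF mA mB] by simp
    show "carrier (tensor_algebra R A B) \<subseteq> lin_span R (tensor_algebra R A B) (pure_tensors R A B)"
      using tensor_span[OF mA mB] by (simp add: span)
  qed (auto simp: pure_tensors_def tensor_mult_pure[OF A B] mult)
qed (use one in simp)

lemma tensor_map_alg_hom:
  assumes A: "assoc_algebra R A" and B: "assoc_algebra R B"
    and A': "assoc_algebra R A'" and B': "assoc_algebra R B'"
    and f: "f \<in> alg_hom R A A'" and g: "g \<in> alg_hom R B B'"
  shows "tensor_map R A' B' f g \<in> alg_hom R (tensor_algebra R A B) (tensor_algebra R A' B')"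
proof -
  note m = assoc_algebra_module[OF A] assoc_algebra_module[OF B]
    assoc_algebra_module[OF A'] assoc_algebra_module[OF B']
  interpret A: assoc_algebra R A by fact
  interpret B: assoc_algebra R B by fact
  note lin = alg_hom_lin[OF f] alg_hom_lin[OF g]
  show ?thesis
    by (rule tensor_alg_homI[OF A B assoc_algebra_tensor[OF A' B']])
      (simp_all add: tensor_map_linear[OF m lin] tensor_map_pure[OF m lin] alg_hom_one[OF f]
        alg_hom_one[OF g] alg_hom_mult[OF f] alg_hom_mult[OF g] tensor_mult_pure[OF A' B']
        lin_map_closed[OF lin(1)] lin_map_closed[OF lin(2)])
qed

text \<open>Makes the side of coassociativity that passes through
  \<open>(H \<otimes> H) \<otimes> H\<close> an algebra homomorphism, so that it can be tested on
  generators.\<close>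

lemma tensor_assoc_alg_hom:
  assumes A: "assoc_algebra R A" and B: "assoc_algebra R B" and C: "assoc_algebra R C"
  shows "tensor_assoc R A B C \<in> alg_hom R (tensor_algebra R (tensor_algebra R A B) C)
    (tensor_algebra R A (tensor_algebra R B C))"
proof (rule tensor_alg_homI)
  note AB = assoc_algebra_tensor[OF A B] and BC = assoc_algebra_tensor[OF B C]
  note mA = assoc_algebra_module[OF A] and mB = assoc_algebra_module[OF B]
    and mC = assoc_algebra_module[OF C]
  note mAB = tensor_module_module[OF mA mB] and mBC = tensor_module_module[OF mB mC]
  interpret A: assoc_algebra R A by fact
  interpret B: assoc_algebra R B by fact
  interpret C: assoc_algebra R C by fact
  interpret AB: assoc_algebra R "tensor_algebra R A B" by fact
  interpret BC: assoc_algebra R "tensor_algebra R B C" by fact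
  let ?ABC = "tensor_algebra R A (tensor_algebra R B C)"
  note ABC = assoc_algebra_tensor[OF A BC]
  show "assoc_algebra R (tensor_algebra R A B)" "assoc_algebra R C"
    "assoc_algebra R ?ABC" by fact+
  show lin: "tensor_assoc R A B C \<in> lin_map R (tensor_module R (tensor_algebra R A B) C) ?ABC"
    using tensor_assoc_linear[OF mA mB mC] by simp
  show "tensor_assoc R A B C (pure_tensor R (tensor_algebra R A B) C \<one>\<^bsub>tensor_algebra R A B\<^esub> \<one>\<^bsub>C\<^esub>) = \<one>\<^bsub>?ABC\<^esub>"
    by (simp add: tensor_assoc_pure[OF mA mB mC])
  fix s c s' c'
  assume "s \<in> carrier (tensor_algebra R A B)" and c: "c \<in> carrier C"
    and "s' \<in> carrier (tensor_algebra R A B)" and c': "c' \<in> carrier C"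
  then have s: "s \<in> carrier (tensor_module R A B)" and s': "s' \<in> carrier (tensor_module R A B)"
    by simp_all
  let ?p = "\<lambda>s c. tensor_assoc R A B C (pure_tensor R (tensor_module R A B) C s c)"
  have assoc_p: "?p \<in> bilin R (tensor_module R A B) C (tensor_module R A (tensor_module R B C))"
    by (rule lin_comp_bilin[OF pure_tensor_bilin[OF mAB mC] tensor_assoc_linear[OF mA mB mC]])
  have mul: "(\<lambda>s t. s \<otimes>\<^bsub>?ABC\<^esub> t) \<in> bilin R (tensor_module R A (tensor_module R B C))
      (tensor_module R A (tensor_module R B C)) (tensor_module R A (tensor_module R B C))"
    using mult_bilin[OF ABC] by (simp add: bilin_def)
  have mulAB: "(\<lambda>s t. s \<otimes>\<^bsub>tensor_algebra R A B\<^esub> t) \<in> bilin R (tensor_module R A B) (tensor_module R A B) (tensor_module R A B)"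
    using mult_bilin[OF AB] by (simp add: bilin_def)
  have cc': "c \<otimes>\<^bsub>C\<^esub> c' \<in> carrier C" using c c' by simp
  note mT = tensor_module_module[OF mA mBC]
  \<comment> \<open>A pure tensor of \<open>(A \<otimes> B) \<otimes> C\<close> still has an
    arbitrary first entry from \<open>A \<otimes> B\<close>. So after the case of pure entries two
    more passes follow, in \<open>s'\<close> and then in \<open>s\<close>.\<close>
  have 0: "?p (pure_tensor R A B a b \<otimes>\<^bsub>tensor_algebra R A B\<^esub> pure_tensor R A B a' b') (c \<otimes>\<^bsub>C\<^esub> c')
      = ?p (pure_tensor R A B a b) c \<otimes>\<^bsub>?ABC\<^esub> ?p (pure_tensor R A B a' b') c'"
    if "a \<in> carrier A" "b \<in> carrier B" "a' \<in> carrier A" "b' \<in> carrier B" for a b a' b'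
    using that c c' tensor_mult_pure[OF A BC, of a "pure_tensor R B C b c" a' "pure_tensor R B C b' c'"]
    by (simp add: tensor_mult_pure[OF A B] tensor_mult_pure[OF B C] tensor_assoc_pure[OF mA mB mC]
        pure_tensor_closed[OF mB mC])
  have 1: "?p (pure_tensor R A B a b \<otimes>\<^bsub>tensor_algebra R A B\<^esub> s') (c \<otimes>\<^bsub>C\<^esub> c')
      = ?p (pure_tensor R A B a b) c \<otimes>\<^bsub>?ABC\<^esub> ?p s' c'"
    if a: "a \<in> carrier A" and b: "b \<in> carrier B" for a b
  proof -
    note p = pure_tensor_closed[OF mA mB a b]
    show ?thesis
      by (rule tensor_eqI[OF lin_map_comp[OF bilin_right[OF mulAB p] bilin_left[OF assoc_p cc']]
            lin_map_comp[OF bilin_left[OF assoc_p c'] bilin_right[OF mul bilin_closed[OF assoc_p p c]]]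
            mA mB mT 0[OF a b] s'])
  qed
  have "?p (s \<otimes>\<^bsub>tensor_algebra R A B\<^esub> s') (c \<otimes>\<^bsub>C\<^esub> c') = ?p s c \<otimes>\<^bsub>?ABC\<^esub> ?p s' c'"
    by (rule tensor_eqI[OF lin_map_comp[OF bilin_left[OF mulAB s'] bilin_left[OF assoc_p cc']]
          lin_map_comp[OF bilin_left[OF assoc_p c] bilin_left[OF mul bilin_closed[OF assoc_p s' c']]]
          mA mB mT 1 s])
  then show "tensor_assoc R A B C (pure_tensor R (tensor_algebra R A B) C (s \<otimes>\<^bsub>tensor_algebra R A B\<^esub> s') (c \<otimes>\<^bsub>C\<^esub> c'))
    = tensor_assoc R A B C (pure_tensor R (tensor_algebra R A B) C s c) \<otimes>\<^bsub>?ABC\<^esub>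
      tensor_assoc R A B C (pure_tensor R (tensor_algebra R A B) C s' c')"
    by simp
qed

section \<open>Antipodes of connected cofiltered bialgebras\<close>

lemma tensor_lift_add:
  assumes "module R M" "module R N" "module R P" "\<beta> \<in> bilin R M N P" "\<beta>' \<in> bilin R M N P"
    and "\<gamma> \<in> bilin R M N P"
    and "\<And>m n. m \<in> carrier M \<Longrightarrow> n \<in> carrier N \<Longrightarrow> \<gamma> m n = \<beta> m n \<oplus>\<^bsub>P\<^esub> \<beta>' m n"
    and "t \<in> carrier (tensor_module R M N)"
  shows "tensor_lift R P \<gamma> t = tensor_lift R P \<beta> t \<oplus>\<^bsub>P\<^esub> tensor_lift R P \<beta>' t"
  by (rule tensor_lift_eqI[OF assms(1-3,6) lin_map_plus[OF assms(3) tensor_lift_linear[OF assms(1-4)]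
          tensor_lift_linear[OF assms(1-3,5)]] _ assms(8)])
    (simp add: tensor_lift_pure[OF assms(1-4)] tensor_lift_pure[OF assms(1-3,5)] assms(7))

section \<open>Convolution of linear endomorphisms\<close>

context bialgebra
begin

lemma assoc_algebra: "assoc_algebra R A" and module: "module R A"
  by (rule assoc_algebra_axioms, rule module_axioms)

text \<open>The antipode condition in \<open>hopf_algebra\<close> says that \<open>S\<close> is a
  two-sided inverse of the identity for this product, with unit \<open>conv_unit\<close>.\<close>

definition conv :: "('a \<Rightarrow> 'a) \<Rightarrow> ('a \<Rightarrow> 'a) \<Rightarrow> 'a \<Rightarrow> 'a" where
  "conv f g a = tensor_lift R A (\<lambda>b c. f b \<otimes>\<^bsub>A\<^esub> g c) (\<Delta> a)"

definition conv_unit :: "'a \<Rightarrow> 'a" where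
  "conv_unit a = \<epsilon> a \<odot>\<^bsub>A\<^esub> \<one>\<^bsub>A\<^esub>"

lemma comult_closed: "a \<in> carrier A \<Longrightarrow> \<Delta> a \<in> carrier (tensor_module R A A)"
  by (rule lin_map_closed[OF comult_linear])

lemma conv_bilin:
  assumes "f \<in> lin_map R A A" "g \<in> lin_map R A A"
  shows "(\<lambda>b c. f b \<otimes>\<^bsub>A\<^esub> g c) \<in> bilin R A A A"
  by (rule bilin_comp_lin[OF mult_bilin[OF assoc_algebra] assms])

lemma conv_linear:
  assumes "f \<in> lin_map R A A" "g \<in> lin_map R A A"
  shows "conv f g \<in> lin_map R A A"
  unfolding conv_def
  by (rule lin_map_comp[OF comult_linear tensor_lift_linear[OF module module module conv_bilin[OF assms]]])

lemma conv_unit_linear: "conv_unit \<in> lin_map R A A"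
  unfolding conv_unit_def by (rule lin_map_smult_vec[OF module one_closed counit_linear])

text \<open>Both bracketings evaluate the same trilinear form
  \<open>f x \<otimes> g y \<otimes> h z\<close> at an iterated coproduct. Associativity of the
  product matches the two forms across the associator (\<open>eq\<close>), and coassociativity
  matches their arguments.\<close>

lemma conv_assoc:
  assumes f: "f \<in> lin_map R A A" and g: "g \<in> lin_map R A A" and h: "h \<in> lin_map R A A"
    and a: "a \<in> carrier A"
  shows "conv (conv f g) h a = conv f (conv g h) a"
proof -
  let ?T = "tensor_module R A A"
  note m = module
  note T = tensor_module_module[OF m m]
  note mb = mult_bilin[OF assoc_algebra]
  let ?fg = "tensor_lift R A (\<lambda>x y. f x \<otimes>\<^bsub>A\<^esub> g y)"
  let ?gh = "tensor_lift R A (\<lambda>x y. g x \<otimes>\<^bsub>A\<^esub> h y)"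
  note fg = tensor_lift_linear[OF m m m conv_bilin[OF f g]]
  note gh = tensor_lift_linear[OF m m m conv_bilin[OF g h]]
  let ?L = "\<lambda>s c. ?fg s \<otimes>\<^bsub>A\<^esub> h c" and ?L' = "\<lambda>b t. f b \<otimes>\<^bsub>A\<^esub> ?gh t"
  have L: "?L \<in> bilin R ?T A A" by (rule bilin_comp_lin[OF mb fg h])
  have L': "?L' \<in> bilin R A ?T A" by (rule bilin_comp_lin[OF mb f gh])
  let ?D = "tensor_map R ?T A \<Delta> (\<lambda>x. x) (\<Delta> a)"
  have D: "?D \<in> carrier (tensor_module R ?T A)"
    by (rule lin_map_closed[OF tensor_map_linear[OF m m T m comult_linear lin_map_id] comult_closed[OF a]])
  note pure_lift = tensor_lift_pure[OF m m m]
  have eq: "tensor_lift R A ?L ?D = tensor_lift R A ?L' (tensor_assoc R A A A ?D)"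
  proof (rule tensor3_eqI[OF tensor_lift_linear[OF T m m L]
        lin_map_comp[OF tensor_assoc_linear[OF m m m] tensor_lift_linear[OF m T m L']] m m m m _ D])
    fix x y z assume xyz: "x \<in> carrier A" "y \<in> carrier A" "z \<in> carrier A"
    then show "tensor_lift R A ?L (pure_tensor R ?T A (pure_tensor R A A x y) z)
      = tensor_lift R A ?L' (tensor_assoc R A A A (pure_tensor R ?T A (pure_tensor R A A x y) z))"
      by (simp add: tensor_assoc_pure[OF m m m] tensor_lift_pure[OF T m m L]
          tensor_lift_pure[OF m T m L'] pure_tensor_closed[OF m m] pure_lift[OF conv_bilin[OF f g]]
          pure_lift[OF conv_bilin[OF g h]] m_assoc lin_map_closed[OF f] lin_map_closed[OF g]
          lin_map_closed[OF h])
  qed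
  have "conv (conv f g) h a = tensor_lift R A (\<lambda>b c. ?L (\<Delta> b) c) (\<Delta> a)"
    by (simp add: conv_def)
  also have "\<dots> = tensor_lift R A ?L ?D"
    by (rule tensor_lift_map[OF m m T m m comult_linear lin_map_id L comult_closed[OF a], symmetric])
  also note eq
  also have "tensor_assoc R A A A ?D = tensor_map R A ?T (\<lambda>x. x) \<Delta> (\<Delta> a)"
    by (rule coassoc[OF a])
  also have "tensor_lift R A ?L' \<dots> = tensor_lift R A (\<lambda>b c. ?L' b (\<Delta> c)) (\<Delta> a)"
    by (rule tensor_lift_map[OF m m m T m lin_map_id comult_linear L' comult_closed[OF a]])
  also have "\<dots> = conv f (conv g h) a"
    by (simp add: conv_def)
  finally show ?thesis .
qed

lemma counit_closed: "a \<in> carrier A \<Longrightarrow> \<epsilon> a \<in> carrier R"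
  using lin_map_closed[OF counit_linear] by simp

lemma smult_bilin: "(\<lambda>a b. \<epsilon> a \<odot>\<^bsub>A\<^esub> b) \<in> bilin R A A A" "(\<lambda>a b. \<epsilon> b \<odot>\<^bsub>A\<^esub> a) \<in> bilin R A A A"
  by (intro bilinI lin_map_smult_vec[OF module _ counit_linear]
      lin_map_scale[OF module lin_map_id] counit_closed; assumption)+

text \<open>The scalar \<open>\<epsilon> b\<close> moves out of the product and then inside
  \<open>f\<close> by linearity; what remains is \<open>f\<close> applied to the left counit
  law.\<close>

lemma conv_unit_left:
  assumes f: "f \<in> lin_map R A A" and a: "a \<in> carrier A"
  shows "conv conv_unit f a = f a"
proof -
  note m = module
  have "conv conv_unit f a = f (tensor_lift R A (\<lambda>a b. \<epsilon> a \<odot>\<^bsub>A\<^esub> b) (\<Delta> a))"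
    unfolding conv_def
    by (rule tensor_lift_eqI[OF m m m conv_bilin[OF conv_unit_linear f]
          lin_map_comp[OF tensor_lift_linear[OF m m m smult_bilin(1)] f] _ comult_closed[OF a]])
      (simp add: tensor_lift_pure[OF m m m smult_bilin(1)] conv_unit_def counit_closed
        smult_mult_left lin_map_smult[OF f] lin_map_closed[OF f])
  then show ?thesis by (simp add: counit_left[OF a])
qed

lemma conv_unit_right:
  assumes f: "f \<in> lin_map R A A" and a: "a \<in> carrier A"
  shows "conv f conv_unit a = f a"
proof -
  note m = module
  have "conv f conv_unit a = f (tensor_lift R A (\<lambda>a b. \<epsilon> b \<odot>\<^bsub>A\<^esub> a) (\<Delta> a))"
    unfolding conv_def
    by (rule tensor_lift_eqI[OF m m m conv_bilin[OF f conv_unit_linear]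
          lin_map_comp[OF tensor_lift_linear[OF m m m smult_bilin(2)] f] _ comult_closed[OF a]])
      (simp add: tensor_lift_pure[OF m m m smult_bilin(2)] conv_unit_def counit_closed
        smult_mult_right lin_map_smult[OF f] lin_map_closed[OF f])
  then show ?thesis by (simp add: counit_right[OF a])
qed

text \<open>The decomposition of \<open>k\<close> is asked for on the carrier only, because that is
  where \<open>conv_unit_decomp\<close> provides it.\<close>

lemma conv_add_left:
  assumes f: "f \<in> lin_map R A A" and f': "f' \<in> lin_map R A A" and g: "g \<in> lin_map R A A"
    and k: "\<And>x. x \<in> carrier A \<Longrightarrow> k x = f x \<oplus>\<^bsub>A\<^esub> f' x" and a: "a \<in> carrier A"
  shows "conv k g a = conv f g a \<oplus>\<^bsub>A\<^esub> conv f' g a"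
proof -
  have "k \<in> lin_map R A A"
    by (rule lin_map_cong[OF lin_map_plus[OF module f f'] module k])
  then show ?thesis
    unfolding conv_def
    by (intro tensor_lift_add[OF module module module] conv_bilin f f' g comult_closed[OF a])
      (simp_all add: k l_distr lin_map_closed[OF f] lin_map_closed[OF f'] lin_map_closed[OF g])
qed

end

section \<open>Inverting the identity along a connected filtration\<close>

locale connected_cofiltered_bialgebra =
  bialgebra R A \<Delta> \<epsilon> + connected_cofiltered_coalgebra R A \<Delta> \<epsilon> "\<lambda>r. r \<odot>\<^bsub>A\<^esub> \<one>\<^bsub>A\<^esub>" Fil
  for R :: "'k ring" and A :: "('k, 'a) module" and \<Delta> \<epsilon> Fil
begin

lemma fil_mono: "m \<le> n \<Longrightarrow> Fil m \<subseteq> Fil n"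
  using fil_increasing by (rule lift_Suc_mono_le)

lemma fil_carrier: "Fil n \<subseteq> carrier A"
  by (rule submodule_subset[OF fil_submodule])

text \<open>By \<open>fil_comult\<close> the coproduct of an element of \<open>Fil n\<close> lies in
  the span of the tensors with \<open>p + q = n\<close>, so a convolution on \<open>Fil n\<close>
  sees no other pairs of arguments.\<close>

lemma conv_eq_on_fil:
  assumes fs: "f \<in> lin_map R A A" "g \<in> lin_map R A A" "f' \<in> lin_map R A A" "g' \<in> lin_map R A A"
    and eq: "\<And>p q b c. p + q = n \<Longrightarrow> b \<in> Fil p \<Longrightarrow> c \<in> Fil q \<Longrightarrow>
      f b \<otimes>\<^bsub>A\<^esub> g c = f' b \<otimes>\<^bsub>A\<^esub> g' c"
    and a: "a \<in> Fil n"
  shows "conv f g a = conv f' g' a"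
proof -
  note m = module
  note l = tensor_lift_linear[OF m m m conv_bilin[OF fs(1,2)]]
    tensor_lift_linear[OF m m m conv_bilin[OF fs(3,4)]]
  have c: "b \<in> carrier A" if "b \<in> Fil p" for b p
    using that fil_carrier by blast
  show ?thesis
    unfolding conv_def
  proof (rule lin_map_eq_on_span[OF l tensor_module_module[OF m m] m])
    show "\<Delta> a \<in> lin_span R (tensor_module R A A)
        {pure_tensor R A A a b | a b p q. p + q = n \<and> a \<in> Fil p \<and> b \<in> Fil q}" (is "_ \<in> lin_span R _ ?S")
      using fil_comult a by blast
    show "?S \<subseteq> carrier (tensor_module R A A)"
      by (auto intro!: pure_tensor_closed[OF m m] intro: c)
    fix s assume "s \<in> ?S"
    then obtain b c p q where s: "s = pure_tensor R A A b c" "p + q = n" "b \<in> Fil p" "c \<in> Fil q"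
      by blast
    then show "tensor_lift R A (\<lambda>b c. f b \<otimes>\<^bsub>A\<^esub> g c) s = tensor_lift R A (\<lambda>b c. f' b \<otimes>\<^bsub>A\<^esub> g' c) s"
      using eq[OF s(2-4)] c[OF s(3)] c[OF s(4)]
      by (simp add: tensor_lift_pure[OF m m m conv_bilin[OF fs(1,2)]]
          tensor_lift_pure[OF m m m conv_bilin[OF fs(3,4)]])
  qed
qed

definition unit_defect :: "'a \<Rightarrow> 'a" where
  "unit_defect a = conv_unit a \<oplus>\<^bsub>A\<^esub> \<ominus>\<^bsub>A\<^esub> a"

lemma unit_defect_linear: "unit_defect \<in> lin_map R A A"
  unfolding unit_defect_def
  by (intro lin_map_plus lin_map_inv conv_unit_linear module lin_map_id)

lemma conv_unit_decomp: "a \<in> carrier A \<Longrightarrow> conv_unit a = unit_defect a \<oplus>\<^bsub>A\<^esub> a"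
  using lin_map_closed[OF conv_unit_linear, of a] by (simp add: unit_defect_def M.a_assoc M.l_neg)

text \<open>By connectedness an element of \<open>Fil 0\<close> is some
  \<open>r \<odot> \<one>\<close>, and \<open>\<epsilon>\<close> returns \<open>r\<close>; so
  \<open>conv_unit\<close> and the identity agree there.\<close>

lemma unit_defect_fil_0: "a \<in> Fil 0 \<Longrightarrow> unit_defect a = \<zero>\<^bsub>A\<^esub>"
  using fil_connected counit_coaug by (auto simp: unit_defect_def conv_unit_def M.r_neg)

text \<open>A left factor from \<open>Fil 0\<close> contributes zero, so \<open>p > 0\<close> and
  the right factor lies in some \<open>Fil q\<close> with \<open>q < n\<close>. Convolving with
  \<open>unit_defect\<close> thus gains one step of the filtration, which drives the inductions
  below.\<close>

lemma conv_unit_defect_cong: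
  assumes g: "g \<in> lin_map R A A" "g' \<in> lin_map R A A"
    and eq: "\<And>q c. q < n \<Longrightarrow> c \<in> Fil q \<Longrightarrow> g c = g' c" and a: "a \<in> Fil n"
  shows "conv unit_defect g a = conv unit_defect g' a"
proof (rule conv_eq_on_fil[OF unit_defect_linear g(1) unit_defect_linear g(2) _ a])
  fix p q b c assume pq: "p + q = n" "b \<in> Fil p" "c \<in> Fil q"
  have c: "c \<in> carrier A" using pq fil_carrier by blast
  show "unit_defect b \<otimes>\<^bsub>A\<^esub> g c = unit_defect b \<otimes>\<^bsub>A\<^esub> g' c"
  proof (cases "p = 0")
    case True
    then show ?thesis
      using pq c by (simp add: unit_defect_fil_0 lin_map_closed[OF g(1)] lin_map_closed[OF g(2)])
  next
    case False
    then show ?thesis using eq[of q c] pq by simp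
  qed
qed

text \<open>The partial sums of the geometric series inverting the identity, which is the convolution
  unit minus \<open>unit_defect\<close>. On each step of the filtration they become stationary.\<close>

primrec inv_series :: "nat \<Rightarrow> 'a \<Rightarrow> 'a" where
  "inv_series 0 = conv_unit"
| "inv_series (Suc n) = (\<lambda>a. conv_unit a \<oplus>\<^bsub>A\<^esub> conv unit_defect (inv_series n) a)"

lemma inv_series_linear: "inv_series n \<in> lin_map R A A"
proof (induction n)
  case (Suc n)
  show ?case
    unfolding inv_series.simps
    by (intro lin_map_plus conv_linear unit_defect_linear conv_unit_linear Suc module)
qed (simp add: conv_unit_linear)

text \<open>Consecutive recursion steps differ only in the right factor of a convolution with
  \<open>unit_defect\<close>, and on \<open>Fil m\<close> only the steps below \<open>m\<close> of
  that factor matter. At the start the difference is \<open>unit_defect\<close> itself, zero on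
  \<open>Fil 0\<close>.\<close>

lemma inv_series_Suc_fil: "a \<in> Fil m \<Longrightarrow> m \<le> n \<Longrightarrow> inv_series (Suc n) a = inv_series n a"
proof (induction n arbitrary: m a)
  case 0
  then have "a \<in> Fil 0" by simp
  then show ?case
    using fil_carrier[of 0] lin_map_closed[OF conv_unit_linear]
    by (auto simp: conv_unit_right[OF unit_defect_linear] unit_defect_fil_0)
next
  case (Suc n)
  have "conv unit_defect (inv_series (Suc n)) a = conv unit_defect (inv_series n) a"
    by (rule conv_unit_defect_cong[OF inv_series_linear inv_series_linear Suc.IH Suc.prems(1)])
      (use Suc.prems(2) in auto)
  then show ?case by simp
qed

lemma inv_series_fil:
  assumes "a \<in> Fil m" "m \<le> n"
  shows "inv_series n a = inv_series m a"
  using assms(2) by (induction n rule: dec_induct) (simp_all add: inv_series_Suc_fil[OF assms(1)] del: inv_series.simps(2))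

text \<open>Write \<open>u\<close>, \<open>d\<close>, \<open>s n\<close> for
  \<open>conv_unit\<close>, \<open>unit_defect\<close>, \<open>inv_series n\<close>, and
  \<open>*\<close> for convolution. From \<open>s (n+1) = u + d * s n\<close> one gets
  \<open>s (n+1) * id = id + d * (s n * id) = id + d * u = id + d = u\<close>; the induction
  hypothesis is available only below \<open>m\<close>, which suffices under
  \<open>d\<close>.\<close>

lemma inv_series_left_inverse:
  "a \<in> Fil m \<Longrightarrow> m \<le> n \<Longrightarrow> conv (inv_series n) (\<lambda>x. x) a = conv_unit a"
proof (induction n arbitrary: m a)
  case 0
  then have a: "a \<in> Fil 0" by simp
  then have "a \<in> carrier A" using fil_carrier by blast
  then show ?case
    using a by (simp add: conv_unit_left conv_unit_decomp unit_defect_fil_0)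
next
  case (Suc n)
  have a: "a \<in> carrier A" using Suc.prems fil_carrier by blast
  note lin = conv_linear[OF unit_defect_linear inv_series_linear]
  have "conv (inv_series (Suc n)) (\<lambda>x. x) a
      = conv conv_unit (\<lambda>x. x) a \<oplus>\<^bsub>A\<^esub> conv (conv unit_defect (inv_series n)) (\<lambda>x. x) a"
    by (rule conv_add_left[OF conv_unit_linear lin lin_map_id _ a]) simp
  also have "conv (conv unit_defect (inv_series n)) (\<lambda>x. x) a
      = conv unit_defect (conv (inv_series n) (\<lambda>x. x)) a"
    by (rule conv_assoc[OF unit_defect_linear inv_series_linear lin_map_id a])
  also have "\<dots> = conv unit_defect conv_unit a"
    by (rule conv_unit_defect_cong[OF conv_linear[OF inv_series_linear lin_map_id] conv_unit_linear
          Suc.IH Suc.prems(1)]) (use Suc.prems(2) in auto)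
  finally show ?case
    using a by (simp add: conv_unit_left conv_unit_right[OF unit_defect_linear] conv_unit_decomp
        M.a_comm lin_map_closed[OF unit_defect_linear])
qed

text \<open>No second induction: with the same letters, \<open>u = d + id\<close> gives
  \<open>d * s n + id * s n = s n\<close>, while stationarity on \<open>Fil n\<close> gives
  \<open>s n = s (n+1) = u + d * s n\<close>. Cancelling \<open>d * s n\<close> leaves the
  claim.\<close>

lemma inv_series_right_inverse:
  assumes "a \<in> Fil n"
  shows "conv (\<lambda>x. x) (inv_series n) a = conv_unit a"
proof -
  have a: "a \<in> carrier A" using assms fil_carrier by blast
  note lin = inv_series_linear[of n]
  let ?c = "conv unit_defect (inv_series n) a" and ?i = "conv (\<lambda>x. x) (inv_series n) a"
  have c: "?c \<in> carrier A" "?i \<in> carrier A" "conv_unit a \<in> carrier A"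
    by (rule lin_map_closed[OF _ a], rule conv_linear[OF _ lin] conv_unit_linear,
        (rule unit_defect_linear lin_map_id)?)+
  have "?c \<oplus>\<^bsub>A\<^esub> ?i = conv conv_unit (inv_series n) a"
    by (rule conv_add_left[symmetric, OF unit_defect_linear lin_map_id lin conv_unit_decomp a])
  also have "\<dots> = inv_series (Suc n) a"
    using a assms by (simp add: conv_unit_left[OF lin] inv_series_Suc_fil del: inv_series.simps(2))
  also have "\<dots> = ?c \<oplus>\<^bsub>A\<^esub> conv_unit a"
    using c by (simp add: M.a_comm)
  finally show ?thesis using c by simp
qed

theorem hopf_algebra: "hopf_algebra R A \<Delta> \<epsilon>"
proof (unfold_locales, intro bexI ballI)
  \<comment> \<open>Exhaustiveness gives every element an index from which the series is stationary.
    Taking the least one makes \<open>S\<close> a function; by stationarity \<open>S\<close> agrees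
    with \<open>inv_series n\<close> on all of \<open>Fil n\<close>, whence its linearity.\<close>
  define S where "S = (\<lambda>a. inv_series (LEAST n. a \<in> Fil n) a)"
  have S: "S a = inv_series n a" if "a \<in> Fil n" for a n
    unfolding S_def by (rule inv_series_fil[symmetric, OF LeastI[of "\<lambda>n. a \<in> Fil n"] Least_le]; rule that)
  have ex: "\<exists>n. a \<in> Fil n" if "a \<in> carrier A" for a
    using that fil_exhaustive by blast
  show lin: "S \<in> lin_map R A A"
  proof (rule lin_mapI)
    fix a assume a: "a \<in> carrier A"
    then obtain n where n: "a \<in> Fil n" using ex by blast
    note l = inv_series_linear
    show "S a \<in> carrier A" using a by (simp add: S[OF n] lin_map_closed[OF l])
    { fix b assume b: "b \<in> carrier A"
      then obtain k where k: "b \<in> Fil k" using ex by blast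
      have ab: "a \<in> Fil (max n k)" "b \<in> Fil (max n k)"
        using n k fil_mono[of n "max n k"] fil_mono[of k "max n k"] by auto
      show "S (a \<oplus>\<^bsub>A\<^esub> b) = S a \<oplus>\<^bsub>A\<^esub> S b"
        using a b by (simp add: S[OF ab(1)] S[OF ab(2)] S[OF submodule_add[OF fil_submodule ab]]
            lin_map_add[OF l]) }
    fix r assume r: "r \<in> carrier R"
    show "S (r \<odot>\<^bsub>A\<^esub> a) = r \<odot>\<^bsub>A\<^esub> S a"
      using a r by (simp add: S[OF n] S[OF submodule_smult[OF fil_submodule r n]] lin_map_smult[OF l])
  qed
  fix a assume "a \<in> carrier A"
  then obtain n where n: "a \<in> Fil n" using ex by blast
  \<comment> \<open>If \<open>p + q = n\<close>, both factors lie in steps not above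
    \<open>n\<close>, so inside a convolution on \<open>Fil n\<close> the map \<open>S\<close> may
    be replaced by the single partial sum \<open>inv_series n\<close>.\<close>
  have S': "S b = inv_series n b" if "b \<in> Fil p" "p \<le> n" for b p
    using S fil_mono[OF that(2)] that(1) by blast
  have "conv S (\<lambda>x. x) a = conv (inv_series n) (\<lambda>x. x) a"
    by (rule conv_eq_on_fil[OF lin lin_map_id inv_series_linear lin_map_id _ n]) (simp add: S')
  moreover have "conv (\<lambda>x. x) S a = conv (\<lambda>x. x) (inv_series n) a"
    by (rule conv_eq_on_fil[OF lin_map_id lin lin_map_id inv_series_linear _ n]) (simp add: S')
  ultimately show "tensor_lift R A (\<lambda>b c. S b \<otimes>\<^bsub>A\<^esub> c) (\<Delta> a) = \<epsilon> a \<odot>\<^bsub>A\<^esub> \<one>\<^bsub>A\<^esub> \<and>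
      tensor_lift R A (\<lambda>b c. b \<otimes>\<^bsub>A\<^esub> S c) (\<Delta> a) = \<epsilon> a \<odot>\<^bsub>A\<^esub> \<one>\<^bsub>A\<^esub>"
    using inv_series_left_inverse[OF n] inv_series_right_inverse[OF n]
    by (simp add: conv_def conv_unit_def)
qed

end

section \<open>The algebra of decorated forests\<close>

lemma tensor_map_tensor_algebra [simp]:
  "tensor_map R (tensor_algebra R A B) N = tensor_map R (tensor_module R A B) N"
  "tensor_map R N (tensor_algebra R A B) = tensor_map R N (tensor_module R A B)"
  by (simp_all add: tensor_map_def fun_eq_iff)

lemma ground_assoc_algebra:
  assumes "cring R"
  shows "assoc_algebra R (ground R)"
proof -
  interpret cring R by fact
  show ?thesis
    by (intro assoc_algebraI ground_module assms bilinI lin_mapI)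
      (auto simp: l_distr r_distr m_assoc m_lcomm)
qed

text \<open>The counterpart of \<open>tensor_lift_param\<close> for free modules, needed because the
  forest product nests two linear extensions.\<close>

lemma lin_ext_param:
  assumes N: "module R N" and L: "module R L"
    and lin: "\<And>s. s \<in> S \<Longrightarrow> (\<lambda>x. g x s) \<in> lin_map R L N"
    and u: "u \<in> carrier (free_module R S)"
  shows "(\<lambda>x. lin_ext R N (g x) u) \<in> lin_map R L N"
proof -
  interpret L: module R L by fact
  note g = lin_map_closed[OF lin]
  have l: "lin_ext R N (g x) \<in> lin_map R (free_module R S) N" if "x \<in> carrier L" for x
    by (rule lin_ext_linear[OF N]) (use g that in auto)
  have b: "lin_ext R N (g x) (basis_vec R s) = g x s" if "x \<in> carrier L" "s \<in> S" for x s
    by (rule lin_ext_basis[of R N "g x"]) (use N g that in auto)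
  show ?thesis
  proof (rule lin_mapI)
    fix x assume x: "x \<in> carrier L"
    show "lin_ext R N (g x) u \<in> carrier N"
      by (rule lin_map_closed[OF l[OF x] u])
    { fix y assume y: "y \<in> carrier L"
      show "lin_ext R N (g (x \<oplus>\<^bsub>L\<^esub> y)) u = lin_ext R N (g x) u \<oplus>\<^bsub>N\<^esub> lin_ext R N (g y) u"
        by (rule free_module_map_eqI[OF l lin_map_plus[OF N l[OF x] l[OF y]] N _ u])
          (use x y in \<open>simp_all add: b lin_map_add[OF lin]\<close>) }
    fix r assume r: "r \<in> carrier R"
    show "lin_ext R N (g (r \<odot>\<^bsub>L\<^esub> x)) u = r \<odot>\<^bsub>N\<^esub> lin_ext R N (g x) u"
      by (rule free_module_map_eqI[OF l lin_map_scale[OF N l[OF x] r] N _ u])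
        (use x r in \<open>simp_all add: b lin_map_smult[OF lin]\<close>)
  qed
qed

section \<open>Induction on forests\<close>

lemma dtrees_simps [simp]:
  "Leaf x \<in> dtrees X \<Omega> \<longleftrightarrow> x \<in> X"
  "Node \<omega> F \<in> dtrees X \<Omega> \<longleftrightarrow> \<omega> \<in> \<Omega> \<and> F \<in> forests X \<Omega>"
  by (auto simp: dtrees_def forests_def in_lists_conv_set)

lemma forests_simps [simp]:
  "[] \<in> forests X \<Omega>"
  "T # F \<in> forests X \<Omega> \<longleftrightarrow> T \<in> dtrees X \<Omega> \<and> F \<in> forests X \<Omega>"
  "F @ G \<in> forests X \<Omega> \<longleftrightarrow> F \<in> forests X \<Omega> \<and> G \<in> forests X \<Omega>"
  by (auto simp: forests_def)

lemma forest_verts_simps [simp]: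
  "forest_verts [] = 0"
  "forest_verts (T # F) = tree_verts T + forest_verts F"
  "tree_verts (Node \<omega> F) = Suc (forest_verts F)"
  by (simp_all add: forest_verts_def)

declare tree_verts.simps(2) [simp del]

text \<open>Induction on the number of vertices: both \<open>F\<close> and \<open>G\<close> have
  fewer vertices than \<open>Node \<omega> F # G\<close>. A single predicate on forests thus
  replaces the mutual induction over trees and lists of trees.\<close>

lemma forest_induct [consumes 1, case_names Nil Leaf Node]:
  assumes "F \<in> forests X \<Omega>"
    and "P []"
    and "\<And>x F. x \<in> X \<Longrightarrow> F \<in> forests X \<Omega> \<Longrightarrow> P F \<Longrightarrow> P (Leaf x # F)"
    and "\<And>\<omega> F G. \<omega> \<in> \<Omega> \<Longrightarrow> F \<in> forests X \<Omega> \<Longrightarrow> G \<in> forests X \<Omega> \<Longrightarrow> P F \<Longrightarrow> P G \<Longrightarrow>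
      P (Node \<omega> F # G)"
  shows "P F"
  using assms(1)
proof (induction "forest_verts F" arbitrary: F rule: less_induct)
  case less
  show ?case
  proof (cases F)
    case Nil
    then show ?thesis using assms(2) by simp
  next
    case (Cons T G)
    then show ?thesis
      using less by (cases T) (auto intro!: assms(3,4))
  qed
qed

lemma H_RT_simps [simp]:
  "carrier (H_RT R X \<Omega>) = carrier (free_module R (forests X \<Omega>))"
  "add (H_RT R X \<Omega>) = add (free_module R (forests X \<Omega>))"
  "zero (H_RT R X \<Omega>) = zero (free_module R (forests X \<Omega>))"
  "smult (H_RT R X \<Omega>) = smult (free_module R (forests X \<Omega>))"
  "one (H_RT R X \<Omega>) = basis_vec R []"
  by (simp_all add: H_RT_def Let_def)

section \<open>The free module on forests as an associative algebra\<close>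

locale forest_algebra =
  fixes R :: "'k ring" and X :: "'x set" and \<Omega> :: "'w set"
  assumes R: "cring R"
begin

abbreviation "M \<equiv> free_module R (forests X \<Omega>)"
abbreviation "H \<equiv> H_RT R X \<Omega>"
abbreviation "bv \<equiv> basis_vec R :: ('x, 'w) dtree list \<Rightarrow> _"
abbreviation "B \<equiv> B_RT R X \<Omega>"

sublocale R: cring R by (rule R)

lemma H_lin_map: "lin_map R H N = lin_map R M N" "lin_map R N H = lin_map R N M"
  by (rule lin_map_mult_update, simp_all)+

lemma H_lin_ext: "lin_ext R H = lin_ext R M"
  by (rule lin_ext_mult_update) simp_all

lemma H_module: "module R H"
  using free_module_module[OF R, of "forests X \<Omega>"] by (subst module_mult_update[of _ M]) simp_all

lemma bv_closed: "F \<in> forests X \<Omega> \<Longrightarrow> bv F \<in> carrier H"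
  using basis_vec_closed[OF R] by simp

lemma H_eqI:
  assumes "f \<in> lin_map R H N" "g \<in> lin_map R H N" "module R N"
    and "\<And>F. F \<in> forests X \<Omega> \<Longrightarrow> f (bv F) = g (bv F)" "u \<in> carrier H"
  shows "f u = g u"
  using free_module_map_eqI[of f R "forests X \<Omega>" N g u] assms by (simp add: H_lin_map)

lemma H_lin_ext_linear:
  "module R N \<Longrightarrow> (\<And>F. F \<in> forests X \<Omega> \<Longrightarrow> g F \<in> carrier N) \<Longrightarrow> lin_ext R N g \<in> lin_map R H N"
  unfolding H_lin_map by (rule lin_ext_linear) auto

lemma H_mult_def: "u \<otimes>\<^bsub>H\<^esub> v = lin_ext R H (\<lambda>F. lin_ext R H (\<lambda>G. bv (F @ G)) v) u"
  unfolding H_lin_ext by (simp add: H_RT_def Let_def)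

lemma H_mult_bilin: "(\<lambda>u v. u \<otimes>\<^bsub>H\<^esub> v) \<in> bilin R H H H"
  unfolding H_mult_def
proof (rule bilinI)
  have l: "lin_ext R H (\<lambda>G. bv (F @ G)) \<in> lin_map R H H" if "F \<in> forests X \<Omega>" for F
    by (rule H_lin_ext_linear[OF H_module]) (use that bv_closed in simp)
  show "(\<lambda>v. lin_ext R H (\<lambda>F. lin_ext R H (\<lambda>G. bv (F @ G)) v) u) \<in> lin_map R H H" if "u \<in> carrier H" for u
    by (rule lin_ext_param[OF H_module H_module l]) (use that in simp_all)
  show "lin_ext R H (\<lambda>F. lin_ext R H (\<lambda>G. bv (F @ G)) v) \<in> lin_map R H H" if "v \<in> carrier H" for v
    by (rule H_lin_ext_linear[OF H_module lin_map_closed[OF l that]])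
qed

lemma bv_mult:
  assumes "F \<in> forests X \<Omega>" "G \<in> forests X \<Omega>"
  shows "bv F \<otimes>\<^bsub>H\<^esub> bv G = bv (F @ G)"
proof -
  have 1: "lin_ext R H (\<lambda>G. bv (F @ G)) (bv G) = bv (F @ G)"
    by (rule lin_ext_basis[OF H_module]) (use assms bv_closed in simp)
  have "bv F \<otimes>\<^bsub>H\<^esub> bv G = lin_ext R H (\<lambda>G. bv (F @ G)) (bv G)"
    unfolding H_mult_def
    by (rule lin_ext_basis[OF H_module]) (use 1 assms bv_closed in simp)
  with 1 show ?thesis by simp
qed

lemma H_assoc_algebra: "assoc_algebra R H"
proof (rule assoc_algebraI[OF H_module H_mult_bilin])
  note m = H_mult_bilin
  show "\<one>\<^bsub>H\<^esub> \<in> carrier H" using bv_closed[of "[]"] by simp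
  fix x assume x: "x \<in> carrier H"
  have one: "\<one>\<^bsub>H\<^esub> = bv []" by simp
  show "\<one>\<^bsub>H\<^esub> \<otimes>\<^bsub>H\<^esub> x = x"
    unfolding one
    by (rule H_eqI[OF bilin_right[OF m] lin_map_id H_module _ x]) (simp_all only: bv_mult bv_closed forests_simps append.simps)
  show "x \<otimes>\<^bsub>H\<^esub> \<one>\<^bsub>H\<^esub> = x"
    unfolding one
    by (rule H_eqI[OF bilin_left[OF m] lin_map_id H_module _ x]) (simp_all only: bv_mult bv_closed forests_simps append_Nil2)
  fix y z assume y: "y \<in> carrier H" and z: "z \<in> carrier H"
  note lr = bilin_left[OF m] bilin_right[OF m] and c = bilin_closed[OF m]
  \<comment> \<open>On forests associativity is that of list append; it is extended by linearity in
    \<open>z\<close>, then in \<open>y\<close>, then in \<open>x\<close>.\<close>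
  have 1: "(bv F \<otimes>\<^bsub>H\<^esub> bv G) \<otimes>\<^bsub>H\<^esub> z = bv F \<otimes>\<^bsub>H\<^esub> (bv G \<otimes>\<^bsub>H\<^esub> z)"
    if FG: "F \<in> forests X \<Omega>" "G \<in> forests X \<Omega>" for F G
    by (rule H_eqI[OF lr(2) lin_map_comp[OF lr(2) lr(2)] H_module _ z])
      (simp_all only: FG c bv_mult bv_closed forests_simps append_assoc simp_thms)
  have 2: "(bv F \<otimes>\<^bsub>H\<^esub> y) \<otimes>\<^bsub>H\<^esub> z = bv F \<otimes>\<^bsub>H\<^esub> (y \<otimes>\<^bsub>H\<^esub> z)" if F: "F \<in> forests X \<Omega>" for F
    by (rule H_eqI[OF lin_map_comp[OF lr(2) lr(1)] lin_map_comp[OF lr(1) lr(2)] H_module _ y])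
      (simp_all only: F z c 1 bv_closed)
  show "(x \<otimes>\<^bsub>H\<^esub> y) \<otimes>\<^bsub>H\<^esub> z = x \<otimes>\<^bsub>H\<^esub> (y \<otimes>\<^bsub>H\<^esub> z)"
    by (rule H_eqI[OF lin_map_comp[OF lr(1) lr(1)] lr(1) H_module _ x])
      (simp_all only: y z c 2)
qed

sublocale H: assoc_algebra R H by (rule H_assoc_algebra)

lemma H_one: "\<one>\<^bsub>H\<^esub> = bv []" by simp

lemma B_linear: "\<omega> \<in> \<Omega> \<Longrightarrow> B \<omega> \<in> lin_map R H H"
  unfolding B_RT_def by (rule H_lin_ext_linear[OF H_module]) (use bv_closed in simp)

lemma B_bv: "\<omega> \<in> \<Omega> \<Longrightarrow> F \<in> forests X \<Omega> \<Longrightarrow> B \<omega> (bv F) = bv [Node \<omega> F]"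
  unfolding B_RT_def by (rule lin_ext_basis[OF H_module]) (use bv_closed in simp)

lemma j_closed: "x \<in> X \<Longrightarrow> j_RT R x \<in> carrier H"
  unfolding j_RT_def by (rule bv_closed) simp

lemma bv_Leaf: "x \<in> X \<Longrightarrow> F \<in> forests X \<Omega> \<Longrightarrow> bv (Leaf x # F) = j_RT R x \<otimes>\<^bsub>H\<^esub> bv F"
  unfolding j_RT_def by (subst bv_mult) simp_all

lemma bv_Node: "\<omega> \<in> \<Omega> \<Longrightarrow> F \<in> forests X \<Omega> \<Longrightarrow> G \<in> forests X \<Omega> \<Longrightarrow>
    bv (Node \<omega> F # G) = B \<omega> (bv F) \<otimes>\<^bsub>H\<^esub> bv G"
  by (simp add: B_bv bv_mult del: H_RT_simps)

text \<open>The grafting hypothesis concerns an arbitrary \<open>a\<close>, not only forests, so it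
  can be discharged directly by identities of linear maps such as the cocycle condition. The
  induction itself calls it on forests.\<close>

lemma alg_hom_eqI:
  assumes A: "assoc_algebra R A" and f: "f \<in> alg_hom R H A" and g: "g \<in> alg_hom R H A"
    and leaf: "\<And>x. x \<in> X \<Longrightarrow> f (j_RT R x) = g (j_RT R x)"
    and graft: "\<And>\<omega> a. \<omega> \<in> \<Omega> \<Longrightarrow> a \<in> carrier H \<Longrightarrow> f a = g a \<Longrightarrow> f (B \<omega> a) = g (B \<omega> a)"
    and a: "a \<in> carrier H"
  shows "f a = g a"
proof (rule H_eqI[OF alg_hom_lin[OF f] alg_hom_lin[OF g] assoc_algebra_module[OF A] _ a])
  fix F assume "F \<in> forests X \<Omega>"
  then show "f (bv F) = g (bv F)"
  proof (induction rule: forest_induct)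
    case Nil
    then show ?case using alg_hom_one[OF f] alg_hom_one[OF g] by simp
  next
    case (Leaf x F)
    note c = j_closed[OF Leaf(1)] bv_closed[OF Leaf(2)]
    show ?case
      unfolding bv_Leaf[OF Leaf(1,2)] alg_hom_mult[OF f c] alg_hom_mult[OF g c]
      using Leaf leaf by simp
  next
    case (Node \<omega> F G)
    note c = lin_map_closed[OF B_linear[OF Node(1)] bv_closed[OF Node(2)]] bv_closed[OF Node(3)]
    show ?case
      unfolding bv_Node[OF Node(1-3)] alg_hom_mult[OF f c] alg_hom_mult[OF g c]
      using Node graft[OF Node(1) bv_closed[OF Node(2)]] by simp
  qed
qed

text \<open>Freeness of the monoid of forests: prescribed values on trees extend multiplicatively
  without any relation to check. Stated with \<open>\<tau>\<close> and \<open>\<phi>\<close> apart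
  because in each application they come from a mutual recursion: coproduct, counit and universal
  map.\<close>

lemma lin_ext_alg_hom:
  assumes A: "assoc_algebra R A"
    and closed: "\<And>T. T \<in> dtrees X \<Omega> \<Longrightarrow> \<tau> T \<in> carrier A"
    and Nil: "\<phi> [] = \<one>\<^bsub>A\<^esub>"
    and Cons: "\<And>T F. T \<in> dtrees X \<Omega> \<Longrightarrow> F \<in> forests X \<Omega> \<Longrightarrow> \<phi> (T # F) = \<tau> T \<otimes>\<^bsub>A\<^esub> \<phi> F"
  shows "lin_ext R A \<phi> \<in> alg_hom R H A"
    and "F \<in> forests X \<Omega> \<Longrightarrow> \<phi> F \<in> carrier A"
    and "F \<in> forests X \<Omega> \<Longrightarrow> lin_ext R A \<phi> (bv F) = \<phi> F"
proof -
  interpret A: assoc_algebra R A by fact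
  have \<phi>: "\<phi> F \<in> carrier A" if "F \<in> forests X \<Omega>" for F
    using that by (induction F) (simp_all add: Nil Cons closed)
  then show "F \<in> forests X \<Omega> \<Longrightarrow> \<phi> F \<in> carrier A" .
  have append: "\<phi> (F @ G) = \<phi> F \<otimes>\<^bsub>A\<^esub> \<phi> G" if "F \<in> forests X \<Omega>" "G \<in> forests X \<Omega>" for F G
    using that by (induction F) (simp_all add: Nil Cons closed \<phi> A.m_assoc)
  have ext: "lin_ext R A \<phi> (bv F) = \<phi> F" if "F \<in> forests X \<Omega>" for F
    by (rule lin_ext_basis[of R A \<phi>]) (use that \<phi> A.module_axioms in auto)
  then show "F \<in> forests X \<Omega> \<Longrightarrow> lin_ext R A \<phi> (bv F) = \<phi> F" .
  have lin: "lin_ext R A \<phi> \<in> lin_map R H A"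
    by (rule H_lin_ext_linear[OF A.module_axioms \<phi>])
  show "lin_ext R A \<phi> \<in> alg_hom R H A"
  proof (rule alg_homI[OF lin])
    fix x y assume xy: "x \<in> carrier H" "y \<in> carrier H"
    have span: "lin_span R H S = lin_span R M S" for S
      by (simp add: lin_span_def submodule_def submodule_axioms_def)
    show "lin_ext R A \<phi> (x \<otimes>\<^bsub>H\<^esub> y) = lin_ext R A \<phi> x \<otimes>\<^bsub>A\<^esub> lin_ext R A \<phi> y"
    proof (rule multiplicative_on_span[OF H_assoc_algebra A lin _ _ _ xy])
      show "bv ` forests X \<Omega> \<subseteq> carrier H" using bv_closed by blast
      show "carrier H \<subseteq> lin_span R H (bv ` forests X \<Omega>)"
        by (simp add: span free_module_span[OF R])
    qed (auto simp: bv_mult ext append simp del: H_RT_simps)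
  qed (use ext[of "[]"] Nil in simp)
qed

end

section \<open>The bialgebra of decorated forests\<close>

locale forest_bialgebra = forest_algebra R X \<Omega>
  for R :: "'k ring" and X :: "'x set" and \<Omega> :: "'w set" +
  fixes \<mu> :: "'x \<Rightarrow> 'k" and lam :: "'w \<Rightarrow> 'k"
  assumes \<mu>: "\<mu> \<in> X \<rightarrow> carrier R" and lam: "lam \<in> \<Omega> \<rightarrow> carrier R"
begin

abbreviation "T \<equiv> tensor_module R H H"
abbreviation "HH \<equiv> tensor_algebra R H H"
abbreviation tens (infixl "\<diamondop>" 72) where "tens \<equiv> pure_tensor R H H"
abbreviation "\<Delta> \<equiv> Delta_RT R X \<Omega> \<mu> lam"
abbreviation "\<epsilon> \<equiv> eps_RT R \<mu> lam :: (('x, 'w) dtree list \<Rightarrow> 'k) \<Rightarrow> 'k"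

lemma T_module: "module R T"
  by (rule tensor_module_module[OF H_module H_module])

lemma HH: "assoc_algebra R HH"
  by (rule assoc_algebra_tensor[OF H_assoc_algebra H_assoc_algebra])

sublocale T: module R T by (rule T_module)
sublocale HH: assoc_algebra R HH by (rule HH)

lemma \<mu>_closed: "x \<in> X \<Longrightarrow> \<mu> x \<in> carrier R" and lam_closed: "\<omega> \<in> \<Omega> \<Longrightarrow> lam \<omega> \<in> carrier R"
  using \<mu> lam by auto

lemma tens_closed: "a \<in> carrier H \<Longrightarrow> b \<in> carrier H \<Longrightarrow> a \<diamondop> b \<in> carrier T"
  by (rule pure_tensor_closed[OF H_module H_module])

lemmas tens_bilin = pure_tensor_bilin[OF H_module H_module]

lemma B_closed: "\<omega> \<in> \<Omega> \<Longrightarrow> a \<in> carrier H \<Longrightarrow> B \<omega> a \<in> carrier H"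
  by (rule lin_map_closed[OF B_linear])

abbreviation "idB \<omega> \<equiv> tensor_map R H H (\<lambda>x. x) (B \<omega>)"

lemma idB_linear: "\<omega> \<in> \<Omega> \<Longrightarrow> idB \<omega> \<in> lin_map R T T"
  by (rule tensor_map_linear[OF H_module H_module H_module H_module lin_map_id B_linear])

section \<open>The coproduct\<close>

lemma comult_tree_Leaf:
  "comult_tree R X \<Omega> \<mu> lam (Leaf x) =
    j_RT R x \<diamondop> \<one>\<^bsub>H\<^esub> \<oplus>\<^bsub>T\<^esub> \<one>\<^bsub>H\<^esub> \<diamondop> j_RT R x \<oplus>\<^bsub>T\<^esub> \<mu> x \<odot>\<^bsub>T\<^esub> (\<one>\<^bsub>H\<^esub> \<diamondop> \<one>\<^bsub>H\<^esub>)"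
  unfolding comult_tree.simps Let_def tensor_algebra_simps ..

lemma comult_tree_Node:
  "comult_tree R X \<Omega> \<mu> lam (Node \<omega> F) =
    bv [Node \<omega> F] \<diamondop> \<one>\<^bsub>H\<^esub> \<oplus>\<^bsub>T\<^esub> idB \<omega> (comult_forest R X \<Omega> \<mu> lam F) \<oplus>\<^bsub>T\<^esub> lam \<omega> \<odot>\<^bsub>T\<^esub> (bv F \<diamondop> \<one>\<^bsub>H\<^esub>)"
  unfolding comult_tree.simps Let_def tensor_algebra_simps ..

lemma comult_tree_Leaf_closed:
  assumes "x \<in> X"
  shows "comult_tree R X \<Omega> \<mu> lam (Leaf x) \<in> carrier T"
  unfolding comult_tree_Leaf
  by (intro T.a_closed T.smult_closed tens_closed j_closed \<mu>_closed H.one_closed assms)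

lemma comult_tree_Node_closed:
  assumes "\<omega> \<in> \<Omega>" "F \<in> forests X \<Omega>" "comult_forest R X \<Omega> \<mu> lam F \<in> carrier T"
  shows "comult_tree R X \<Omega> \<mu> lam (Node \<omega> F) \<in> carrier T"
  unfolding comult_tree_Node
  by (intro T.a_closed T.smult_closed tens_closed bv_closed lam_closed H.one_closed
      lin_map_closed[OF idB_linear] assms) (simp add: assms)

lemma comult_forest_closed: "F \<in> forests X \<Omega> \<Longrightarrow> comult_forest R X \<Omega> \<mu> lam F \<in> carrier T"
proof (induction rule: forest_induct)
  case Nil
  then show ?case unfolding comult_forest.simps by (intro tens_closed H.one_closed)
next
  case (Leaf x F)
  then show ?case
    using HH.m_closed[OF _ _] comult_tree_Leaf_closed[OF Leaf(1)]
    unfolding comult_forest.simps tensor_algebra_simps by blast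
next
  case (Node \<omega> F G)
  then show ?case
    using HH.m_closed[OF _ _] comult_tree_Node_closed[OF Node(1,2)]
    unfolding comult_forest.simps tensor_algebra_simps by blast
qed

lemma comult_tree_closed: "t \<in> dtrees X \<Omega> \<Longrightarrow> comult_tree R X \<Omega> \<mu> lam t \<in> carrier T"
  using comult_tree_Leaf_closed comult_tree_Node_closed comult_forest_closed by (cases t) auto

lemma comult_ext:
  "\<Delta> \<in> alg_hom R H HH"
  "F \<in> forests X \<Omega> \<Longrightarrow> \<Delta> (bv F) = comult_forest R X \<Omega> \<mu> lam F"
proof -
  \<comment> \<open>\<open>Delta_RT\<close> is an extension into the bare module \<open>T\<close>;
    the product needed for multiplicativity is a field of \<open>HH\<close>, which
    \<open>lin_ext\<close> does not read.\<close>
  have "\<Delta> = lin_ext R HH (comult_forest R X \<Omega> \<mu> lam)"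
    unfolding Delta_RT_def by (subst lin_ext_mult_update[of HH T]) simp_all
  moreover note lin_ext_alg_hom[OF HH, of "comult_tree R X \<Omega> \<mu> lam" "comult_forest R X \<Omega> \<mu> lam"]
  ultimately show "\<Delta> \<in> alg_hom R H HH"
    "F \<in> forests X \<Omega> \<Longrightarrow> \<Delta> (bv F) = comult_forest R X \<Omega> \<mu> lam F"
    by (simp_all add: comult_tree_closed del: H_RT_simps comult_tree.simps)
qed

lemmas comult_alg_hom = comult_ext(1)
lemmas comult_bv = comult_ext(2)

lemma comult_linear: "\<Delta> \<in> lin_map R H T"
  using alg_hom_lin[OF comult_alg_hom] by simp

lemma comult_closed: "a \<in> carrier H \<Longrightarrow> \<Delta> a \<in> carrier T"
  by (rule lin_map_closed[OF comult_linear])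

lemma comult_one: "\<Delta> \<one>\<^bsub>H\<^esub> = \<one>\<^bsub>H\<^esub> \<diamondop> \<one>\<^bsub>H\<^esub>"
  using alg_hom_one[OF comult_alg_hom] by (simp del: H_RT_simps)

lemma comult_single: "t \<in> dtrees X \<Omega> \<Longrightarrow> \<Delta> (bv [t]) = comult_tree R X \<Omega> \<mu> lam t"
proof -
  assume t: "t \<in> dtrees X \<Omega>"
  then have "\<Delta> (bv [t]) = comult_tree R X \<Omega> \<mu> lam t \<otimes>\<^bsub>HH\<^esub> \<one>\<^bsub>HH\<^esub>"
    by (subst comult_bv) simp_all
  also have "\<dots> = comult_tree R X \<Omega> \<mu> lam t"
    by (rule HH.r_one) (use comult_tree_closed[OF t] in simp)
  finally show ?thesis .
qed

lemma comult_j: "x \<in> X \<Longrightarrow> \<Delta> (j_RT R x) =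
    j_RT R x \<diamondop> \<one>\<^bsub>H\<^esub> \<oplus>\<^bsub>T\<^esub> \<one>\<^bsub>H\<^esub> \<diamondop> j_RT R x \<oplus>\<^bsub>T\<^esub> \<mu> x \<odot>\<^bsub>T\<^esub> (\<one>\<^bsub>H\<^esub> \<diamondop> \<one>\<^bsub>H\<^esub>)"
  unfolding comult_tree_Leaf[symmetric] by (subst j_RT_def, rule comult_single) simp

text \<open>On a forest this is the recursion clause for \<open>Node\<close> with two summands
  exchanged; both sides are linear in \<open>a\<close>.\<close>

lemma comult_B:
  assumes \<omega>: "\<omega> \<in> \<Omega>" and a: "a \<in> carrier H"
  shows "\<Delta> (B \<omega> a) = B \<omega> a \<diamondop> \<one>\<^bsub>H\<^esub> \<oplus>\<^bsub>T\<^esub> lam \<omega> \<odot>\<^bsub>T\<^esub> (a \<diamondop> \<one>\<^bsub>H\<^esub>) \<oplus>\<^bsub>T\<^esub> idB \<omega> (\<Delta> a)"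
proof (rule H_eqI[OF lin_map_comp[OF B_linear[OF \<omega>] comult_linear] _ T_module _ a])
  note t1 = bilin_left[OF tens_bilin H.one_closed]
  show "(\<lambda>a. B \<omega> a \<diamondop> \<one>\<^bsub>H\<^esub> \<oplus>\<^bsub>T\<^esub> lam \<omega> \<odot>\<^bsub>T\<^esub> (a \<diamondop> \<one>\<^bsub>H\<^esub>) \<oplus>\<^bsub>T\<^esub> idB \<omega> (\<Delta> a)) \<in> lin_map R H T"
    by (intro lin_map_plus[OF T_module] lin_map_scale[OF T_module] lam_closed[OF \<omega>] t1
        lin_map_comp[OF B_linear[OF \<omega>] t1] lin_map_comp[OF comult_linear idB_linear[OF \<omega>]])
  fix F assume F: "F \<in> forests X \<Omega>"
  have "\<Delta> (B \<omega> (bv F)) = comult_tree R X \<Omega> \<mu> lam (Node \<omega> F)"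
    unfolding B_bv[OF \<omega> F] by (rule comult_single) (simp add: \<omega> F)
  also have "\<dots> = B \<omega> (bv F) \<diamondop> \<one>\<^bsub>H\<^esub> \<oplus>\<^bsub>T\<^esub> idB \<omega> (\<Delta> (bv F)) \<oplus>\<^bsub>T\<^esub> lam \<omega> \<odot>\<^bsub>T\<^esub> (bv F \<diamondop> \<one>\<^bsub>H\<^esub>)"
    unfolding comult_tree_Node comult_bv[OF F] B_bv[OF \<omega> F] ..
  also have "\<dots> = B \<omega> (bv F) \<diamondop> \<one>\<^bsub>H\<^esub> \<oplus>\<^bsub>T\<^esub> lam \<omega> \<odot>\<^bsub>T\<^esub> (bv F \<diamondop> \<one>\<^bsub>H\<^esub>) \<oplus>\<^bsub>T\<^esub> idB \<omega> (\<Delta> (bv F))"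
    using F \<omega> by (simp add: T.M.a_ac tens_closed bv_closed B_closed lam_closed H.one_closed
        lin_map_closed[OF idB_linear] comult_closed del: H_RT_simps)
  finally show "\<Delta> (B \<omega> (bv F)) = B \<omega> (bv F) \<diamondop> \<one>\<^bsub>H\<^esub> \<oplus>\<^bsub>T\<^esub> lam \<omega> \<odot>\<^bsub>T\<^esub> (bv F \<diamondop> \<one>\<^bsub>H\<^esub>)
      \<oplus>\<^bsub>T\<^esub> idB \<omega> (\<Delta> (bv F))" .
qed

section \<open>The counit\<close>

lemma ground_a_inv: "\<ominus>\<^bsub>ground R\<^esub> r = \<ominus>\<^bsub>R\<^esub> r"
  by (simp add: a_inv_def m_inv_def)

lemma ground: "assoc_algebra R (ground R)"
  by (rule ground_assoc_algebra[OF R])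

lemma counit_forest_closed: "F \<in> forests X \<Omega> \<Longrightarrow> counit_forest R \<mu> lam F \<in> carrier R"
  by (induction rule: forest_induct) (simp_all add: \<mu>_closed lam_closed)

lemma counit_tree_closed: "t \<in> dtrees X \<Omega> \<Longrightarrow> counit_tree R \<mu> lam t \<in> carrier R"
  using counit_forest_closed by (cases t) (auto simp: \<mu>_closed lam_closed)

lemma counit_ext:
  "\<epsilon> \<in> alg_hom R H (ground R)"
  "F \<in> forests X \<Omega> \<Longrightarrow> \<epsilon> (bv F) = counit_forest R \<mu> lam F"
  unfolding eps_RT_def
  using lin_ext_alg_hom[OF ground, of "counit_tree R \<mu> lam" "counit_forest R \<mu> lam"]
  by (simp_all add: counit_tree_closed)

lemma counit_linear: "\<epsilon> \<in> lin_map R H (ground R)"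
  by (rule alg_hom_lin[OF counit_ext(1)])

lemma counit_carrier: "a \<in> carrier H \<Longrightarrow> \<epsilon> a \<in> carrier R"
  using lin_map_closed[OF counit_linear] by simp

lemma counit_one: "\<epsilon> \<one>\<^bsub>H\<^esub> = \<one>\<^bsub>R\<^esub>"
  using alg_hom_one[OF counit_ext(1)] by simp

lemma counit_j: "x \<in> X \<Longrightarrow> \<epsilon> (j_RT R x) = \<ominus>\<^bsub>R\<^esub> \<mu> x"
  unfolding j_RT_def by (subst counit_ext(2)) (simp_all add: \<mu>_closed)

lemma counit_B:
  assumes \<omega>: "\<omega> \<in> \<Omega>" and a: "a \<in> carrier H"
  shows "\<epsilon> (B \<omega> a) = \<ominus>\<^bsub>R\<^esub> (lam \<omega> \<otimes>\<^bsub>R\<^esub> \<epsilon> a)"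
proof -
  have "\<epsilon> (B \<omega> a) = \<ominus>\<^bsub>ground R\<^esub> (lam \<omega> \<odot>\<^bsub>ground R\<^esub> \<epsilon> a)"
  proof (rule H_eqI[OF lin_map_comp[OF B_linear[OF \<omega>] counit_linear] _ ground_module[OF R] _ a])
    show "(\<lambda>a. \<ominus>\<^bsub>ground R\<^esub> (lam \<omega> \<odot>\<^bsub>ground R\<^esub> \<epsilon> a)) \<in> lin_map R H (ground R)"
      by (intro lin_map_inv lin_map_scale ground_module[OF R] counit_linear lam_closed[OF \<omega>])
    fix F assume F: "F \<in> forests X \<Omega>"
    show "\<epsilon> (B \<omega> (bv F)) = \<ominus>\<^bsub>ground R\<^esub> (lam \<omega> \<odot>\<^bsub>ground R\<^esub> \<epsilon> (bv F))"
      using \<omega> F counit_forest_closed[OF F]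
      by (simp add: B_bv counit_ext lam_closed ground_a_inv del: H_RT_simps)
  qed
  then show ?thesis by (simp add: ground_a_inv)
qed

text \<open>Write \<open>D1\<close>, \<open>D2\<close> for the coproduct applied to the first and
  second factor. For \<open>B \<omega> b\<close> both sides reduce to
  \<open>\<kappa> (\<Delta> (B \<omega> b))\<close> plus \<open>lam \<omega>\<close> times
  \<open>\<kappa> (\<Delta> b)\<close> plus grafting of the last factor applied to the iterated
  coproduct of \<open>b\<close>. The induction hypothesis is used only in the last term.\<close>

lemma coassoc:
  assumes a: "a \<in> carrier H"
  shows "tensor_assoc R H H H (tensor_map R T H \<Delta> (\<lambda>x. x) (\<Delta> a)) = tensor_map R H T (\<lambda>x. x) \<Delta> (\<Delta> a)"
proof -
  note m = H_module and Tm = T_module and one = H.one_closed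
  note H = H_assoc_algebra
  let ?TL = "tensor_module R T H" and ?TR = "tensor_module R H T"
  let ?p = "pure_tensor R T H" and ?q = "pure_tensor R H T"
  define D1 where "D1 = tensor_map R T H \<Delta> (\<lambda>x. x)"
  define D2 where "D2 = tensor_map R H T (\<lambda>x. x) \<Delta>"
  define as where "as = tensor_assoc R H H H"
  \<comment> \<open>\<open>\<kappa>\<close> appends a unit as third factor. On the left it arises
    from the terms \<open>_ \<diamondop> \<one>\<close> of the outer coproduct (\<open>as1\<close>),
    on the right from those of the inner one.\<close>
  define \<kappa> where "\<kappa> = tensor_map R H T (\<lambda>x. x) (\<lambda>b. b \<diamondop> \<one>\<^bsub>H\<^esub>)"
  note TRm = tensor_module_module[OF m Tm]
  interpret TR: module R ?TR by (rule TRm)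
  note t1 = bilin_left[OF tens_bilin one]
  have D1: "D1 \<in> lin_map R T ?TL"
    unfolding D1_def by (rule tensor_map_linear[OF m m Tm m comult_linear lin_map_id])
  have D2: "D2 \<in> lin_map R T ?TR"
    unfolding D2_def by (rule tensor_map_linear[OF m m m Tm lin_map_id comult_linear])
  have as: "as \<in> lin_map R ?TL ?TR"
    unfolding as_def by (rule tensor_assoc_linear[OF m m m])
  have \<kappa>: "\<kappa> \<in> lin_map R T ?TR"
    unfolding \<kappa>_def by (rule tensor_map_linear[OF m m m Tm lin_map_id t1])
  have D1p: "D1 (b \<diamondop> c) = ?p (\<Delta> b) c" if "b \<in> carrier H" "c \<in> carrier H" for b c
    unfolding D1_def by (rule tensor_map_pure[OF m m Tm m comult_linear lin_map_id that])
  have D2p: "D2 (b \<diamondop> c) = ?q b (\<Delta> c)" if "b \<in> carrier H" "c \<in> carrier H" for b c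
    unfolding D2_def by (rule tensor_map_pure[OF m m m Tm lin_map_id comult_linear that])
  have \<kappa>p: "\<kappa> (b \<diamondop> c) = ?q b (c \<diamondop> \<one>\<^bsub>H\<^esub>)" if "b \<in> carrier H" "c \<in> carrier H" for b c
    unfolding \<kappa>_def by (rule tensor_map_pure[OF m m m Tm lin_map_id t1 that])
  have asp: "as (?p (b \<diamondop> c) d) = ?q b (c \<diamondop> d)" if "b \<in> carrier H" "c \<in> carrier H" "d \<in> carrier H" for b c d
    unfolding as_def by (rule tensor_assoc_pure[OF m m m that])
  note pb = pure_tensor_bilin[OF Tm m] and qb = pure_tensor_bilin[OF m Tm]
  have as1: "as (?p t \<one>\<^bsub>H\<^esub>) = \<kappa> t" if "t \<in> carrier T" for t
    by (rule tensor_eqI[OF lin_map_comp[OF bilin_left[OF pb one] as] \<kappa> m m TRm _ that])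
      (simp add: asp \<kappa>p one del: H_RT_simps)
  note cl = tens_closed comult_closed B_closed lam_closed \<mu>_closed one j_closed
    bilin_closed[OF pb] bilin_closed[OF qb] lin_map_closed[OF D1] lin_map_closed[OF D2]
    lin_map_closed[OF as] lin_map_closed[OF \<kappa>] lin_map_closed[OF idB_linear]
  note lin = lin_map_add[OF D1] lin_map_smult[OF D1] lin_map_add[OF D2] lin_map_smult[OF D2]
    lin_map_add[OF as] lin_map_smult[OF as] lin_map_add[OF \<kappa>] lin_map_smult[OF \<kappa>]
    bilin_simps[OF qb]
  have "as (D1 (\<Delta> a)) = D2 (\<Delta> a)"
  proof (rule alg_hom_eqI[OF assoc_algebra_tensor[OF H HH] _ _ _ _ a])
    have D1h: "D1 \<in> alg_hom R HH (tensor_algebra R HH H)"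
      using tensor_map_alg_hom[OF H H HH H comult_alg_hom alg_hom_id] by (simp add: D1_def del: H_RT_simps)
    have ash: "as \<in> alg_hom R (tensor_algebra R HH H) (tensor_algebra R H HH)"
      unfolding as_def by (rule tensor_assoc_alg_hom[OF H H H])
    show "(\<lambda>a. as (D1 (\<Delta> a))) \<in> alg_hom R H (tensor_algebra R H HH)"
      by (rule alg_hom_comp[OF comult_alg_hom alg_hom_comp[OF D1h ash]])
    have "D2 \<in> alg_hom R HH (tensor_algebra R H HH)"
      using tensor_map_alg_hom[OF H H H HH alg_hom_id comult_alg_hom] by (simp add: D2_def del: H_RT_simps)
    then show "(\<lambda>a. D2 (\<Delta> a)) \<in> alg_hom R H (tensor_algebra R H HH)"
      by (rule alg_hom_comp[OF comult_alg_hom])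
  next
    \<comment> \<open>Both iterated coproducts consist of the three placements of the leaf and of
      two copies of \<open>\<mu> x\<close> times the triple unit.\<close>
    fix x assume x: "x \<in> X"
    have "D1 (\<Delta> (j_RT R x)) = ?p (\<Delta> (j_RT R x)) \<one>\<^bsub>H\<^esub> \<oplus>\<^bsub>?TL\<^esub> ?p (\<one>\<^bsub>H\<^esub> \<diamondop> \<one>\<^bsub>H\<^esub>) (j_RT R x)
        \<oplus>\<^bsub>?TL\<^esub> \<mu> x \<odot>\<^bsub>?TL\<^esub> ?p (\<one>\<^bsub>H\<^esub> \<diamondop> \<one>\<^bsub>H\<^esub>) \<one>\<^bsub>H\<^esub>"
      by (subst comult_j[OF x])
        (simp add: lin D1p T.smult_closed T.a_closed cl x comult_one del: H_RT_simps)
    then have "as (D1 (\<Delta> (j_RT R x))) = \<kappa> (\<Delta> (j_RT R x)) \<oplus>\<^bsub>?TR\<^esub> ?q \<one>\<^bsub>H\<^esub> (\<one>\<^bsub>H\<^esub> \<diamondop> j_RT R x)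
        \<oplus>\<^bsub>?TR\<^esub> \<mu> x \<odot>\<^bsub>?TR\<^esub> ?q \<one>\<^bsub>H\<^esub> (\<one>\<^bsub>H\<^esub> \<diamondop> \<one>\<^bsub>H\<^esub>)"
      using tensor_module_module[OF Tm m]
      by (simp add: lin as1 asp \<kappa>p cl x module.smult_closed abelian_monoid.a_closed abelian_group.axioms
          module.axioms del: H_RT_simps)
    also have "\<kappa> (\<Delta> (j_RT R x)) = ?q (j_RT R x) (\<one>\<^bsub>H\<^esub> \<diamondop> \<one>\<^bsub>H\<^esub>) \<oplus>\<^bsub>?TR\<^esub> ?q \<one>\<^bsub>H\<^esub> (j_RT R x \<diamondop> \<one>\<^bsub>H\<^esub>)
        \<oplus>\<^bsub>?TR\<^esub> \<mu> x \<odot>\<^bsub>?TR\<^esub> ?q \<one>\<^bsub>H\<^esub> (\<one>\<^bsub>H\<^esub> \<diamondop> \<one>\<^bsub>H\<^esub>)"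
      by (subst comult_j[OF x]) (simp add: lin \<kappa>p cl x del: H_RT_simps)
    finally have L: "as (D1 (\<Delta> (j_RT R x))) = \<dots> \<oplus>\<^bsub>?TR\<^esub> ?q \<one>\<^bsub>H\<^esub> (\<one>\<^bsub>H\<^esub> \<diamondop> j_RT R x)
        \<oplus>\<^bsub>?TR\<^esub> \<mu> x \<odot>\<^bsub>?TR\<^esub> ?q \<one>\<^bsub>H\<^esub> (\<one>\<^bsub>H\<^esub> \<diamondop> \<one>\<^bsub>H\<^esub>)" .
    have "D2 (\<Delta> (j_RT R x)) = ?q (j_RT R x) (\<one>\<^bsub>H\<^esub> \<diamondop> \<one>\<^bsub>H\<^esub>) \<oplus>\<^bsub>?TR\<^esub> ?q \<one>\<^bsub>H\<^esub> (\<Delta> (j_RT R x))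
        \<oplus>\<^bsub>?TR\<^esub> \<mu> x \<odot>\<^bsub>?TR\<^esub> ?q \<one>\<^bsub>H\<^esub> (\<one>\<^bsub>H\<^esub> \<diamondop> \<one>\<^bsub>H\<^esub>)"
      by (subst comult_j[OF x]) (simp add: lin D2p cl x comult_one del: H_RT_simps)
    also have "?q \<one>\<^bsub>H\<^esub> (\<Delta> (j_RT R x)) = ?q \<one>\<^bsub>H\<^esub> (j_RT R x \<diamondop> \<one>\<^bsub>H\<^esub>) \<oplus>\<^bsub>?TR\<^esub> ?q \<one>\<^bsub>H\<^esub> (\<one>\<^bsub>H\<^esub> \<diamondop> j_RT R x)
        \<oplus>\<^bsub>?TR\<^esub> \<mu> x \<odot>\<^bsub>?TR\<^esub> ?q \<one>\<^bsub>H\<^esub> (\<one>\<^bsub>H\<^esub> \<diamondop> \<one>\<^bsub>H\<^esub>)"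
      by (subst comult_j[OF x]) (simp add: lin cl x del: H_RT_simps)
    finally show "as (D1 (\<Delta> (j_RT R x))) = D2 (\<Delta> (j_RT R x))"
      unfolding L using x by (simp add: cl TR.M.a_ac del: H_RT_simps)
  next
    fix \<omega> b assume \<omega>: "\<omega> \<in> \<Omega>" and b: "b \<in> carrier H" and IH: "as (D1 (\<Delta> b)) = D2 (\<Delta> b)"
    note BL = B_linear[OF \<omega>] and IB = idB_linear[OF \<omega>]
    define iB where "iB = tensor_map R H T (\<lambda>x. x) (idB \<omega>)"
    have iB: "iB \<in> lin_map R ?TR ?TR"
      unfolding iB_def by (rule tensor_map_linear[OF m Tm m Tm lin_map_id IB])
    have iBp: "iB (?q c t) = ?q c (idB \<omega> t)" if "c \<in> carrier H" "t \<in> carrier T" for c t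
      unfolding iB_def by (rule tensor_map_pure[OF m Tm m Tm lin_map_id IB that])
    have IBp: "idB \<omega> (c \<diamondop> d) = c \<diamondop> B \<omega> d" if "c \<in> carrier H" "d \<in> carrier H" for c d
      by (rule tensor_map_pure[OF m m m m lin_map_id BL that])
    have asB: "as (?p t (B \<omega> d)) = iB (as (?p t d))" if "t \<in> carrier T" "d \<in> carrier H" for t d
      by (rule tensor_eqI[OF lin_map_comp[OF bilin_left[OF pb] as]
            lin_map_comp[OF lin_map_comp[OF bilin_left[OF pb] as] iB] m m TRm _ that(1)])
        (use that \<omega> in \<open>simp_all add: asp iBp IBp cl del: H_RT_simps\<close>)
    \<comment> \<open>\<open>D1\<close> acts on the first factor and \<open>idB \<omega>\<close> on
      the second, so they commute; through the associator grafting then acts on the last of three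
      factors, as \<open>iB\<close>.\<close>
    have l: "as (D1 (idB \<omega> t)) = iB (as (D1 t))" if "t \<in> carrier T" for t
      by (rule tensor_eqI[OF lin_map_comp[OF IB lin_map_comp[OF D1 as]]
            lin_map_comp[OF lin_map_comp[OF D1 as] iB] m m TRm _ that])
        (use \<omega> in \<open>simp add: D1p IBp asB cl del: H_RT_simps\<close>)
    \<comment> \<open>The cocycle condition in the second factor: \<open>D2\<close> takes the
      coproduct of a grafted element, which splits into three terms.\<close>
    have r: "D2 (idB \<omega> t) = \<kappa> (idB \<omega> t) \<oplus>\<^bsub>?TR\<^esub> lam \<omega> \<odot>\<^bsub>?TR\<^esub> \<kappa> t \<oplus>\<^bsub>?TR\<^esub> iB (D2 t)"
      if "t \<in> carrier T" for t
      by (rule tensor_eqI[OF lin_map_comp[OF IB D2]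
            lin_map_plus[OF TRm lin_map_plus[OF TRm lin_map_comp[OF IB \<kappa>]
                lin_map_scale[OF TRm \<kappa> lam_closed[OF \<omega>]]] lin_map_comp[OF D2 iB]] m m TRm _ that])
        (use \<omega> in \<open>simp add: IBp D2p \<kappa>p iBp comult_B lin cl T.smult_closed T.a_closed del: H_RT_simps\<close>)
    have q1: "?q c (\<Delta> \<one>\<^bsub>H\<^esub>) = \<kappa> (c \<diamondop> \<one>\<^bsub>H\<^esub>)" if "c \<in> carrier H" for c
      using that by (simp add: \<kappa>p one comult_one del: H_RT_simps)
    note s = \<omega> b T.smult_closed T.a_closed cl
    have "as (D1 (\<Delta> (B \<omega> b))) = \<kappa> (\<Delta> (B \<omega> b)) \<oplus>\<^bsub>?TR\<^esub> lam \<omega> \<odot>\<^bsub>?TR\<^esub> \<kappa> (\<Delta> b) \<oplus>\<^bsub>?TR\<^esub> iB (D2 (\<Delta> b))"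
    proof -
      have "as (D1 (\<Delta> (B \<omega> b))) = as (D1 (B \<omega> b \<diamondop> \<one>\<^bsub>H\<^esub> \<oplus>\<^bsub>T\<^esub> lam \<omega> \<odot>\<^bsub>T\<^esub> (b \<diamondop> \<one>\<^bsub>H\<^esub>) \<oplus>\<^bsub>T\<^esub> idB \<omega> (\<Delta> b)))"
        by (simp only: comult_B[OF \<omega> b])
      also have "\<dots> = as (D1 (B \<omega> b \<diamondop> \<one>\<^bsub>H\<^esub>)) \<oplus>\<^bsub>?TR\<^esub> lam \<omega> \<odot>\<^bsub>?TR\<^esub> as (D1 (b \<diamondop> \<one>\<^bsub>H\<^esub>)) \<oplus>\<^bsub>?TR\<^esub> as (D1 (idB \<omega> (\<Delta> b)))"
        by (simp add: s lin_map_add[OF lin_map_comp[OF D1 as]] lin_map_smult[OF lin_map_comp[OF D1 as]] del: H_RT_simps)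
      finally show ?thesis by (simp add: D1p as1 l IH s del: H_RT_simps)
    qed
    also have "\<kappa> (\<Delta> (B \<omega> b)) = \<kappa> (B \<omega> b \<diamondop> \<one>\<^bsub>H\<^esub>) \<oplus>\<^bsub>?TR\<^esub> lam \<omega> \<odot>\<^bsub>?TR\<^esub> \<kappa> (b \<diamondop> \<one>\<^bsub>H\<^esub>) \<oplus>\<^bsub>?TR\<^esub> \<kappa> (idB \<omega> (\<Delta> b))"
      by (simp add: comult_B s lin del: H_RT_simps)
    finally have L: "as (D1 (\<Delta> (B \<omega> b))) = \<dots> \<oplus>\<^bsub>?TR\<^esub> lam \<omega> \<odot>\<^bsub>?TR\<^esub> \<kappa> (\<Delta> b) \<oplus>\<^bsub>?TR\<^esub> iB (D2 (\<Delta> b))" .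
    have "D2 (\<Delta> (B \<omega> b)) = \<kappa> (B \<omega> b \<diamondop> \<one>\<^bsub>H\<^esub>) \<oplus>\<^bsub>?TR\<^esub> lam \<omega> \<odot>\<^bsub>?TR\<^esub> \<kappa> (b \<diamondop> \<one>\<^bsub>H\<^esub>) \<oplus>\<^bsub>?TR\<^esub> D2 (idB \<omega> (\<Delta> b))"
      by (simp add: comult_B s lin D2p q1 del: H_RT_simps)
    then show "as (D1 (\<Delta> (B \<omega> b))) = D2 (\<Delta> (B \<omega> b))"
      unfolding L
      by (simp add: r s TR.M.a_assoc lin_map_closed[OF iB] TR.M.a_closed TR.smult_closed del: H_RT_simps)
  qed
  then show ?thesis by (simp add: as_def D1_def D2_def)
qed

end

section \<open>The counit laws\<close>

context forest_bialgebra
begin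

lemma counit_smult_bilin:
  "(\<lambda>a b. \<epsilon> a \<odot>\<^bsub>H\<^esub> b) \<in> bilin R H H H" "(\<lambda>a b. \<epsilon> b \<odot>\<^bsub>H\<^esub> a) \<in> bilin R H H H"
  by (intro bilinI lin_map_smult_vec[OF H_module _ counit_linear]
      lin_map_scale[OF H_module lin_map_id] counit_carrier; assumption)+

lemma smult_smult_mult:
  assumes "r \<in> carrier R" "s \<in> carrier R" "a \<in> carrier H" "b \<in> carrier H"
  shows "(r \<odot>\<^bsub>H\<^esub> a) \<otimes>\<^bsub>H\<^esub> (s \<odot>\<^bsub>H\<^esub> b) = (r \<otimes>\<^bsub>R\<^esub> s) \<odot>\<^bsub>H\<^esub> (a \<otimes>\<^bsub>H\<^esub> b)"
  using assms
  by (simp add: H.smult_mult_left H.smult_mult_right R.m_comm del: H_RT_simps flip: H.smult_assoc1)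

lemma counit_mult: "a \<in> carrier H \<Longrightarrow> b \<in> carrier H \<Longrightarrow> \<epsilon> (a \<otimes>\<^bsub>H\<^esub> b) = \<epsilon> a \<otimes>\<^bsub>R\<^esub> \<epsilon> b"
  using alg_hom_mult[OF counit_ext(1)] by simp

text \<open>Contracting the first factor of the coproduct of \<open>B \<omega> b\<close> gives
  \<open>\<epsilon> (B \<omega> b)\<close> and \<open>lam \<omega>\<close> times
  \<open>\<epsilon> b\<close> as multiples of \<open>\<one>\<close>, which cancel by the sign in the
  counit, and \<open>B \<omega>\<close> of the contraction for \<open>b\<close>. The contraction is
  multiplicative because its values of \<open>\<epsilon>\<close> are scalars.\<close>

lemma counit_left:
  assumes a: "a \<in> carrier H"
  shows "tensor_lift R H (\<lambda>a b. \<epsilon> a \<odot>\<^bsub>H\<^esub> b) (\<Delta> a) = a"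
proof -
  define E where "E = tensor_lift R H (\<lambda>a b. \<epsilon> a \<odot>\<^bsub>H\<^esub> b)"
  note m = H_module
  have E: "E \<in> lin_map R T H"
    unfolding E_def by (rule tensor_lift_linear[OF m m m counit_smult_bilin(1)])
  have Ep: "E (b \<diamondop> c) = \<epsilon> b \<odot>\<^bsub>H\<^esub> c" if "b \<in> carrier H" "c \<in> carrier H" for b c
    unfolding E_def by (rule tensor_lift_pure[OF m m m counit_smult_bilin(1) that])
  have Eh: "E \<in> alg_hom R HH H"
    by (rule tensor_alg_homI[OF H_assoc_algebra H_assoc_algebra H_assoc_algebra E])
      (simp_all add: Ep H.one_closed H.m_closed counit_one smult_smult_mult counit_mult
        counit_carrier del: H_RT_simps)
  note cl = tens_closed comult_closed B_closed lam_closed \<mu>_closed H.one_closed j_closed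
    lin_map_closed[OF E] lin_map_closed[OF idB_linear] counit_carrier T.smult_closed T.a_closed
    H.smult_closed H.M.a_closed
  note lin = lin_map_add[OF E] lin_map_smult[OF E]
  have "E (\<Delta> a) = a"
  proof (rule alg_hom_eqI[OF H_assoc_algebra alg_hom_comp[OF comult_alg_hom Eh] alg_hom_id _ _ a])
    fix x assume x: "x \<in> X"
    show "E (\<Delta> (j_RT R x)) = j_RT R x"
      using x by (simp add: comult_j lin Ep cl counit_j counit_one H.smult_l_minus H.M.a_ac
          H.M.r_neg2 H.M.r_neg H.M.r_neg1 del: H_RT_simps)
  next
    fix \<omega> b assume \<omega>: "\<omega> \<in> \<Omega>" and b: "b \<in> carrier H" and IH: "E (\<Delta> b) = b"
    have IBp: "idB \<omega> (c \<diamondop> d) = c \<diamondop> B \<omega> d" if "c \<in> carrier H" "d \<in> carrier H" for c d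
      by (rule tensor_map_pure[OF m m m m lin_map_id B_linear[OF \<omega>] that])
    have "E (idB \<omega> t) = B \<omega> (E t)" if "t \<in> carrier T" for t
      by (rule tensor_eqI[OF lin_map_comp[OF idB_linear[OF \<omega>] E] lin_map_comp[OF E B_linear[OF \<omega>]] m m m _ that])
        (use \<omega> in \<open>simp add: IBp Ep cl lin_map_smult[OF B_linear] del: H_RT_simps\<close>)
    then show "E (\<Delta> (B \<omega> b)) = B \<omega> b"
      using \<omega> b IH
      by (simp add: comult_B lin Ep cl counit_B counit_one H.smult_l_minus H.smult_assoc1 H.M.l_neg del: H_RT_simps)
  qed
  then show ?thesis by (simp add: E_def)
qed

text \<open>The cancellation differs from the left law: contracting the second factor leaves
  \<open>B \<omega> b\<close> and \<open>lam \<omega> \<odot> b\<close>, and the latter is cancelled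
  by the third term, where \<open>\<epsilon>\<close> meets the grafted factor and yields minus
  \<open>lam \<omega>\<close> times the contraction for \<open>b\<close>.\<close>

lemma counit_right:
  assumes a: "a \<in> carrier H"
  shows "tensor_lift R H (\<lambda>a b. \<epsilon> b \<odot>\<^bsub>H\<^esub> a) (\<Delta> a) = a"
proof -
  define E where "E = tensor_lift R H (\<lambda>a b. \<epsilon> b \<odot>\<^bsub>H\<^esub> a)"
  note m = H_module
  have E: "E \<in> lin_map R T H"
    unfolding E_def by (rule tensor_lift_linear[OF m m m counit_smult_bilin(2)])
  have Ep: "E (b \<diamondop> c) = \<epsilon> c \<odot>\<^bsub>H\<^esub> b" if "b \<in> carrier H" "c \<in> carrier H" for b c
    unfolding E_def by (rule tensor_lift_pure[OF m m m counit_smult_bilin(2) that])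
  have Eh: "E \<in> alg_hom R HH H"
    by (rule tensor_alg_homI[OF H_assoc_algebra H_assoc_algebra H_assoc_algebra E])
      (simp_all add: Ep H.one_closed H.m_closed counit_one smult_smult_mult counit_mult
        counit_carrier del: H_RT_simps)
  note cl = tens_closed comult_closed B_closed lam_closed \<mu>_closed H.one_closed j_closed
    lin_map_closed[OF E] lin_map_closed[OF idB_linear] counit_carrier T.smult_closed T.a_closed
    H.smult_closed H.M.a_closed
  note lin = lin_map_add[OF E] lin_map_smult[OF E]
  have "E (\<Delta> a) = a"
  proof (rule alg_hom_eqI[OF H_assoc_algebra alg_hom_comp[OF comult_alg_hom Eh] alg_hom_id _ _ a])
    fix x assume x: "x \<in> X"
    show "E (\<Delta> (j_RT R x)) = j_RT R x"
      using x by (simp add: comult_j lin Ep cl counit_j counit_one H.smult_l_minus H.M.a_assoc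
          H.M.l_neg del: H_RT_simps)
  next
    fix \<omega> b assume \<omega>: "\<omega> \<in> \<Omega>" and b: "b \<in> carrier H" and IH: "E (\<Delta> b) = b"
    have IBp: "idB \<omega> (c \<diamondop> d) = c \<diamondop> B \<omega> d" if "c \<in> carrier H" "d \<in> carrier H" for c d
      by (rule tensor_map_pure[OF m m m m lin_map_id B_linear[OF \<omega>] that])
    have "E (idB \<omega> t) = \<ominus>\<^bsub>H\<^esub> (lam \<omega> \<odot>\<^bsub>H\<^esub> E t)" if "t \<in> carrier T" for t
      by (rule tensor_eqI[OF lin_map_comp[OF idB_linear[OF \<omega>] E]
            lin_map_inv[OF m lin_map_scale[OF m E lam_closed[OF \<omega>]]] m m m _ that])
        (use \<omega> in \<open>simp add: IBp Ep cl counit_B H.smult_assoc1 H.smult_l_minus del: H_RT_simps\<close>)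
    then show "E (\<Delta> (B \<omega> b)) = B \<omega> b"
      using \<omega> b IH
      by (simp add: comult_B lin Ep cl counit_one H.M.a_assoc H.M.r_neg del: H_RT_simps)
  qed
  then show ?thesis by (simp add: E_def)
qed

lemma cocycle_bialgebra: "cocycle_bialgebra R \<Omega> lam H \<Delta> \<epsilon> B"
proof -
  have "coalgebra R H \<Delta> \<epsilon>"
    by (intro coalgebra.intro coalgebra_axioms.intro H_module comult_linear counit_linear
        coassoc counit_left counit_right)
  moreover have "ring_hom H (ground R) = ring_hom H R"
    by (simp add: ring_hom_def)
  then have "bialgebra_axioms R H \<Delta> \<epsilon>"
    using comult_alg_hom counit_ext(1) by (intro bialgebra_axioms.intro) (simp_all add: alg_hom_def)
  ultimately show ?thesis
    by (intro cocycle_bialgebra.intro operated_bialgebra.intro bialgebra.intro H_assoc_algebra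
        operated_bialgebra_axioms.intro cocycle_bialgebra_axioms.intro B_linear comult_B)
qed

end

section \<open>The universal property\<close>

text \<open>The values that an operated homomorphism extending \<open>f\<close> is forced to take;
  existence means that they do define one.\<close>

primrec hom_tree :: "('k, 'a) module \<Rightarrow> ('w \<Rightarrow> 'a \<Rightarrow> 'a) \<Rightarrow> ('x \<Rightarrow> 'a) \<Rightarrow> ('x, 'w) dtree \<Rightarrow> 'a"
  and hom_forest :: "('k, 'a) module \<Rightarrow> ('w \<Rightarrow> 'a \<Rightarrow> 'a) \<Rightarrow> ('x \<Rightarrow> 'a) \<Rightarrow> ('x, 'w) dtree list \<Rightarrow> 'a"
where
  "hom_tree A P f (Leaf x) = f x"
| "hom_tree A P f (Node \<omega> F) = P \<omega> (hom_forest A P f F)"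
| "hom_forest A P f [] = \<one>\<^bsub>A\<^esub>"
| "hom_forest A P f (T # F) = hom_tree A P f T \<otimes>\<^bsub>A\<^esub> hom_forest A P f F"

section \<open>The counit forced by the cocycle condition\<close>

context cocycle_bialgebra
begin

lemma counit_one: "\<epsilon> \<one>\<^bsub>A\<^esub> = \<one>\<^bsub>R\<^esub>"
  by (rule ring_hom_one[OF counit_hom])

text \<open>Applying \<open>\<epsilon>\<close> to a multiple of \<open>\<one>\<close> recovers the
  scalar, so \<open>r \<mapsto> r \<odot> \<one>\<close> is injective even though \<open>A\<close>
  is an arbitrary module.\<close>

lemma counit_eq_of_smult_one:
  assumes "r \<in> carrier R" "s \<in> carrier R" "(r \<oplus>\<^bsub>R\<^esub> s) \<odot>\<^bsub>A\<^esub> \<one>\<^bsub>A\<^esub> = \<zero>\<^bsub>A\<^esub>"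
  shows "r = \<ominus>\<^bsub>R\<^esub> s"
proof -
  have "r \<oplus>\<^bsub>R\<^esub> s = \<epsilon> ((r \<oplus>\<^bsub>R\<^esub> s) \<odot>\<^bsub>A\<^esub> \<one>\<^bsub>A\<^esub>)"
    using assms(1,2) by (subst lin_map_smult[OF counit_linear]) (simp_all add: counit_one)
  also have "\<dots> = \<zero>\<^bsub>R\<^esub>"
    unfolding assms(3) using lin_map_zero[OF counit_linear module ground_module[OF R.is_cring]] by simp
  finally show ?thesis
    using assms(1,2) R.minus_equality[of r s] by simp
qed

text \<open>The left counit law reads \<open>a = \<epsilon> a \<odot> \<one> \<oplus> a \<oplus> r
  \<odot> \<one>\<close>; cancelling \<open>a\<close> leaves a vanishing multiple of
  \<open>\<one>\<close>.\<close>

lemma counit_primitive: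
  assumes r: "r \<in> carrier R" and a: "a \<in> carrier A"
    and \<Delta>: "\<Delta> a = pure_tensor R A A a \<one>\<^bsub>A\<^esub> \<oplus>\<^bsub>tensor_module R A A\<^esub> pure_tensor R A A \<one>\<^bsub>A\<^esub> a
      \<oplus>\<^bsub>tensor_module R A A\<^esub> r \<odot>\<^bsub>tensor_module R A A\<^esub> pure_tensor R A A \<one>\<^bsub>A\<^esub> \<one>\<^bsub>A\<^esub>"
  shows "\<epsilon> a = \<ominus>\<^bsub>R\<^esub> r"
proof -
  note m = module
  interpret T: module R "tensor_module R A A" by (rule tensor_module_module[OF m m])
  note E = tensor_lift_linear[OF m m m smult_bilin(1)]
  note cl = pure_tensor_closed[OF m m] a r counit_closed
  have "a = tensor_lift R A (\<lambda>a b. \<epsilon> a \<odot>\<^bsub>A\<^esub> b) (\<Delta> a)"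
    by (rule counit_left[OF a, symmetric])
  also have "\<dots> = \<epsilon> a \<odot>\<^bsub>A\<^esub> \<one>\<^bsub>A\<^esub> \<oplus>\<^bsub>A\<^esub> a \<oplus>\<^bsub>A\<^esub> r \<odot>\<^bsub>A\<^esub> \<one>\<^bsub>A\<^esub>"
    unfolding \<Delta> by (simp add: lin_map_add[OF E] lin_map_smult[OF E] cl
        tensor_lift_pure[OF m m m smult_bilin(1)] counit_one)
  also have "\<dots> = a \<oplus>\<^bsub>A\<^esub> (\<epsilon> a \<oplus>\<^bsub>R\<^esub> r) \<odot>\<^bsub>A\<^esub> \<one>\<^bsub>A\<^esub>"
    by (simp add: smult_l_distr cl M.a_ac)
  finally have "(\<epsilon> a \<oplus>\<^bsub>R\<^esub> r) \<odot>\<^bsub>A\<^esub> \<one>\<^bsub>A\<^esub> = \<zero>\<^bsub>A\<^esub>"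
    using a r counit_closed[OF a] M.add.r_cancel_one'[of a] by (simp add: M.a_comm)
  then show ?thesis
    by (rule counit_eq_of_smult_one[OF counit_closed[OF a] r])
qed

lemma counit_oper:
  assumes \<omega>: "\<omega> \<in> \<Omega>" and lam: "lam \<omega> \<in> carrier R" and a: "a \<in> carrier A"
  shows "\<epsilon> (P \<omega> a) = \<ominus>\<^bsub>R\<^esub> (lam \<omega> \<otimes>\<^bsub>R\<^esub> \<epsilon> a)"
proof -
  note m = module
  note P = oper_linear[OF \<omega>]
  interpret T: module R "tensor_module R A A" by (rule tensor_module_module[OF m m])
  define E where "E = tensor_lift R A (\<lambda>a b. \<epsilon> a \<odot>\<^bsub>A\<^esub> b)"
  have E: "E \<in> lin_map R (tensor_module R A A) A"
    unfolding E_def by (rule tensor_lift_linear[OF m m m smult_bilin(1)])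
  have Ep: "E (pure_tensor R A A b c) = \<epsilon> b \<odot>\<^bsub>A\<^esub> c" if "b \<in> carrier A" "c \<in> carrier A" for b c
    unfolding E_def by (rule tensor_lift_pure[OF m m m smult_bilin(1) that])
  note IP = tensor_map_linear[OF m m m m lin_map_id P]
  \<comment> \<open>\<open>E\<close> contracts the first factor while \<open>P \<omega>\<close> acts
    on the second, so the third summand of the cocycle condition contracts to
    \<open>P \<omega> a\<close> and cancels against the left side.\<close>
  have EP: "E (tensor_map R A A (\<lambda>x. x) (P \<omega>) t) = P \<omega> (E t)" if "t \<in> carrier (tensor_module R A A)" for t
    by (rule tensor_eqI[OF lin_map_comp[OF IP E] lin_map_comp[OF E P] m m m _ that])
      (simp add: tensor_map_pure[OF m m m m lin_map_id P] Ep lin_map_closed[OF P] lin_map_smult[OF P]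
        counit_closed)
  note cl = pure_tensor_closed[OF m m] a lam counit_closed lin_map_closed[OF P] lin_map_closed[OF IP] comult_closed
  have "P \<omega> a = E (\<Delta> (P \<omega> a))"
    unfolding E_def by (rule counit_left[symmetric]) (simp add: cl)
  also have "\<dots> = \<epsilon> (P \<omega> a) \<odot>\<^bsub>A\<^esub> \<one>\<^bsub>A\<^esub> \<oplus>\<^bsub>A\<^esub> lam \<omega> \<odot>\<^bsub>A\<^esub> (\<epsilon> a \<odot>\<^bsub>A\<^esub> \<one>\<^bsub>A\<^esub>) \<oplus>\<^bsub>A\<^esub> P \<omega> (E (\<Delta> a))"
    unfolding cocycle[OF \<omega> a] by (simp add: lin_map_add[OF E] lin_map_smult[OF E] cl Ep EP)
  also have "E (\<Delta> a) = a"
    unfolding E_def by (rule counit_left[OF a])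
  also have "\<epsilon> (P \<omega> a) \<odot>\<^bsub>A\<^esub> \<one>\<^bsub>A\<^esub> \<oplus>\<^bsub>A\<^esub> lam \<omega> \<odot>\<^bsub>A\<^esub> (\<epsilon> a \<odot>\<^bsub>A\<^esub> \<one>\<^bsub>A\<^esub>) \<oplus>\<^bsub>A\<^esub> P \<omega> a
      = P \<omega> a \<oplus>\<^bsub>A\<^esub> (\<epsilon> (P \<omega> a) \<oplus>\<^bsub>R\<^esub> lam \<omega> \<otimes>\<^bsub>R\<^esub> \<epsilon> a) \<odot>\<^bsub>A\<^esub> \<one>\<^bsub>A\<^esub>"
    by (simp add: smult_l_distr smult_assoc1 cl M.a_ac)
  finally have "(\<epsilon> (P \<omega> a) \<oplus>\<^bsub>R\<^esub> lam \<omega> \<otimes>\<^bsub>R\<^esub> \<epsilon> a) \<odot>\<^bsub>A\<^esub> \<one>\<^bsub>A\<^esub> = \<zero>\<^bsub>A\<^esub>"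
    using M.add.r_cancel_one'[of "P \<omega> a"] by (simp add: M.a_comm cl)
  then show ?thesis
    by (intro counit_eq_of_smult_one) (simp_all add: cl)
qed

end

context forest_bialgebra
begin

text \<open>Without \<open>extensional\<close> uniqueness would fail, as values off the carrier are
  free. The map is therefore built as a linear extension \<open>h\<close>, shown to be a
  homomorphism, and only then restricted.\<close>

theorem universal_property:
  assumes "cocycle_bialgebra R \<Omega> lam A \<Delta>' \<epsilon>' P" and f: "f \<in> X \<rightarrow> carrier A"
    and \<Delta>f: "\<And>x. x \<in> X \<Longrightarrow> \<Delta>' (f x) = pure_tensor R A A (f x) \<one>\<^bsub>A\<^esub>
           \<oplus>\<^bsub>tensor_module R A A\<^esub> pure_tensor R A A \<one>\<^bsub>A\<^esub> (f x)
           \<oplus>\<^bsub>tensor_module R A A\<^esub> \<mu> x \<odot>\<^bsub>tensor_module R A A\<^esub> pure_tensor R A A \<one>\<^bsub>A\<^esub> \<one>\<^bsub>A\<^esub>"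
  shows "\<exists>!h. h \<in> extensional (carrier H) \<and>
    h \<in> operated_bialgebra_hom R \<Omega> H \<Delta> \<epsilon> B A \<Delta>' \<epsilon>' P \<and> (\<forall>x\<in>X. h (j_RT R x) = f x)"
proof -
  interpret A: cocycle_bialgebra R \<Omega> lam A \<Delta>' \<epsilon>' P by fact
  note Am = A.module and Aa = A.assoc_algebra and Hm = H_module
  note Pl = A.oper_linear
  have fc: "x \<in> X \<Longrightarrow> f x \<in> carrier A" for x using f by auto
  have tree: "hom_tree A P f t \<in> carrier A" if t: "t \<in> dtrees X \<Omega>" for t
  proof -
    have "hom_forest A P f F \<in> carrier A" if "F \<in> forests X \<Omega>" for F
      using that by (induction rule: forest_induct) (simp_all add: fc lin_map_closed[OF Pl])
    then show ?thesis using t by (cases t) (simp_all add: fc lin_map_closed[OF Pl])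
  qed
  define h where "h = lin_ext R A (hom_forest A P f)"
  note ext = lin_ext_alg_hom[where \<tau> = "hom_tree A P f" and \<phi> = "hom_forest A P f",
      OF Aa tree, folded h_def, OF _ hom_forest.simps]
  have h: "h \<in> alg_hom R H A" and hb: "\<And>F. F \<in> forests X \<Omega> \<Longrightarrow> h (bv F) = hom_forest A P f F"
    and fo: "\<And>F. F \<in> forests X \<Omega> \<Longrightarrow> hom_forest A P f F \<in> carrier A"
    using ext by simp_all
  note hl = alg_hom_lin[OF h]
  have hj: "h (j_RT R x) = f x" if "x \<in> X" for x
    unfolding j_RT_def using that by (simp add: hb fc)
  have hB: "h (B \<omega> a) = P \<omega> (h a)" if \<omega>: "\<omega> \<in> \<Omega>" and a: "a \<in> carrier H" for \<omega> a
    by (rule H_eqI[OF lin_map_comp[OF B_linear[OF \<omega>] hl] lin_map_comp[OF hl Pl[OF \<omega>]] Am _ a])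
      (simp add: B_bv \<omega> hb fo lin_map_closed[OF Pl])
  let ?TA = "tensor_module R A A"
  interpret TA: module R ?TA by (rule tensor_module_module[OF Am Am])
  note hh = tensor_map_linear[OF Hm Hm Am Am hl hl] and hhp = tensor_map_pure[OF Hm Hm Am Am hl hl]
  have hone: "h \<one>\<^bsub>H\<^esub> = \<one>\<^bsub>A\<^esub>" by (rule alg_hom_one[OF h])
  note cl = tens_closed comult_closed B_closed lam_closed \<mu>_closed H.one_closed j_closed
    lin_map_closed[OF idB_linear] T.smult_closed T.a_closed
  have h\<Delta>: "\<Delta>' (h a) = tensor_map R A A h h (\<Delta> a)" if a: "a \<in> carrier H" for a
  proof (rule alg_hom_eqI[OF assoc_algebra_tensor[OF Aa Aa] _ _ _ _ a])
    have "\<Delta>' \<in> alg_hom R A (tensor_algebra R A A)"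
      using A.comult_hom A.comult_linear by (simp add: alg_hom_def)
    then show "(\<lambda>a. \<Delta>' (h a)) \<in> alg_hom R H (tensor_algebra R A A)"
      by (rule alg_hom_comp[OF h])
    show "(\<lambda>a. tensor_map R A A h h (\<Delta> a)) \<in> alg_hom R H (tensor_algebra R A A)"
      by (rule alg_hom_comp[OF comult_alg_hom tensor_map_alg_hom[OF H_assoc_algebra H_assoc_algebra Aa Aa h h]])
  next
    fix x assume x: "x \<in> X"
    then show "\<Delta>' (h (j_RT R x)) = tensor_map R A A h h (\<Delta> (j_RT R x))"
      by (simp add: hj \<Delta>f comult_j lin_map_add[OF hh] lin_map_smult[OF hh] hhp cl hone del: H_RT_simps)
  next
    fix \<omega> b assume \<omega>: "\<omega> \<in> \<Omega>" and b: "b \<in> carrier H"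
      and IH: "\<Delta>' (h b) = tensor_map R A A h h (\<Delta> b)"
    note BL = B_linear[OF \<omega>] and PL = Pl[OF \<omega>]
    have hb: "h b \<in> carrier A" by (rule lin_map_closed[OF hl b])
    \<comment> \<open>Since \<open>h\<close> intertwines \<open>B \<omega>\<close> with
      \<open>P \<omega>\<close>, the map \<open>h \<otimes> h\<close> intertwines their actions on
      the second factor. This carries the cocycle condition of \<open>H\<close> to that of
      \<open>A\<close>, term by term.\<close>
    have "tensor_map R A A h h (idB \<omega> t) = tensor_map R A A (\<lambda>x. x) (P \<omega>) (tensor_map R A A h h t)"
      if t: "t \<in> carrier T" for t
    proof -
      have "tensor_map R A A h h (idB \<omega> t) = tensor_map R A A h (\<lambda>b. h (B \<omega> b)) t"
        by (rule tensor_map_comp[OF Hm Hm Hm Hm Am Am lin_map_id BL hl hl t])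
      also have "\<dots> = tensor_map R A A h (\<lambda>b. P \<omega> (h b)) t"
        by (rule tensor_map_cong[OF Hm Hm Am Am hl lin_map_comp[OF hl PL] refl _ t]) (simp add: hB \<omega>)
      also have "\<dots> = tensor_map R A A (\<lambda>x. x) (P \<omega>) (tensor_map R A A h h t)"
        by (rule tensor_map_comp[symmetric, OF Hm Hm Am Am Am Am hl hl lin_map_id PL t])
      finally show ?thesis .
    qed
    then show "\<Delta>' (h (B \<omega> b)) = tensor_map R A A h h (\<Delta> (B \<omega> b))"
      using \<omega> b hb by (simp add: hB A.cocycle IH comult_B lin_map_add[OF hh] lin_map_smult[OF hh] hhp cl hone
          del: H_RT_simps)
  qed
  have h\<epsilon>: "\<epsilon>' (h a) = \<epsilon> a" if a: "a \<in> carrier H" for a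
  proof (rule alg_hom_eqI[OF ground _ counit_ext(1) _ _ a])
    have "ring_hom A (ground R) = ring_hom A R"
      by (simp add: ring_hom_def)
    then have "\<epsilon>' \<in> alg_hom R A (ground R)"
      using A.counit_hom A.counit_linear by (simp add: alg_hom_def)
    then show "(\<lambda>a. \<epsilon>' (h a)) \<in> alg_hom R H (ground R)"
      by (rule alg_hom_comp[OF h])
    show "\<epsilon>' (h (j_RT R x)) = \<epsilon> (j_RT R x)" if x: "x \<in> X" for x
      using A.counit_primitive[OF \<mu>_closed[OF x] fc[OF x] \<Delta>f[OF x]] by (simp add: hj counit_j x)
    show "\<epsilon>' (h (B \<omega> b)) = \<epsilon> (B \<omega> b)" if "\<omega> \<in> \<Omega>" "b \<in> carrier H" "\<epsilon>' (h b) = \<epsilon> b" for \<omega> b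
      using that A.counit_oper[OF that(1) lam_closed[OF that(1)] lin_map_closed[OF hl that(2)]]
      by (simp add: hB counit_B del: H_RT_simps)
  qed
  show ?thesis
  proof (rule ex1I)
    let ?h = "restrict h (carrier H)"
    have r: "\<And>a. a \<in> carrier H \<Longrightarrow> ?h a = h a" by simp
    have "?h \<in> alg_hom R H A"
    proof (rule alg_homI)
      show "?h \<in> lin_map R H A" by (rule lin_map_cong[OF hl Hm r])
      show "?h \<one>\<^bsub>H\<^esub> = \<one>\<^bsub>A\<^esub>" unfolding r[OF H.one_closed] by (rule hone)
    qed (simp add: r alg_hom_mult[OF h] H.m_closed del: H_RT_simps)
    \<comment> \<open>The coproduct condition mentions \<open>?h\<close> inside a tensor map, so
      pointwise agreement on the carrier has to be pushed through \<open>tensor_map\<close>.\<close>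
    moreover have "tensor_map R A A ?h ?h (\<Delta> a) = tensor_map R A A h h (\<Delta> a)" if "a \<in> carrier H" for a
      by (rule tensor_map_cong[OF Hm Hm Am Am hl hl r r comult_closed[OF that]])
    ultimately show "?h \<in> extensional (carrier H) \<and>
        ?h \<in> operated_bialgebra_hom R \<Omega> H \<Delta> \<epsilon> B A \<Delta>' \<epsilon>' P \<and> (\<forall>x\<in>X. ?h (j_RT R x) = f x)"
      by (simp add: operated_bialgebra_hom_def alg_hom_def r h\<Delta> h\<epsilon> hB B_closed hj j_closed del: H_RT_simps)
    fix g assume g: "g \<in> extensional (carrier H) \<and>
      g \<in> operated_bialgebra_hom R \<Omega> H \<Delta> \<epsilon> B A \<Delta>' \<epsilon>' P \<and> (\<forall>x\<in>X. g (j_RT R x) = f x)"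
    then have gh: "g \<in> alg_hom R H A"
      by (simp add: operated_bialgebra_hom_def alg_hom_def)
    show "g = ?h"
    proof (rule extensionalityI)
      show "g \<in> extensional (carrier H)" using g by blast
      fix a assume a: "a \<in> carrier H"
      have "g a = h a"
        by (rule alg_hom_eqI[OF Aa gh h _ _ a])
          (use g in \<open>simp_all add: operated_bialgebra_hom_def hj hB del: H_RT_simps\<close>)
      then show "g a = ?h a" using a by simp
    qed simp
  qed
qed

end

section \<open>The filtration by the number of vertices\<close>

lemma lin_map_span_closed:
  assumes "f \<in> lin_map R M N" "module R M" "module R N" "submodule K R N" "S \<subseteq> carrier M"
    and "\<And>s. s \<in> S \<Longrightarrow> f s \<in> K" "x \<in> lin_span R M S"
  shows "f x \<in> K"
  using lin_span_least[OF submodule_preimage[OF assms(1-4)], of S] assms(5-7) by blast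

text \<open>Reduces statements that degrees add under a product to products of generators, both in
  \<open>H\<close> and in \<open>H \<otimes> H\<close>.\<close>

lemma bilin_span_closed:
  assumes \<beta>: "\<beta> \<in> bilin R M N P" and m: "module R M" "module R N" "module R P"
    and K: "submodule K R P" and S: "S \<subseteq> carrier M" "S' \<subseteq> carrier N"
    and closed: "\<And>s s'. s \<in> S \<Longrightarrow> s' \<in> S' \<Longrightarrow> \<beta> s s' \<in> K"
    and xy: "x \<in> lin_span R M S" "y \<in> lin_span R N S'"
  shows "\<beta> x y \<in> K"
proof (rule lin_map_span_closed[OF bilin_left[OF \<beta>] m(1,3) K S(1) _ xy(1)])
  show "y \<in> carrier N"
    using submodule_subset[OF lin_span_submodule[OF m(2) S(2)]] xy(2) by blast
  fix s assume s: "s \<in> S"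
  then have "s \<in> carrier M" using S by blast
  then show "\<beta> s y \<in> K"
    by (rule lin_map_span_closed[OF bilin_right[OF \<beta>] m(2,3) K S(2) closed[OF s] xy(2)])
qed

section \<open>Compatibility of the vertex filtration with product, grafting and coproduct\<close>

context forest_bialgebra
begin

abbreviation "Fil \<equiv> Fil_RT R X \<Omega>"

definition "Fil_basis n = {bv F | F. F \<in> forests X \<Omega> \<and> forest_verts F \<le> n}"

text \<open>Kept in the exact shape that \<open>fil_comult\<close> asks for, with
  \<open>p + q\<close> equal to \<open>n\<close>.\<close>

definition "Fil2_gens n = {a \<diamondop> b | a b p q. p + q = n \<and> a \<in> Fil p \<and> b \<in> Fil q}"

definition "Fil2 n = lin_span R T (Fil2_gens n)"

lemma Fil_span: "Fil n = lin_span R H (Fil_basis n)"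
  by (simp add: Fil_RT_def Fil_basis_def)

lemma Fil_basis_closed: "Fil_basis n \<subseteq> carrier H"
  using bv_closed unfolding Fil_basis_def by blast

lemma Fil_submodule: "submodule (Fil n) R H"
  unfolding Fil_span by (rule lin_span_submodule[OF H_module Fil_basis_closed])

lemma Fil_closed: "a \<in> Fil n \<Longrightarrow> a \<in> carrier H"
  using submodule_subset[OF Fil_submodule] by blast

lemma Fil_mono: "m \<le> n \<Longrightarrow> Fil m \<subseteq> Fil n"
  unfolding Fil_span by (rule lin_span_mono) (auto simp: Fil_basis_def)

lemma bv_Fil: "F \<in> forests X \<Omega> \<Longrightarrow> forest_verts F \<le> n \<Longrightarrow> bv F \<in> Fil n"
  unfolding Fil_span by (rule subsetD[OF lin_span_superset]) (auto simp: Fil_basis_def)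

lemma one_Fil: "\<one>\<^bsub>H\<^esub> \<in> Fil n"
  unfolding H_one by (rule bv_Fil) simp_all

lemma Fil2_gens_closed: "Fil2_gens n \<subseteq> carrier T"
  unfolding Fil2_gens_def using tens_closed Fil_closed by blast

lemma Fil2_submodule: "submodule (Fil2 n) R T"
  unfolding Fil2_def by (rule lin_span_submodule[OF T_module Fil2_gens_closed])

lemma tens_Fil2: "a \<in> Fil p \<Longrightarrow> b \<in> Fil q \<Longrightarrow> p + q = n \<Longrightarrow> a \<diamondop> b \<in> Fil2 n"
  unfolding Fil2_def by (rule subsetD[OF lin_span_superset]) (auto simp: Fil2_gens_def)

lemma Fil2_mono:
  assumes "m \<le> n"
  shows "Fil2 m \<subseteq> Fil2 n"
proof -
  \<comment> \<open>The indices must sum exactly to \<open>n\<close>, so the slack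
    \<open>n - m\<close> is added to the index of the first factor.\<close>
  have "a \<diamondop> b \<in> Fil2 n" if "p + q = m" "a \<in> Fil p" "b \<in> Fil q" for a b p q
  proof (rule tens_Fil2[OF _ that(3)])
    show "a \<in> Fil (p + (n - m))" using that(2) Fil_mono[of p "p + (n - m)"] by auto
    show "p + (n - m) + q = n" using that(1) assms by simp
  qed
  then show ?thesis
    unfolding Fil2_def[of m]
    by (intro lin_span_least[OF Fil2_submodule]) (auto simp: Fil2_gens_def)
qed

lemma Fil_mult:
  assumes "a \<in> Fil p" "b \<in> Fil q"
  shows "a \<otimes>\<^bsub>H\<^esub> b \<in> Fil (p + q)"
proof (rule bilin_span_closed[OF H_mult_bilin H_module H_module H_module Fil_submodule
      Fil_basis_closed Fil_basis_closed])
  show "a \<in> lin_span R H (Fil_basis p)" "b \<in> lin_span R H (Fil_basis q)"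
    using assms by (simp_all only: Fil_span)
  fix s s' assume "s \<in> Fil_basis p" "s' \<in> Fil_basis q"
  then obtain F G where "s = bv F" "s' = bv G" "F \<in> forests X \<Omega>" "G \<in> forests X \<Omega>"
    "forest_verts F \<le> p" "forest_verts G \<le> q"
    unfolding Fil_basis_def by blast
  moreover have "forest_verts (F @ G) = forest_verts F + forest_verts G"
    by (simp add: forest_verts_def)
  ultimately show "s \<otimes>\<^bsub>H\<^esub> s' \<in> Fil (p + q)"
    by (simp only: bv_mult) (rule bv_Fil, simp_all)
qed

lemma B_Fil:
  assumes \<omega>: "\<omega> \<in> \<Omega>" and a: "a \<in> Fil p"
  shows "B \<omega> a \<in> Fil (Suc p)"
proof (rule lin_map_span_closed[OF B_linear[OF \<omega>] H_module H_module Fil_submodule Fil_basis_closed])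
  show "a \<in> lin_span R H (Fil_basis p)" using a by (simp only: Fil_span)
  fix s assume "s \<in> Fil_basis p"
  then show "B \<omega> s \<in> Fil (Suc p)"
    unfolding Fil_basis_def using \<omega> by (auto simp: B_bv intro!: bv_Fil)
qed

lemma Fil2_mult:
  assumes "s \<in> Fil2 m" "t \<in> Fil2 n"
  shows "s \<otimes>\<^bsub>HH\<^esub> t \<in> Fil2 (m + n)"
proof -
  have bil: "(\<lambda>s t. s \<otimes>\<^bsub>HH\<^esub> t) \<in> bilin R T T T"
    using mult_bilin[OF HH] by (simp add: bilin_def)
  show ?thesis
  proof (rule bilin_span_closed[OF bil T_module T_module T_module Fil2_submodule Fil2_gens_closed Fil2_gens_closed])
    show "s \<in> lin_span R T (Fil2_gens m)" "t \<in> lin_span R T (Fil2_gens n)"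
      using assms by (simp_all only: Fil2_def)
    fix x y assume "x \<in> Fil2_gens m" "y \<in> Fil2_gens n"
    then obtain a b p q a' b' p' q' where x: "x = a \<diamondop> b" "p + q = m" "a \<in> Fil p" "b \<in> Fil q"
      and y: "y = a' \<diamondop> b'" "p' + q' = n" "a' \<in> Fil p'" "b' \<in> Fil q'"
      unfolding Fil2_gens_def by blast
    have "x \<otimes>\<^bsub>HH\<^esub> y = (a \<otimes>\<^bsub>H\<^esub> a') \<diamondop> (b \<otimes>\<^bsub>H\<^esub> b')"
      unfolding x(1) y(1)
      by (rule tensor_mult_pure[OF H_assoc_algebra H_assoc_algebra]; rule Fil_closed; fact)
    also have "\<dots> \<in> Fil2 (m + n)"
      using x y by (intro tens_Fil2[of _ "p + p'" _ "q + q'"] Fil_mult) auto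
    finally show "x \<otimes>\<^bsub>HH\<^esub> y \<in> Fil2 (m + n)" .
  qed
qed

lemma idB_Fil2:
  assumes \<omega>: "\<omega> \<in> \<Omega>" and t: "t \<in> Fil2 n"
  shows "idB \<omega> t \<in> Fil2 (Suc n)"
proof (rule lin_map_span_closed[OF idB_linear[OF \<omega>] T_module T_module Fil2_submodule Fil2_gens_closed])
  show "t \<in> lin_span R T (Fil2_gens n)" using t by (simp only: Fil2_def)
  fix s assume "s \<in> Fil2_gens n"
  then obtain a b p q where s: "s = a \<diamondop> b" "p + q = n" "a \<in> Fil p" "b \<in> Fil q"
    unfolding Fil2_gens_def by blast
  have "idB \<omega> s = a \<diamondop> B \<omega> b"
    unfolding s(1)
    by (rule tensor_map_pure[OF H_module H_module H_module H_module lin_map_id B_linear[OF \<omega>]];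
        rule Fil_closed; fact)
  also have "\<dots> \<in> Fil2 (Suc n)"
    using s by (intro tens_Fil2[of _ p _ "Suc q"] B_Fil \<omega>) auto
  finally show "idB \<omega> s \<in> Fil2 (Suc n)" .
qed

text \<open>Degrees add under products and grafting adds one, so it remains to place the extra terms
  of the weights. They have fewer vertices than the forest, and fit because \<open>Fil\<close>
  bounds the number of vertices from above only.\<close>

lemma comult_forest_Fil2: "F \<in> forests X \<Omega> \<Longrightarrow> comult_forest R X \<Omega> \<mu> lam F \<in> Fil2 (forest_verts F)"
proof (induction rule: forest_induct)
  case Nil
  show ?case
    unfolding comult_forest.simps by (rule tens_Fil2[OF one_Fil one_Fil]) simp
next
  case (Leaf x F)
  note sub = submodule_add[OF Fil2_submodule] submodule_smult[OF Fil2_submodule]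
  have j: "j_RT R x \<in> Fil 1"
    unfolding j_RT_def by (rule bv_Fil) (simp_all add: Leaf)
  \<comment> \<open>The term with \<open>\<mu> x\<close> has no vertices; one of its units is
    counted in \<open>Fil 1\<close> to reach total index 1.\<close>
  have "comult_tree R X \<Omega> \<mu> lam (Leaf x) \<in> Fil2 1"
    unfolding comult_tree_Leaf
    by (intro sub \<mu>_closed Leaf tens_Fil2[OF j one_Fil[of 0]] tens_Fil2[OF one_Fil[of 0] j]
        tens_Fil2[OF one_Fil[of 0] one_Fil[of 1]]) simp_all
  from Fil2_mult[OF this Leaf(3)] show ?case by simp
next
  case (Node \<omega> F G)
  note sub = submodule_add[OF Fil2_submodule] submodule_smult[OF Fil2_submodule]
  let ?n = "Suc (forest_verts F)"
  \<comment> \<open>\<open>F\<close> has one vertex fewer than its grafting, yet is placed in the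
    same step, so that the \<open>lam \<omega>\<close> term has total index
    \<open>?n\<close>.\<close>
  have b: "bv [Node \<omega> F] \<in> Fil ?n" "bv F \<in> Fil ?n"
    by (intro bv_Fil; simp add: Node)+
  have "comult_tree R X \<Omega> \<mu> lam (Node \<omega> F) \<in> Fil2 ?n"
    unfolding comult_tree_Node
    by (intro sub lam_closed Node idB_Fil2 tens_Fil2[OF b(1) one_Fil[of 0]]
        tens_Fil2[OF b(2) one_Fil[of 0]]) simp_all
  from Fil2_mult[OF this Node(5)] show ?case by simp
qed

lemma comult_Fil2:
  assumes "a \<in> Fil n"
  shows "\<Delta> a \<in> Fil2 n"
proof (rule lin_map_span_closed[OF comult_linear H_module T_module Fil2_submodule Fil_basis_closed])
  show "a \<in> lin_span R H (Fil_basis n)" using assms by (simp only: Fil_span)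
  fix s assume "s \<in> Fil_basis n"
  then obtain F where "s = bv F" "F \<in> forests X \<Omega>" "forest_verts F \<le> n"
    unfolding Fil_basis_def by blast
  then show "\<Delta> s \<in> Fil2 n"
    using comult_forest_Fil2[of F] Fil2_mono[of "forest_verts F" n] by (auto simp: comult_bv)
qed

lemma Fil_exhaustive: "(\<Union>n. Fil n) = carrier H"
proof
  show "(\<Union>n. Fil n) \<subseteq> carrier H" using Fil_closed by blast
  \<comment> \<open>An increasing union: two elements lie in a common step, the one with the maximal
    index.\<close>
  have sub: "submodule (\<Union>n. Fil n) R H"
  proof (rule submodule_crit[OF H_module])
    fix x y assume "x \<in> (\<Union>n. Fil n)" "y \<in> (\<Union>n. Fil n)"
    then obtain m n where "x \<in> Fil m" "y \<in> Fil n" by blast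
    then have "x \<in> Fil (max m n)" "y \<in> Fil (max m n)"
      using Fil_mono[of m "max m n"] Fil_mono[of n "max m n"] by auto
    then show "x \<oplus>\<^bsub>H\<^esub> y \<in> (\<Union>n. Fil n)"
      using submodule_add[OF Fil_submodule] by blast
  next
    fix r x assume "r \<in> carrier R" "x \<in> (\<Union>n. Fil n)"
    then show "r \<odot>\<^bsub>H\<^esub> x \<in> (\<Union>n. Fil n)"
      using submodule_smult[OF Fil_submodule] by blast
  next
    show "\<zero>\<^bsub>H\<^esub> \<in> (\<Union>n. Fil n)"
      using submodule_zero[OF Fil_submodule] by blast
  next
    show "(\<Union>n. Fil n) \<subseteq> carrier H" using Fil_closed by blast
  qed
  have "u \<in> (\<Union>n. Fil n)" if u: "u \<in> carrier H" for u
  proof (rule lin_map_span_closed[OF lin_map_id H_module H_module sub])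
    show "bv ` forests X \<Omega> \<subseteq> carrier H" using bv_closed by blast
    have "lin_span R H S = lin_span R M S" for S
      by (simp add: lin_span_def submodule_def submodule_axioms_def)
    then show "u \<in> lin_span R H (bv ` forests X \<Omega>)"
      using u by (simp add: free_module_span[OF R])
  qed (use bv_Fil in blast)
  then show "carrier H \<subseteq> (\<Union>n. Fil n)" by blast
qed

lemma tree_verts_nonzero: "tree_verts t \<noteq> 0"
  by (cases t) simp_all

text \<open>Connectedness. Every tree has a vertex, so the empty forest is the only basis element in
  step 0.\<close>

lemma Fil_0: "Fil 0 = (\<lambda>r. r \<odot>\<^bsub>H\<^esub> \<one>\<^bsub>H\<^esub>) ` carrier R"
proof
  have sub: "submodule ((\<lambda>r. r \<odot>\<^bsub>H\<^esub> \<one>\<^bsub>H\<^esub>) ` carrier R) R H"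
  proof (rule submodule_crit[OF H_module])
    show "\<zero>\<^bsub>H\<^esub> \<in> (\<lambda>r. r \<odot>\<^bsub>H\<^esub> \<one>\<^bsub>H\<^esub>) ` carrier R"
      using H.smult_l_null[OF H.one_closed] by (intro image_eqI[of _ _ "\<zero>\<^bsub>R\<^esub>"]) (simp_all del: H_RT_simps)
    fix x y assume "x \<in> (\<lambda>r. r \<odot>\<^bsub>H\<^esub> \<one>\<^bsub>H\<^esub>) ` carrier R" "y \<in> (\<lambda>r. r \<odot>\<^bsub>H\<^esub> \<one>\<^bsub>H\<^esub>) ` carrier R"
    then show "x \<oplus>\<^bsub>H\<^esub> y \<in> (\<lambda>r. r \<odot>\<^bsub>H\<^esub> \<one>\<^bsub>H\<^esub>) ` carrier R"
      by (auto simp del: H_RT_simps simp flip: H.smult_l_distr[OF _ _ H.one_closed])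
  next
    fix r x assume "r \<in> carrier R" "x \<in> (\<lambda>r. r \<odot>\<^bsub>H\<^esub> \<one>\<^bsub>H\<^esub>) ` carrier R"
    then show "r \<odot>\<^bsub>H\<^esub> x \<in> (\<lambda>r. r \<odot>\<^bsub>H\<^esub> \<one>\<^bsub>H\<^esub>) ` carrier R"
      by (auto simp del: H_RT_simps simp flip: H.smult_assoc1[OF _ _ H.one_closed])
  qed (use H.smult_closed[OF _ H.one_closed] in blast)
  have "Fil_basis 0 \<subseteq> {\<one>\<^bsub>H\<^esub>}"
  proof
    fix s assume "s \<in> Fil_basis 0"
    then obtain F where "s = bv F" "forest_verts F = 0" unfolding Fil_basis_def by auto
    then show "s \<in> {\<one>\<^bsub>H\<^esub>}" by (cases F) (simp_all add: tree_verts_nonzero)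
  qed
  also have "\<dots> \<subseteq> (\<lambda>r. r \<odot>\<^bsub>H\<^esub> \<one>\<^bsub>H\<^esub>) ` carrier R"
    using H.smult_one[OF H.one_closed] by (auto intro!: image_eqI[of _ _ "\<one>\<^bsub>R\<^esub>"] simp del: H_RT_simps)
  finally show "Fil 0 \<subseteq> (\<lambda>r. r \<odot>\<^bsub>H\<^esub> \<one>\<^bsub>H\<^esub>) ` carrier R"
    unfolding Fil_span by (rule lin_span_least[OF sub])
  show "(\<lambda>r. r \<odot>\<^bsub>H\<^esub> \<one>\<^bsub>H\<^esub>) ` carrier R \<subseteq> Fil 0"
    using submodule_smult[OF Fil_submodule _ one_Fil] by blast
qed

lemma connected_cofiltered: "connected_cofiltered_coalgebra R H \<Delta> \<epsilon> (\<lambda>r. r \<odot>\<^bsub>H\<^esub> \<one>\<^bsub>H\<^esub>) Fil"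
proof -
  interpret CB: cocycle_bialgebra R \<Omega> lam H \<Delta> \<epsilon> B by (rule cocycle_bialgebra)
  show ?thesis
  proof (intro connected_cofiltered_coalgebra.intro connected_cofiltered_coalgebra_axioms.intro)
    show "coalgebra R H \<Delta> \<epsilon>" by (rule CB.coalgebra_axioms)
    show "(\<lambda>r. r \<odot>\<^bsub>H\<^esub> \<one>\<^bsub>H\<^esub>) \<in> lin_map R (ground R) H"
      by (rule lin_map_smult_vec[OF H_module H.one_closed lin_map_id])
    show "\<epsilon> (r \<odot>\<^bsub>H\<^esub> \<one>\<^bsub>H\<^esub>) = r" if "r \<in> carrier R" for r
      unfolding lin_map_smult[OF counit_linear that H.one_closed] counit_one using that by simp
    show "submodule (Fil n) R H" for n by (rule Fil_submodule)
    show "Fil n \<subseteq> Fil (Suc n)" for n by (rule Fil_mono) simp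
    show "(\<Union>n. Fil n) = carrier H" by (rule Fil_exhaustive)
    show "(\<lambda>r. r \<odot>\<^bsub>H\<^esub> \<one>\<^bsub>H\<^esub>) ` carrier R \<subseteq> Fil n" for n
      unfolding Fil_0[symmetric] by (rule Fil_mono) simp
    show "\<Delta> ` Fil n \<subseteq> lin_span R T {a \<diamondop> b | a b p q. p + q = n \<and> a \<in> Fil p \<and> b \<in> Fil q}" for n
      using comult_Fil2 unfolding Fil2_def Fil2_gens_def by blast
    show "Fil 0 = (\<lambda>r. r \<odot>\<^bsub>H\<^esub> \<one>\<^bsub>H\<^esub>) ` carrier R" by (rule Fil_0)
  qed
qed

lemma cocycle_hopf_algebra: "cocycle_hopf_algebra R \<Omega> lam H \<Delta> \<epsilon> B"
proof -
  interpret CB: cocycle_bialgebra R \<Omega> lam H \<Delta> \<epsilon> B by (rule cocycle_bialgebra)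
  have "hopf_algebra R H \<Delta> \<epsilon>"
    by (rule connected_cofiltered_bialgebra.hopf_algebra[OF connected_cofiltered_bialgebra.intro[OF
            CB.bialgebra_axioms connected_cofiltered]])
  then show ?thesis
    by (intro cocycle_hopf_algebra.intro cocycle_bialgebra)
qed

end

theorem theorem3p16:
  fixes R :: "'k ring" and X :: "'x set" and \<Omega> :: "'w set"
    and \<mu> :: "'x \<Rightarrow> 'k" and lam :: "'w \<Rightarrow> 'k"
  assumes "cring R" and "\<Omega> \<noteq> {}" and "\<mu> \<in> X \<rightarrow> carrier R" and "lam \<in> \<Omega> \<rightarrow> carrier R"
  shows
    "(cocycle_bialgebra R \<Omega> lam (H_RT R X \<Omega>) (Delta_RT R X \<Omega> \<mu> lam) (eps_RT R \<mu> lam) (B_RT R X \<Omega>) \<and>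
      (\<forall>(A :: ('k, 'a) module) \<Delta> \<epsilon> P f.
        cocycle_bialgebra R \<Omega> lam A \<Delta> \<epsilon> P \<and> f \<in> X \<rightarrow> carrier A \<and>
        (\<forall>x\<in>X. \<Delta> (f x) = pure_tensor R A A (f x) \<one>\<^bsub>A\<^esub>
           \<oplus>\<^bsub>tensor_module R A A\<^esub> pure_tensor R A A \<one>\<^bsub>A\<^esub> (f x)
           \<oplus>\<^bsub>tensor_module R A A\<^esub> \<mu> x \<odot>\<^bsub>tensor_module R A A\<^esub> pure_tensor R A A \<one>\<^bsub>A\<^esub> \<one>\<^bsub>A\<^esub>)
        \<longrightarrow> (\<exists>!h. h \<in> extensional (carrier (H_RT R X \<Omega>)) \<and>
              h \<in> operated_bialgebra_hom R \<Omega>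
                (H_RT R X \<Omega>) (Delta_RT R X \<Omega> \<mu> lam) (eps_RT R \<mu> lam) (B_RT R X \<Omega>) A \<Delta> \<epsilon> P \<and>
              (\<forall>x\<in>X. h (j_RT R x) = f x))))
     \<and>
     (connected_cofiltered_coalgebra R (H_RT R X \<Omega>) (Delta_RT R X \<Omega> \<mu> lam) (eps_RT R \<mu> lam)
        (u_RT R X \<Omega>) (Fil_RT R X \<Omega>) \<and>
      cocycle_hopf_algebra R \<Omega> lam (H_RT R X \<Omega>) (Delta_RT R X \<Omega> \<mu> lam) (eps_RT R \<mu> lam) (B_RT R X \<Omega>) \<and>
      (\<forall>(A :: ('k, 'a) module) \<Delta> \<epsilon> P f.
        cocycle_hopf_algebra R \<Omega> lam A \<Delta> \<epsilon> P \<and> f \<in> X \<rightarrow> carrier A \<and>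
        (\<forall>x\<in>X. \<Delta> (f x) = pure_tensor R A A (f x) \<one>\<^bsub>A\<^esub>
           \<oplus>\<^bsub>tensor_module R A A\<^esub> pure_tensor R A A \<one>\<^bsub>A\<^esub> (f x)
           \<oplus>\<^bsub>tensor_module R A A\<^esub> \<mu> x \<odot>\<^bsub>tensor_module R A A\<^esub> pure_tensor R A A \<one>\<^bsub>A\<^esub> \<one>\<^bsub>A\<^esub>)
        \<longrightarrow> (\<exists>!h. h \<in> extensional (carrier (H_RT R X \<Omega>)) \<and>
              h \<in> operated_bialgebra_hom R \<Omega>
                (H_RT R X \<Omega>) (Delta_RT R X \<Omega> \<mu> lam) (eps_RT R \<mu> lam) (B_RT R X \<Omega>) A \<Delta> \<epsilon> P \<and>
              (\<forall>x\<in>X. h (j_RT R x) = f x))))"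
proof -
  interpret forest_bialgebra R X \<Omega> \<mu> lam
    using assms by (intro forest_bialgebra.intro forest_algebra.intro forest_bialgebra_axioms.intro)
  have u: "u_RT R X \<Omega> = (\<lambda>r. r \<odot>\<^bsub>H\<^esub> \<one>\<^bsub>H\<^esub>)"
    by (rule ext) (simp only: u_RT_def)
  show ?thesis
    unfolding u
    \<comment> \<open>For the Hopf half the target is replaced by its underlying cocycle bialgebra:
      the homomorphisms are those of operated bialgebras in both halves, so the same universal
      property applies.\<close>
    by (intro conjI allI impI; (elim conjE)?;
        (rule cocycle_bialgebra connected_cofiltered cocycle_hopf_algebra
        | rule universal_property;
          (assumption | erule cocycle_hopf_algebra.axioms(1) | erule bspec, assumption)))
qed

end
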